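(* Let $A_1\in\mathbb{C}_{\rm H}^{m_1}$, $B_1\in\mathbb{C}^{m_1\times n}$ and $A_4,B_4\in\mathbb{C}^{m\times n}$ be given. Assume that the matrix equation $B_4X=A_4$ has a nonnegative definite solution, i.e., $\mathscr{R}(A_4)\subseteq\mathscr{R}(B_4)$, $A_4B_4^{*}\geqslant0$ and $r(A_4B_4^{*})=r(A_4)$, and let $$\mathcal{S}=\{0\leqslant X\in\mathbb{C}_{\rm H}^{n}\mid B_4X=A_4\},$$ $$M_1=\begin{bmatrix} A_1 & B_1 \\ A_4B_1^{*} & B_4 \end{bmatrix},\quad M_2=\begin{bmatrix} A_1 & B_1A_4^{*} \\ A_4B_1^{*} & A_4B_4^{*} \end{bmatrix},\quad N=\begin{bmatrix} A_1 & B_1 & 0 \\ B_1^{*} & 0 & B_4^{*} \\ 0 & B_4 & -A_4B_4^{*} \end{bmatrix}.$$ Then $$\max_{X\in\mathcal{S}}r(A_1-B_1XB_1^{*})=r(M_1)-r(B_4),\qquad \min_{X\in\mathcal{S}}r(A_1-B_1XB_1^{*})=r(M_1)+i_{-}(M_2)-i_{-}(N),$$ $$\max_{X\in\mathcal{S}}i_{+}(A_1-B_1XB_1^{*})=i_{+}(M_2)-r(A_4),\qquad \min_{X\in\mathcal{S}}i_{+}(A_1-B_1XB_1^{*})=r(M_1)-i_{-}(N),$$ $$\max_{X\in\mathcal{S}}i_{-}(A_1-B_1XB_1^{*})=i_{-}(N)-r(A_4),\qquad \min_{X\in\mathcal{S}}i_{-}(A_1-B_1XB_1^{*})=i_{-}(M_2).$$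 In consequence: (a) $B_4X=A_4$ has a nonnegative definite solution such that $A_1-B_1XB_1^{*}$ is nonsingular if and only if $r(M_1)=r(B_4)+m_1$. (b) $A_1-B_1XB_1^{*}$ is nonsingular for all nonnegative definite solutions of $B_4X=A_4$ if and only if $r(M_1)+i_{-}(M_2)=i_{-}(N)+m_1$. (c) The pair of matrix equations $B_1XB_1^{*}=A_1$ and $B_4X=A_4$ have a common nonnegative definite solution if and only if $r(M_1)+i_{-}(M_2)=i_{-}(N)$. (d) $B_1XB_1^{*}=A_1$ holds for all nonnegative definite solutions of $B_4X=A_4$ if and only if $r(M_1)=r(B_4)$. (e) $B_4X=A_4$ has a solution $X\in\mathbb{C}_{\rm H}^{n}$ such that $A_1-B_1XB_1^{*}>0$ if and only if $i_{+}(M_2)=r(A_4)+m_1$. (f) $A_1-B_1XB_1^{*}>0$ holds for all Hermitian solutions of $B_4X=A_4$ if and only if $r(M_1)=i_{-}(N)+m_1$. (g) $B_4X=A_4$ has a solution $X\in\mathbb{C}_{\rm H}^{n}$ such that $A_1-B_1XB_1^{*}<0$ if and only if $i_{-}(N)=r(A_4)+m_1$. (h) $A_1-B_1XB_1^{*}<0$ holds for all Hermitian solutions of $B_4X=A_4$ if and only if $i_{-}(M_2)=m_1$. (i) $B_4X=A_4$ has a solution $X\in\mathbb{C}_{\rm H}^{n}$ such that $A_1-B_1XB_1^{*}\geqslant0$ if and only if $M_2\geqslant0$. (j) $A_1-B_1XB_1^{*}\geqslant0$ holds for all Hermitian solutions of $B_4X=A_4$ if and only if $i_{-}(N)=r(A_4)$.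 (k) $B_4X=A_4$ has a solution $X\in\mathbb{C}_{\rm H}^{n}$ such that $A_1-B_1XB_1^{*}\leqslant0$ if and only if $r(M_1)=i_{-}(N)$. (l) $A_1-B_1XB_1^{*}\leqslant0$ holds for all Hermitian solutions of $B_4X=A_4$ if and only if $i_{+}(M_2)=r(A_4)$.
   Context: $\mathbb{C}^{m\times n}$ is the set of $m\times n$ complex matrices, $\mathbb{C}_{\rm H}^{m}$ is the set of $m\times m$ complex Hermitian matrices, $A^{*}$ the conjugate transpose, $r(A)$ the rank, $\mathscr{R}(A)$ the range (column space). For Hermitian $A$, $i_{+}(A)$ and $i_{-}(A)$ are the numbers of positive and negative eigenvalues counted with multiplicity; $A>0$ ($A\geqslant0$, $A<0$, $A\leqslant 0$) means $A$ is positive definite (positive semi-definite, negative definite, negative semi-definite). "Nonnegative definite solution" means a Hermitian solution $X\geqslant0$.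
   Formalization: In the formula for max i_-, (g) and (j), r(A_4) is corrected to r(B_4); in (e), (h), (i), (l) the Hermitian solutions are restricted to nonnegative definite ones (X in S), because the printed claims are false there. *)

theory Defs
  imports
    "Jordan_Normal_Form.Schur_Decomposition"
    "Jordan_Normal_Form.DL_Rank"
begin

notation mat_adjoint ("_\<^sup>H" [1000] 999)

abbreviation mat_rank :: "complex mat \<Rightarrow> nat" where
  "mat_rank A \<equiv> vec_space.rank (dim_row A) A"

abbreviation mat_range :: "complex mat \<Rightarrow> complex vec set" where
  "mat_range A \<equiv> vec_space.col_space (dim_row A) A"

definition hermitian :: "complex mat \<Rightarrow> bool" where
  "hermitian A \<longleftrightarrow> A\<^sup>H = A"

(* The inner product (A *\<^sub>v v) \<bullet>c v is v\<^sup>* A v, which is real for Hermitian A;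
   taking Re only moves it to type real. *)
definition quad_form :: "complex mat \<Rightarrow> complex vec \<Rightarrow> real" where
  "quad_form A v = Re ((A *\<^sub>v v) \<bullet>c v)"

definition pos_def :: "complex mat \<Rightarrow> bool" where
  "pos_def A \<longleftrightarrow> hermitian A \<and>
     (\<forall>v \<in> carrier_vec (dim_row A). v \<noteq> 0\<^sub>v (dim_row A) \<longrightarrow> quad_form A v > 0)"

definition pos_semidef :: "complex mat \<Rightarrow> bool" where
  "pos_semidef A \<longleftrightarrow> hermitian A \<and> (\<forall>v \<in> carrier_vec (dim_row A). quad_form A v \<ge> 0)"

definition neg_def :: "complex mat \<Rightarrow> bool" where
  "neg_def A \<longleftrightarrow> hermitian A \<and>
     (\<forall>v \<in> carrier_vec (dim_row A). v \<noteq> 0\<^sub>v (dim_row A) \<longrightarrow> quad_form A v < 0)"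

definition neg_semidef :: "complex mat \<Rightarrow> bool" where
  "neg_semidef A \<longleftrightarrow> hermitian A \<and> (\<forall>v \<in> carrier_vec (dim_row A). quad_form A v \<le> 0)"

(* Only real eigenvalues are counted, each with its algebraic multiplicity. For Hermitian
   matrices, the intended arguments, these are all the eigenvalues and the algebraic and
   geometric multiplicities agree. *)
definition pos_inertia :: "complex mat \<Rightarrow> nat" ("i\<^sub>+") where
  "i\<^sub>+ A = (\<Sum>x | x > 0 \<and> eigenvalue A (complex_of_real x).
              order (complex_of_real x) (char_poly A))"

definition neg_inertia :: "complex mat \<Rightarrow> nat" ("i\<^sub>-") where
  "i\<^sub>- A = (\<Sum>x | x < 0 \<and> eigenvalue A (complex_of_real x).
              order (complex_of_real x) (char_poly A))"

(* C stacked on F is the right column; the bottom row [G H] is the transpose of G\<^sup>T stacked on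
   H\<^sup>T, since the library concatenates matrices only vertically. *)
definition block33 ::
  "complex mat \<Rightarrow> complex mat \<Rightarrow> complex mat \<Rightarrow>
   complex mat \<Rightarrow> complex mat \<Rightarrow> complex mat \<Rightarrow>
   complex mat \<Rightarrow> complex mat \<Rightarrow> complex mat \<Rightarrow> complex mat" where
  "block33 A B C D E F G H K =
     four_block_mat (four_block_mat A B D E) (C @\<^sub>r F)
                    (((G\<^sup>T) @\<^sub>r (H\<^sup>T))\<^sup>T) K"

definition hermitian_solutions :: "complex mat \<Rightarrow> complex mat \<Rightarrow> complex mat set" where
  "hermitian_solutions B A =
     {X \<in> carrier_mat (dim_col B) (dim_col B). hermitian X \<and> B * X = A}"

definition nonneg_solutions :: "complex mat \<Rightarrow> complex mat \<Rightarrow> complex mat set" where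
  "nonneg_solutions B A =
     {X \<in> carrier_mat (dim_col B) (dim_col B). pos_semidef X \<and> B * X = A}"

end

theory Submission
  imports Defs
begin

text \<open>Every Hermitian solution \<open>X\<close> of \<open>B4 X = A4\<close> turns the block matrices into forms in
  \<open>P = A1 - B1 X B1\<^sup>*\<close>: with \<open>u = B1\<^sup>* x + B4\<^sup>* w\<close>, the form of \<open>M2\<close> at \<open>(x, w)\<close> is
  \<open>x\<^sup>* P x + u\<^sup>* X u\<close>, and that of \<open>N\<close> at \<open>(x, y, w)\<close> is congruent to \<open>x\<^sup>* P x + 2 Re (y\<^sup>* u)\<close>, while
  the kernel of \<open>M1\<^sup>*\<close> is given by \<open>P x = 0\<close>, \<open>u = 0\<close>. Comparing dimensions of definite subspaces
  and kernels gives all bounds. The smallest solution \<open>A4\<^sup>* Z\<close> attains the maximal \<open>i\<^sub>+\<close> and the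
  minimal \<open>i\<^sub>-\<close>; adding a large multiple of \<open>K K\<^sup>*\<close>, with \<open>K\<close> a projection onto the kernel of \<open>B4\<close>,
  attains the minimal \<open>i\<^sub>+\<close>, the maximal \<open>i\<^sub>-\<close> and the maximal rank. For the minimal rank, as long as
  \<open>i\<^sub>+ P + i\<^sub>- N > r(M1)\<close> a kernel vector of \<open>M1\<close> yields \<open>x\<close> and \<open>y\<close> with \<open>x\<^sup>* P x > 0\<close>, \<open>P x = - B1 y\<close>
  and \<open>B4 y = 0\<close>; passing from \<open>X\<close> to \<open>X + y y\<^sup>* / (x\<^sup>* P x)\<close> lowers \<open>i\<^sub>+ P\<close> without raising \<open>i\<^sub>- P\<close>.\<close>

section \<open>Adjoints and the real inner product\<close>

text \<open>The minimal rank is the hard value. A small solution keeps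
  \<open>i\<^sub>- (P X)\<close> low and a large one keeps \<open>i\<^sub>+ (P X)\<close> low, so
  the two minima are reached at opposite ends of the solution set, while the rank asks for both at
  once. A step that enlarges \<open>X\<close> must therefore remove a positive direction of
  \<open>P X\<close> without creating a negative one; the relation between \<open>P x\<close> and
  \<open>B1 y\<close> is what makes the rank-one step do exactly this. The two corrections
  \<open>r(A4)\<close> and \<open>r(B4)\<close> differ in origin. At \<open>x = 0\<close> the form
  of \<open>M2\<close> is that of \<open>X\<close> at \<open>B4\<^sup>H w\<close>, which for
  \<open>X \<ge> 0\<close> vanishes only if \<open>A4\<^sup>H w = 0\<close>: this accounts for
  \<open>r(A4)\<close>. At \<open>x = 0\<close> the border of \<open>N\<close> pairs a free
  \<open>y\<close> with \<open>B4\<^sup>H w\<close>, which accounts for \<open>r(B4)\<close>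
  whatever \<open>A4\<close> is; for \<open>A1 = 0\<close>, \<open>B1 = 0\<close>,
  \<open>A4 = 0\<close> one has \<open>i\<^sub>- N = r(B4)\<close>, while
  \<open>P X = 0\<close>.\<close>

lemma dim_mat_adjoint [simp]:
  "dim_row (A\<^sup>H) = dim_col A" "dim_col (A\<^sup>H) = dim_row A"
  by (simp_all add: mat_adjoint_def)

lemma mat_adjoint_carrier [simp]: "A\<^sup>H \<in> carrier_mat k n \<longleftrightarrow> A \<in> carrier_mat n k"
  by (metis carrier_matD carrier_matI dim_mat_adjoint)

lemma index_mat_adjoint [simp]:
  "i < dim_col A \<Longrightarrow> j < dim_row A \<Longrightarrow> A\<^sup>H $$ (i, j) = conjugate (A $$ (j, i))"
  by (simp add: mat_adjoint_def mat_of_rows_def)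

lemma mat_adjoint_adjoint [simp]: "(A\<^sup>H)\<^sup>H = (A :: complex mat)"
  by (rule eq_matI) auto

lemma mat_adjoint_mult:
  fixes A B :: "complex mat"
  assumes "A \<in> carrier_mat n k" "B \<in> carrier_mat k l"
  shows "(A * B)\<^sup>H = B\<^sup>H * A\<^sup>H"
  using assms
  by (intro eq_matI) (auto simp: scalar_prod_def sum_conjugate conjugate_dist_mul mult.commute
      intro!: sum.cong)

lemma mat_adjoint_add:
  fixes A B :: "complex mat"
  assumes "A \<in> carrier_mat n k" "B \<in> carrier_mat n k"
  shows "(A + B)\<^sup>H = A\<^sup>H + B\<^sup>H"
  using assms by (intro eq_matI) (auto simp: conjugate_dist_add)

lemma mat_adjoint_minus:
  fixes A B :: "complex mat"
  assumes "A \<in> carrier_mat n k" "B \<in> carrier_mat n k"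
  shows "(A - B)\<^sup>H = A\<^sup>H - B\<^sup>H"
  using assms by (intro eq_matI) auto

lemma mat_adjoint_uminus: "(- A :: complex mat)\<^sup>H = - (A\<^sup>H)"
  by (intro eq_matI) auto

lemma mat_adjoint_smult_real: "(complex_of_real t \<cdot>\<^sub>m A)\<^sup>H = complex_of_real t \<cdot>\<^sub>m A\<^sup>H"
  by (intro eq_matI) auto

lemma mat_adjoint_one [simp]: "(1\<^sub>m n :: complex mat)\<^sup>H = 1\<^sub>m n"
  by (intro eq_matI) auto

lemma mat_adjoint_zero [simp]: "(0\<^sub>m n k :: complex mat)\<^sup>H = 0\<^sub>m k n"
  by (intro eq_matI) auto

lemma mat_adjoint_four_block:
  fixes A :: "complex mat"
  assumes "A \<in> carrier_mat n1 k1" "B \<in> carrier_mat n1 k2" "C \<in> carrier_mat n2 k1"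
    "D \<in> carrier_mat n2 k2"
  shows "(four_block_mat A B C D)\<^sup>H = four_block_mat (A\<^sup>H) (C\<^sup>H) (B\<^sup>H) (D\<^sup>H)"
  using assms by (intro eq_matI) auto

lemma cscalar_prod_adjoint:
  fixes A :: "complex mat"
  assumes A: "A \<in> carrier_mat n k" and x: "x \<in> carrier_vec k" and y: "y \<in> carrier_vec n"
  shows "(A *\<^sub>v x) \<bullet>c y = x \<bullet>c (A\<^sup>H *\<^sub>v y)"
proof -
  have "(A *\<^sub>v x) \<bullet>c y = (\<Sum>i<n. \<Sum>j<k. A $$ (i,j) * x $ j * conjugate (y $ i))"
    using assms by (auto simp: scalar_prod_def sum_distrib_right lessThan_atLeast0 intro!: sum.cong)
  also have "\<dots> = (\<Sum>j<k. \<Sum>i<n. A $$ (i,j) * x $ j * conjugate (y $ i))"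
    by (rule sum.swap)
  also have "\<dots> = x \<bullet>c (A\<^sup>H *\<^sub>v y)"
    using assms by (auto simp: scalar_prod_def sum_distrib_left lessThan_atLeast0 sum_conjugate
        conjugate_dist_mul mult_ac intro!: sum.cong)
  finally show ?thesis .
qed

text \<open>The real part makes the product a symmetric real bilinear form, so that polarization has
  one cross term and completing squares needs no complex conjugates.\<close>

definition re_inner :: "complex vec \<Rightarrow> complex vec \<Rightarrow> real" where
  "re_inner x y = Re (x \<bullet>c y)"

lemma quad_form_re_inner: "quad_form A x = re_inner (A *\<^sub>v x) x"
  by (simp add: quad_form_def re_inner_def)

lemma re_inner_sum: "x \<in> carrier_vec n \<Longrightarrow> y \<in> carrier_vec n \<Longrightarrow>
    re_inner x y = (\<Sum>i<n. Re (x $ i * cnj (y $ i)))"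
  by (auto simp: re_inner_def scalar_prod_def lessThan_atLeast0 intro!: sum.cong)

lemma re_inner_add_left: "x \<in> carrier_vec n \<Longrightarrow> y \<in> carrier_vec n \<Longrightarrow> z \<in> carrier_vec n \<Longrightarrow>
    re_inner (x + y) z = re_inner x z + re_inner y z"
  by (simp add: re_inner_sum[of _ n] algebra_simps sum.distrib)

lemma re_inner_commute: "x \<in> carrier_vec n \<Longrightarrow> y \<in> carrier_vec n \<Longrightarrow> re_inner x y = re_inner y x"
  by (simp add: re_inner_sum[of _ n] algebra_simps)

lemma re_inner_add_right: "x \<in> carrier_vec n \<Longrightarrow> y \<in> carrier_vec n \<Longrightarrow> z \<in> carrier_vec n \<Longrightarrow>
    re_inner z (x + y) = re_inner z x + re_inner z y"
  by (simp add: re_inner_sum[of _ n] algebra_simps sum.distrib)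

lemma re_inner_minus_left: "x \<in> carrier_vec n \<Longrightarrow> y \<in> carrier_vec n \<Longrightarrow> z \<in> carrier_vec n \<Longrightarrow>
    re_inner (x - y) z = re_inner x z - re_inner y z"
  by (simp add: re_inner_sum[of _ n] algebra_simps sum_subtractf)

lemma re_inner_smult_left: "x \<in> carrier_vec n \<Longrightarrow> y \<in> carrier_vec n \<Longrightarrow>
    re_inner (complex_of_real t \<cdot>\<^sub>v x) y = t * re_inner x y"
  by (simp add: re_inner_sum[of _ n] sum_distrib_left algebra_simps)

lemma re_inner_smult_right: "x \<in> carrier_vec n \<Longrightarrow> y \<in> carrier_vec n \<Longrightarrow>
    re_inner x (complex_of_real t \<cdot>\<^sub>v y) = t * re_inner x y"
  by (simp add: re_inner_sum[of _ n] sum_distrib_left algebra_simps)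

lemma re_inner_uminus_left: "x \<in> carrier_vec n \<Longrightarrow> y \<in> carrier_vec n \<Longrightarrow>
    re_inner (- x) y = - re_inner x y"
  by (simp add: re_inner_sum[of _ n] sum_negf sum_subtractf)

lemma re_inner_zero [simp]: "x \<in> carrier_vec n \<Longrightarrow> re_inner (0\<^sub>v n) x = 0"
  "x \<in> carrier_vec n \<Longrightarrow> re_inner x (0\<^sub>v n) = 0"
  by (simp_all add: re_inner_sum[of _ n])

lemma re_inner_self: "x \<in> carrier_vec n \<Longrightarrow> re_inner x x = (\<Sum>i<n. (cmod (x $ i))\<^sup>2)"
  unfolding re_inner_sum[of x n x] by (rule sum.cong) (simp_all add: cmod_power2 flip: power2_eq_square)

lemma re_inner_self_ge_0 [simp]: "x \<in> carrier_vec n \<Longrightarrow> 0 \<le> re_inner x x"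
  by (simp add: re_inner_self sum_nonneg)

lemma re_inner_self_eq_0:
  assumes "x \<in> carrier_vec n" shows "re_inner x x = 0 \<longleftrightarrow> x = 0\<^sub>v n"
  using assms by (auto simp: re_inner_self sum_nonneg_eq_0_iff)

lemma re_inner_self_pos: "x \<in> carrier_vec n \<Longrightarrow> x \<noteq> 0\<^sub>v n \<Longrightarrow> 0 < re_inner x x"
  using re_inner_self_eq_0[of x n] re_inner_self_ge_0[of x n] by linarith

lemma re_inner_adjoint:
  assumes "A \<in> carrier_mat n k" "x \<in> carrier_vec k" "y \<in> carrier_vec n"
  shows "re_inner (A *\<^sub>v x) y = re_inner x (A\<^sup>H *\<^sub>v y)"
  using cscalar_prod_adjoint[OF assms] by (simp add: re_inner_def)

lemma re_inner_append:
  assumes "a \<in> carrier_vec n" "b \<in> carrier_vec k" "c \<in> carrier_vec n" "d \<in> carrier_vec k"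
  shows "re_inner (a @\<^sub>v b) (c @\<^sub>v d) = re_inner a c + re_inner b d"
proof -
  have "conjugate (c @\<^sub>v d) = conjugate c @\<^sub>v conjugate d"
    by (rule eq_vecI) auto
  then show ?thesis
    using assms by (simp add: re_inner_def scalar_prod_append[of _ n _ k])
qed

lemma hermitian_re_inner:
  assumes "A \<in> carrier_mat n n" "hermitian A" "x \<in> carrier_vec n" "y \<in> carrier_vec n"
  shows "re_inner (A *\<^sub>v x) y = re_inner (A *\<^sub>v y) x"
  using assms re_inner_adjoint[of A n n x y] re_inner_commute[of x n "A *\<^sub>v y"]
  by (simp add: hermitian_def)

lemma quad_form_add:
  assumes "A \<in> carrier_mat n n" "hermitian A" "x \<in> carrier_vec n" "y \<in> carrier_vec n"
  shows "quad_form A (x + y) = quad_form A x + quad_form A y + 2 * re_inner (A *\<^sub>v x) y"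
  using assms hermitian_re_inner[OF assms]
  by (simp add: quad_form_re_inner mult_add_distrib_mat_vec[of A n n] re_inner_add_left[of _ n]
      re_inner_add_right[of _ n] mult_mat_vec_carrier[of A n n])

lemma quad_form_zero [simp]: "A \<in> carrier_mat n n \<Longrightarrow> quad_form A (0\<^sub>v n) = 0"
  by (simp add: quad_form_re_inner mult_mat_vec_carrier[of A n n])

lemma quad_form_uminus:
  assumes "A \<in> carrier_mat n n" "x \<in> carrier_vec n"
  shows "quad_form (- A) x = - quad_form A x"
  using assms by (simp add: quad_form_re_inner re_inner_uminus_left[of _ n])

lemma hermitian_uminus: "hermitian A \<Longrightarrow> hermitian (- A)"
  by (simp add: hermitian_def mat_adjoint_uminus)

section \<open>Linear maps between coordinate spaces\<close>

text \<open>Subspaces are never formed as sets. An injective \<open>lin k n f\<close> stands for a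
  subspace of dimension \<open>k\<close>, the zero set of a \<open>lin n k g\<close> for one of
  codimension at most \<open>k\<close>, and a dimension count is an application of
  \<open>lin_kernel_nontrivial\<close>. The matrix is prescribed on \<open>carrier_vec k\<close>
  only, since vectors of all lengths share one type.\<close>

definition lin :: "nat \<Rightarrow> nat \<Rightarrow> (complex vec \<Rightarrow> complex vec) \<Rightarrow> bool" where
  "lin k n f \<longleftrightarrow> (\<exists>V\<in>carrier_mat n k. \<forall>c\<in>carrier_vec k. f c = V *\<^sub>v c)"

lemma linI: "V \<in> carrier_mat n k \<Longrightarrow> (\<And>c. c \<in> carrier_vec k \<Longrightarrow> f c = V *\<^sub>v c) \<Longrightarrow> lin k n f"
  by (auto simp: lin_def)

lemma linE:
  assumes "lin k n f"
  obtains V where "V \<in> carrier_mat n k" "\<And>c. c \<in> carrier_vec k \<Longrightarrow> f c = V *\<^sub>v c"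
  using assms by (auto simp: lin_def)

lemma lin_carrier: "lin k n f \<Longrightarrow> c \<in> carrier_vec k \<Longrightarrow> f c \<in> carrier_vec n"
  by (auto elim!: linE simp: mult_mat_vec_carrier)

lemma lin_zero_arg: "lin k n f \<Longrightarrow> f (0\<^sub>v k) = 0\<^sub>v n"
  by (auto elim!: linE)

lemma lin_id: "lin k k (\<lambda>c. c)"
  by (rule linI[of "1\<^sub>m k"]) auto

lemma lin_compose:
  assumes "lin n l g" "lin k n f" shows "lin k l (\<lambda>c. g (f c))"
proof -
  obtain W V where W: "W \<in> carrier_mat l n" "\<And>c. c \<in> carrier_vec n \<Longrightarrow> g c = W *\<^sub>v c"
    and V: "V \<in> carrier_mat n k" "\<And>c. c \<in> carrier_vec k \<Longrightarrow> f c = V *\<^sub>v c"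
    using assms by (metis linE)
  then show ?thesis
    by (intro linI[of "W * V"]) (auto simp: mult_mat_vec_carrier)
qed

lemma lin_mat: "A \<in> carrier_mat l n \<Longrightarrow> lin k n f \<Longrightarrow> lin k l (\<lambda>c. A *\<^sub>v f c)"
  by (rule lin_compose[of n l "\<lambda>c. A *\<^sub>v c"]) (auto intro: linI)

lemma lin_add:
  assumes "lin k n f" "lin k n g" shows "lin k n (\<lambda>c. f c + g c)"
proof -
  obtain V W where V: "V \<in> carrier_mat n k" "\<And>c. c \<in> carrier_vec k \<Longrightarrow> f c = V *\<^sub>v c"
    and W: "W \<in> carrier_mat n k" "\<And>c. c \<in> carrier_vec k \<Longrightarrow> g c = W *\<^sub>v c"
    using assms by (metis linE)
  then show ?thesis
    by (intro linI[of "V + W"]) (auto simp: add_mult_distrib_mat_vec)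
qed

lemma lin_uminus:
  assumes "lin k n f" shows "lin k n (\<lambda>c. - f c)"
proof -
  obtain V where V: "V \<in> carrier_mat n k" "\<And>c. c \<in> carrier_vec k \<Longrightarrow> f c = V *\<^sub>v c"
    using assms by (metis linE)
  then show ?thesis
    by (intro linI[of "- V"]) auto
qed

lemma lin_smult:
  assumes "lin k n f" shows "lin k n (\<lambda>c. a \<cdot>\<^sub>v f c)"
proof -
  obtain V where V: "V \<in> carrier_mat n k" "\<And>c. c \<in> carrier_vec k \<Longrightarrow> f c = V *\<^sub>v c"
    using assms by (metis linE)
  then show ?thesis
    by (intro linI[of "a \<cdot>\<^sub>m V"]) (auto intro!: eq_vecI)
qed

lemma lin_minus:
  assumes "lin k n f" "lin k n g" shows "lin k n (\<lambda>c. f c - g c)"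
proof -
  obtain V W where V: "V \<in> carrier_mat n k" "\<And>c. c \<in> carrier_vec k \<Longrightarrow> f c = V *\<^sub>v c"
    and W: "W \<in> carrier_mat n k" "\<And>c. c \<in> carrier_vec k \<Longrightarrow> g c = W *\<^sub>v c"
    using assms by (metis linE)
  then show ?thesis
    by (intro linI[of "V - W"]) (auto simp: minus_mult_distrib_mat_vec)
qed

lemma lin_append:
  assumes "lin k n1 f" "lin k n2 g" shows "lin k (n1 + n2) (\<lambda>c. f c @\<^sub>v g c)"
proof -
  obtain V W where V: "V \<in> carrier_mat n1 k" "\<And>c. c \<in> carrier_vec k \<Longrightarrow> f c = V *\<^sub>v c"
    and W: "W \<in> carrier_mat n2 k" "\<And>c. c \<in> carrier_vec k \<Longrightarrow> g c = W *\<^sub>v c"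
    using assms by (metis linE)
  then show ?thesis
    by (intro linI[of "V @\<^sub>r W"]) (auto simp: mat_mult_append)
qed

lemma lin_first: "lin (p + q) p (\<lambda>c. vec_first c p)"
proof (rule linI)
  fix c :: "complex vec" assume c: "c \<in> carrier_vec (p + q)"
  \<comment> \<open>The lower blocks have no rows: this is the single row of blocks [I 0].\<close>
  have "four_block_mat (1\<^sub>m p) (0\<^sub>m p q) (0\<^sub>m 0 p) (0\<^sub>m 0 q) *\<^sub>v (vec_first c p @\<^sub>v vec_last c q)
      = vec_first c p @\<^sub>v 0\<^sub>v 0"
    by (subst four_block_mat_mult_vec[of _ p p _ q _ 0]) auto
  moreover have "vec_first c p @\<^sub>v 0\<^sub>v 0 = vec_first c p"
    by (rule eq_vecI) auto
  ultimately show "vec_first c p =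
      four_block_mat (1\<^sub>m p) (0\<^sub>m p q) (0\<^sub>m 0 p) (0\<^sub>m 0 q) *\<^sub>v c"
    using c by simp
qed auto

lemma lin_last: "lin (p + q) q (\<lambda>c. vec_last c q)"
proof (rule linI)
  fix c :: "complex vec" assume c: "c \<in> carrier_vec (p + q)"
  have "four_block_mat (0\<^sub>m q p) (1\<^sub>m q) (0\<^sub>m 0 p) (0\<^sub>m 0 q) *\<^sub>v (vec_first c p @\<^sub>v vec_last c q)
      = vec_last c q @\<^sub>v 0\<^sub>v 0"
    by (subst four_block_mat_mult_vec[of _ q p _ q _ 0]) auto
  moreover have "vec_last c q @\<^sub>v 0\<^sub>v 0 = vec_last c q"
    by (rule eq_vecI) auto
  ultimately show "vec_last c q =
      four_block_mat (0\<^sub>m q p) (1\<^sub>m q) (0\<^sub>m 0 p) (0\<^sub>m 0 q) *\<^sub>v c"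
    using c by simp
qed auto

lemma append_vec_eq_0:
  "a \<in> carrier_vec n \<Longrightarrow> b \<in> carrier_vec k \<Longrightarrow> a @\<^sub>v b = 0\<^sub>v (n + k) \<longleftrightarrow> a = 0\<^sub>v n \<and> b = 0\<^sub>v k"
proof -
  have "0\<^sub>v n @\<^sub>v 0\<^sub>v k = (0\<^sub>v (n + k) :: 'a :: zero vec)"
    by (rule eq_vecI) auto
  then show "a \<in> carrier_vec n \<Longrightarrow> b \<in> carrier_vec k \<Longrightarrow> ?thesis"
    using append_vec_eq[of a n "0\<^sub>v n" b "0\<^sub>v k"] by simp
qed

lemma vec_split_cases:
  assumes c: "c \<in> carrier_vec (p + q)" "c \<noteq> 0\<^sub>v (p + q)"
  shows "vec_first c p \<noteq> 0\<^sub>v p \<or> vec_last c q \<noteq> 0\<^sub>v q"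
  using append_vec_eq_0[of "vec_first c p" p "vec_last c q" q] c by simp

lemma mat_kernel_nontrivial:
  fixes A :: "complex mat"
  assumes A: "A \<in> carrier_mat n k" and "n < k"
  shows "\<exists>c\<in>carrier_vec k. c \<noteq> 0\<^sub>v k \<and> A *\<^sub>v c = 0\<^sub>v n"
proof -
  \<comment> \<open>\<open>A\<close> is padded with zero rows to a square matrix. Row
    \<open>n\<close> of \<open>B\<close> is zero because \<open>n < k\<close>, so
    \<open>unit_vec k n\<close> is killed by the transpose and the determinant vanishes.\<close>
  define B where "B = mat k k (\<lambda>(i, j). if i < n then A $$ (i, j) else 0)"
  have B: "B \<in> carrier_mat k k" by (simp add: B_def)
  have "B\<^sup>T *\<^sub>v unit_vec k n = 0\<^sub>v k"
    using \<open>n < k\<close> by (intro eq_vecI) (auto simp: B_def)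
  moreover have "unit_vec k n \<noteq> (0\<^sub>v k :: complex vec)"
    using \<open>n < k\<close> by (metis index_unit_vec(2) index_zero_vec(1) zero_neq_one)
  ultimately have "det (B\<^sup>T) = 0"
    using B det_0_iff_vec_prod_zero_field[of "B\<^sup>T" k] by (metis transpose_carrier_mat unit_vec_carrier)
  then have "det B = 0" using det_transpose[OF B] by simp
  then obtain c where c: "c \<in> carrier_vec k" "c \<noteq> 0\<^sub>v k" "B *\<^sub>v c = 0\<^sub>v k"
    using det_0_iff_vec_prod_zero_field[OF B] by auto
  have "A *\<^sub>v c = 0\<^sub>v n"
  proof (rule eq_vecI)
    fix i assume i: "i < dim_vec (0\<^sub>v n)"
    then have "(B *\<^sub>v c) $ i = 0" using c \<open>n < k\<close> by simp
    moreover have "row B i = row A i"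
      using i A \<open>n < k\<close> by (intro eq_vecI) (auto simp: B_def)
    ultimately show "(A *\<^sub>v c) $ i = 0\<^sub>v n $ i"
      using i A B \<open>n < k\<close> by simp
  qed (use A in auto)
  with c show ?thesis by auto
qed

lemma lin_kernel_nontrivial:
  assumes "lin k n f" "n < k"
  obtains c where "c \<in> carrier_vec k" "c \<noteq> 0\<^sub>v k" "f c = 0\<^sub>v n"
  using assms mat_kernel_nontrivial by (metis linE)

section \<open>Rank\<close>

lemma mult_mat_vec_zero: "(A :: complex mat) \<in> carrier_mat n k \<Longrightarrow> A *\<^sub>v 0\<^sub>v k = 0\<^sub>v n"
  by (intro eq_vecI) auto

lemma vec_minus_eq_0:
  fixes v :: "complex vec"
  assumes "v \<in> carrier_vec n" "w \<in> carrier_vec n" "v - w = 0\<^sub>v n"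
  shows "v = w"
proof (rule eq_vecI)
  fix i assume "i < dim_vec w"
  then have "(v - w) $ i = v $ i - w $ i" "i < n" using assms(1,2) by simp_all
  then show "v $ i = w $ i" using assms(3) by simp
qed (use assms in auto)

lemma inverse_of_injective:
  fixes B :: "complex mat"
  assumes B: "B \<in> carrier_mat r r"
    and inj: "\<And>c. c \<in> carrier_vec r \<Longrightarrow> B *\<^sub>v c = 0\<^sub>v r \<Longrightarrow> c = 0\<^sub>v r"
  obtains C where "C \<in> carrier_mat r r" "C * B = 1\<^sub>m r" "B * C = 1\<^sub>m r"
proof -
  have "det B \<noteq> 0"
    using det_0_iff_vec_prod_zero_field[OF B] inj by auto
  from det_non_zero_imp_unit[OF B this, of "()"] show thesis
    by (auto simp: Units_def ring_mat_simps intro: that)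
qed

text \<open>The columns of \<open>A * E\<close> are a column basis of \<open>A\<close>, and \<open>R\<close> expresses all columns in it.\<close>

lemma rank_factorization:
  assumes A: "A \<in> carrier_mat n k"
  obtains E R where "E \<in> carrier_mat k (mat_rank A)" "R \<in> carrier_mat (mat_rank A) k"
    "A * E * R = A"
    "\<And>c. c \<in> carrier_vec (mat_rank A) \<Longrightarrow> A * E *\<^sub>v c = 0\<^sub>v n \<Longrightarrow> c = 0\<^sub>v (mat_rank A)"
proof -
  interpret vec_space "TYPE(complex)" n .
  have cols_A: "set (cols A) \<subseteq> carrier_vec n" using A cols_dim by blast
  obtain S where "finite S" and max: "maximal S (\<lambda>T. T \<subseteq> set (cols A) \<and> lin_indpt T)"
    using maximal_exists_superset[of "set (cols A)" "\<lambda>T. T \<subseteq> set (cols A) \<and> lin_indpt T" "{}"]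
      finite_lin_indpt2[of "{}"] by auto
  from max have S: "S \<subseteq> set (cols A)" "lin_indpt S"
    by (auto simp: maximal_def)
  from rank_card_indpt[OF A max] A have r: "mat_rank A = card S" by simp
  let ?r = "mat_rank A"
  obtain ss where ss: "set ss = S" "distinct ss" using \<open>finite S\<close> finite_distinct_list by auto
  have len: "length ss = ?r" using ss r distinct_card by fastforce
  have ss_carrier: "set ss \<subseteq> carrier_vec n" using ss S cols_A by blast
  define B where "B = mat_of_cols n ss"
  have B: "B \<in> carrier_mat n ?r" using len by (auto simp: B_def)
  have cols_B: "cols B = ss" using ss_carrier by (simp add: B_def)
  have inj: "c = 0\<^sub>v ?r" if "c \<in> carrier_vec ?r" "B *\<^sub>v c = 0\<^sub>v n" for c
    using lin_depI[OF B] that S ss cols_B by auto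
  have "\<forall>j<?r. \<exists>i<k. ss ! j = col A i"
  proof (intro allI impI)
    fix j assume "j < ?r"
    then have "ss ! j \<in> set (cols A)" using len ss S by (metis nth_mem subsetD)
    then show "\<exists>i<k. ss ! j = col A i" using A by (auto simp: in_set_conv_nth)
  qed
  then obtain js where js: "\<And>j. j < ?r \<Longrightarrow> js j < k" "\<And>j. j < ?r \<Longrightarrow> ss ! j = col A (js j)"
    by metis
  \<comment> \<open>A selection matrix: column \<open>j\<close> of \<open>E\<close> is the unit
    vector at \<open>js j\<close>, so \<open>A * E\<close> consists of the chosen columns.\<close>
  define E where "E = mat k ?r (\<lambda>(i, j). if i = js j then 1 else 0 :: complex)"
  have E: "E \<in> carrier_mat k ?r" by (simp add: E_def)
  have AE: "A * E = B"
  proof (rule eq_matI)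
    fix i j assume ij: "i < dim_row B" "j < dim_col B"
    then have j: "j < ?r" "i < n" using B by auto
    have "(A * E) $$ (i, j) = (\<Sum>l = 0..<k. A $$ (i, l) * (if l = js j then 1 else 0))"
      using A E j by (auto simp: scalar_prod_def E_def intro!: sum.cong)
    also have "\<dots> = A $$ (i, js j)"
      using js(1)[OF j(1)] by (simp add: sum.delta if_distrib cong: if_cong)
    also have "\<dots> = ss ! j $ i" using js[OF j(1)] j A by simp
    also have "\<dots> = B $$ (i, j)" using j len by (simp add: B_def mat_of_cols_index)
    finally show "(A * E) $$ (i, j) = B $$ (i, j)" .
  qed (use A B E in auto)
  have "col A i \<in> span S" if "i < k" for i
  proof (cases "col A i \<in> S")
    case True
    then show ?thesis using S cols_A by (meson span_mem subset_trans)
  next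
    case False
    have i: "col A i \<in> set (cols A)" using that A by (metis carrier_matD(2) cols_length cols_nth nth_mem)
    have "lin_dep (S \<union> {col A i})"
    proof (rule ccontr)
      assume "lin_indpt (S \<union> {col A i})"
      then have "S \<union> {col A i} = S"
        using max i S unfolding maximal_def by blast
      with False show False by blast
    qed
    then show ?thesis
      using lin_dep_iff_in_span[of S "col A i"] S cols_A i False by auto
  qed
  moreover have "span S = {y \<in> carrier_vec n. \<exists>x\<in>carrier_vec ?r. B *\<^sub>v x = y}"
    using col_space_eq[OF B] B cols_B ss by (simp add: col_space_def)
  ultimately have "\<forall>i<k. \<exists>x\<in>carrier_vec ?r. B *\<^sub>v x = col A i" by auto
  then obtain xs where xs: "\<And>i. i < k \<Longrightarrow> xs i \<in> carrier_vec ?r" "\<And>i. i < k \<Longrightarrow> B *\<^sub>v xs i = col A i"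
    by metis
  define R where "R = mat_of_cols ?r (map xs [0..<k])"
  have R: "R \<in> carrier_mat ?r k" by (auto simp: R_def)
  have "B * R = A"
  proof (rule mat_col_eqI)
    fix i assume "i < dim_col A"
    then have i: "i < k" using A by simp
    then have "col R i = xs i" using xs(1) by (simp add: R_def)
    then show "col (B * R) i = col A i" using col_mult2[OF B R i] xs(2)[OF i] by simp
  qed (use A B R in auto)
  with E R AE inj show thesis by (intro that[of E R]) auto
qed

lemma rank_domain:
  assumes A: "A \<in> carrier_mat n k"
  obtains f where "lin (mat_rank A) k f"
    "\<And>c. c \<in> carrier_vec (mat_rank A) \<Longrightarrow> A *\<^sub>v f c = 0\<^sub>v n \<Longrightarrow> c = 0\<^sub>v (mat_rank A)"
proof -
  obtain E R where ER: "E \<in> carrier_mat k (mat_rank A)"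
    "\<And>c. c \<in> carrier_vec (mat_rank A) \<Longrightarrow> A * E *\<^sub>v c = 0\<^sub>v n \<Longrightarrow> c = 0\<^sub>v (mat_rank A)"
    using rank_factorization[OF A] by metis
  then show thesis
    using A by (intro that[of "\<lambda>c. E *\<^sub>v c"]) (auto intro: linI)
qed

lemma rank_functionals:
  assumes A: "A \<in> carrier_mat n k"
  obtains g where "lin k (mat_rank A) g"
    "\<And>x. x \<in> carrier_vec k \<Longrightarrow> g x = 0\<^sub>v (mat_rank A) \<longleftrightarrow> A *\<^sub>v x = 0\<^sub>v n"
proof -
  obtain E R where ER: "E \<in> carrier_mat k (mat_rank A)" "R \<in> carrier_mat (mat_rank A) k"
    "A * E * R = A"
    "\<And>c. c \<in> carrier_vec (mat_rank A) \<Longrightarrow> A * E *\<^sub>v c = 0\<^sub>v n \<Longrightarrow> c = 0\<^sub>v (mat_rank A)"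
    using rank_factorization[OF A] by metis
  show thesis
  proof (rule that[of "\<lambda>x. R *\<^sub>v x"])
    show "lin k (mat_rank A) (\<lambda>x. R *\<^sub>v x)" using ER by (auto intro: linI)
    fix x :: "complex vec" assume x: "x \<in> carrier_vec k"
    have "A *\<^sub>v x = A * E *\<^sub>v (R *\<^sub>v x)"
      using assoc_mult_mat_vec[of "A * E" n "mat_rank A" R k x] ER A x by simp
    moreover have "R *\<^sub>v x \<in> carrier_vec (mat_rank A)" using ER x by (auto simp: mult_mat_vec_carrier)
    moreover have "A * E *\<^sub>v 0\<^sub>v (mat_rank A) = 0\<^sub>v n"
      using A ER(1) by (intro mult_mat_vec_zero) auto
    ultimately show "R *\<^sub>v x = 0\<^sub>v (mat_rank A) \<longleftrightarrow> A *\<^sub>v x = 0\<^sub>v n"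
      using ER(4) by metis
  qed
qed

text \<open>Were the rank larger than \<open>r\<close>, the \<open>r\<close> conditions
  \<open>g = 0\<close> would leave a nonzero vector in the domain supplied by
  \<open>rank_domain\<close>, on which \<open>A\<close> is injective. \<open>rank_ge\<close> is the
  dual count, with conditions and parameters exchanged.\<close>

lemma rank_le:
  assumes A: "A \<in> carrier_mat n k" and g: "lin k r g"
    and ker: "\<And>x. x \<in> carrier_vec k \<Longrightarrow> g x = 0\<^sub>v r \<Longrightarrow> A *\<^sub>v x = 0\<^sub>v n"
  shows "mat_rank A \<le> r"
proof (rule ccontr)
  assume "\<not> mat_rank A \<le> r"
  moreover obtain f where f: "lin (mat_rank A) k f"
    "\<And>c. c \<in> carrier_vec (mat_rank A) \<Longrightarrow> A *\<^sub>v f c = 0\<^sub>v n \<Longrightarrow> c = 0\<^sub>v (mat_rank A)"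
    using rank_domain[OF A] by metis
  ultimately obtain c where "c \<in> carrier_vec (mat_rank A)" "c \<noteq> 0\<^sub>v (mat_rank A)" "g (f c) = 0\<^sub>v r"
    using lin_kernel_nontrivial[OF lin_compose[OF g f(1)]] by (metis not_le)
  then show False using f ker lin_carrier by metis
qed

lemma rank_ge:
  assumes A: "A \<in> carrier_mat n k" and f: "lin r k f"
    and inj: "\<And>c. c \<in> carrier_vec r \<Longrightarrow> A *\<^sub>v f c = 0\<^sub>v n \<Longrightarrow> c = 0\<^sub>v r"
  shows "r \<le> mat_rank A"
proof (rule ccontr)
  assume "\<not> r \<le> mat_rank A"
  moreover obtain g where g: "lin k (mat_rank A) g"
    "\<And>x. x \<in> carrier_vec k \<Longrightarrow> g x = 0\<^sub>v (mat_rank A) \<longleftrightarrow> A *\<^sub>v x = 0\<^sub>v n"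
    using rank_functionals[OF A] by metis
  ultimately obtain c where "c \<in> carrier_vec r" "c \<noteq> 0\<^sub>v r" "g (f c) = 0\<^sub>v (mat_rank A)"
    using lin_kernel_nontrivial[OF lin_compose[OF g(1) f]] by (metis not_le)
  then show False using f g inj lin_carrier by metis
qed

lemma rank_le_rank:
  assumes A: "A \<in> carrier_mat n k" and B: "B \<in> carrier_mat l k"
    and "\<And>x. x \<in> carrier_vec k \<Longrightarrow> B *\<^sub>v x = 0\<^sub>v l \<Longrightarrow> A *\<^sub>v x = 0\<^sub>v n"
  shows "mat_rank A \<le> mat_rank B"
  using rank_functionals[OF B] rank_le[OF A] assms(3) by metis

lemma rank_le_dim:
  assumes A: "A \<in> carrier_mat n k" shows "mat_rank A \<le> n" "mat_rank A \<le> k"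
proof -
  show "mat_rank A \<le> n" by (rule rank_le[OF A, of n "\<lambda>x. A *\<^sub>v x"]) (use A in \<open>auto intro: linI\<close>)
  show "mat_rank A \<le> k"
    by (rule rank_le[OF A, of k "\<lambda>x. x"]) (use mult_mat_vec_zero[OF A] in \<open>auto intro: lin_id\<close>)
qed

lemma rank_eq_0_iff:
  assumes A: "A \<in> carrier_mat n k"
  shows "mat_rank A = 0 \<longleftrightarrow> A = 0\<^sub>m n k"
proof
  obtain E R where ER: "E \<in> carrier_mat k (mat_rank A)" "R \<in> carrier_mat (mat_rank A) k"
    "A * E * R = A"
    using rank_factorization[OF A] by metis
  assume 0: "mat_rank A = 0"
  have "E * R = 0\<^sub>m k k" using ER(1,2) 0 by (intro eq_matI) (auto simp: scalar_prod_def)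
  then have "A * E * R = A * 0\<^sub>m k k" using A ER(1,2) by simp
  then show "A = 0\<^sub>m n k" using A ER(3) by simp
next
  assume "A = 0\<^sub>m n k"
  then have "mat_rank A \<le> 0"
    by (intro rank_le[OF A, of 0 "\<lambda>x. 0\<^sub>v 0"]) (auto intro!: linI[of "0\<^sub>m 0 k"])
  then show "mat_rank A = 0" by simp
qed

lemma rank_eq_dim_iff:
  assumes A: "A \<in> carrier_mat n n"
  shows "mat_rank A = n \<longleftrightarrow> (\<forall>x\<in>carrier_vec n. A *\<^sub>v x = 0\<^sub>v n \<longrightarrow> x = 0\<^sub>v n)"
  using vec_space.det_rank_iff[OF A] det_0_iff_vec_prod_zero_field[OF A] A by auto

lemma invertible_mat_iff_rank:
  fixes A :: "complex mat"
  assumes A: "A \<in> carrier_mat n n"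
  shows "invertible_mat A \<longleftrightarrow> mat_rank A = n"
proof
  assume "invertible_mat A"
  then obtain B where B: "inverts_mat A B" "inverts_mat B A" by (auto simp: invertible_mat_def)
  then have "A * B = 1\<^sub>m n" "B * A = 1\<^sub>m (dim_row B)" using A by (auto simp: inverts_mat_def)
  then have "dim_col B = n" "dim_row B = n"
    using A by (metis carrier_matD(2) index_mult_mat(3) index_one_mat(3))+
  then have "B \<in> carrier_mat n n" "B * A = 1\<^sub>m n" using \<open>B * A = _\<close> by auto
  then have "x = 0\<^sub>v n" if "x \<in> carrier_vec n" "A *\<^sub>v x = 0\<^sub>v n" for x
    using assoc_mult_mat_vec[of B n n A n x] A that by auto
  then show "mat_rank A = n" using rank_eq_dim_iff[OF A] by blast
next
  assume "mat_rank A = n"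
  then obtain C where "C \<in> carrier_mat n n" "C * A = 1\<^sub>m n" "A * C = 1\<^sub>m n"
    using inverse_of_injective[OF A] rank_eq_dim_iff[OF A] by metis
  then show "invertible_mat A" using A by (auto simp: invertible_mat_def inverts_mat_def)
qed

lemma adjoint_mult_kernel:
  fixes A :: "complex mat"
  assumes A: "A \<in> carrier_mat n k" and x: "x \<in> carrier_vec k" and 0: "A\<^sup>H *\<^sub>v (A *\<^sub>v x) = 0\<^sub>v k"
  shows "A *\<^sub>v x = 0\<^sub>v n"
proof -
  have "A *\<^sub>v x \<in> carrier_vec n" using A x by (rule mult_mat_vec_carrier)
  then have "re_inner (A *\<^sub>v x) (A *\<^sub>v x) = 0"
    using re_inner_adjoint[OF A x, of "A *\<^sub>v x"] 0 x by simp
  then show ?thesis using re_inner_self_eq_0 \<open>A *\<^sub>v x \<in> carrier_vec n\<close> by metis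
qed

text \<open>\<open>B\<^sup>H\<close> is injective on the range of \<open>B\<close>, since
  \<open>B\<^sup>H B x = 0\<close> forces the squared norm of \<open>B x\<close> to be zero. So the
  rank cannot drop on passing to the adjoint, and doing so twice gives equality.\<close>

lemma rank_adjoint:
  assumes A: "A \<in> carrier_mat n k"
  shows "mat_rank (A\<^sup>H) = mat_rank A"
proof -
  have le: "mat_rank B \<le> mat_rank (B\<^sup>H)" if B: "B \<in> carrier_mat n k" for B n k
  proof -
    obtain f where f: "lin (mat_rank B) k f"
      "\<And>c. c \<in> carrier_vec (mat_rank B) \<Longrightarrow> B *\<^sub>v f c = 0\<^sub>v n \<Longrightarrow> c = 0\<^sub>v (mat_rank B)"
      using rank_domain[OF B] by metis
    show ?thesis
    proof (rule rank_ge[of "B\<^sup>H" k n _ "\<lambda>c. B *\<^sub>v f c"])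
      show "lin (mat_rank B) n (\<lambda>c. B *\<^sub>v f c)" using B f by (auto intro: lin_mat)
      fix c assume "c \<in> carrier_vec (mat_rank B)" "B\<^sup>H *\<^sub>v (B *\<^sub>v f c) = 0\<^sub>v k"
      then show "c = 0\<^sub>v (mat_rank B)" using f adjoint_mult_kernel[OF B] lin_carrier by metis
    qed (use B in simp)
  qed
  from le[OF A] le[of "A\<^sup>H" k n] A show ?thesis by simp
qed

text \<open>In the full-rank factorization \<open>A = B * R\<close> with \<open>B = A * E\<close>,
  the factor \<open>B\<close> has the left inverse \<open>L = C * B\<^sup>H\<close>, where
  \<open>C\<close> inverts \<open>B\<^sup>H * B\<close>. Then \<open>E * L\<close> works because
  \<open>A * E * L * A = B * L * B * R = A\<close>.\<close>

lemma inner_inverse_exists: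
  assumes A: "A \<in> carrier_mat n k"
  obtains G :: "complex mat" where "G \<in> carrier_mat k n" "A * G * A = A"
proof -
  let ?r = "mat_rank A"
  obtain E R where E: "E \<in> carrier_mat k ?r" and R: "R \<in> carrier_mat ?r k"
    and AER: "A * E * R = A"
    and inj: "\<And>c. c \<in> carrier_vec ?r \<Longrightarrow> A * E *\<^sub>v c = 0\<^sub>v n \<Longrightarrow> c = 0\<^sub>v ?r"
    using rank_factorization[OF A] by metis
  define B where "B = A * E"
  have B: "B \<in> carrier_mat n ?r" using A E by (simp add: B_def)
  have BH: "B\<^sup>H \<in> carrier_mat ?r n" using B by simp
  have "c = 0\<^sub>v ?r" if c: "c \<in> carrier_vec ?r" "B\<^sup>H * B *\<^sub>v c = 0\<^sub>v ?r" for c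
    using adjoint_mult_kernel[OF B c(1)] c inj assoc_mult_mat_vec[OF BH B c(1)] by (simp add: B_def)
  then obtain C where C: "C \<in> carrier_mat ?r ?r" "C * (B\<^sup>H * B) = 1\<^sub>m ?r"
    using inverse_of_injective[of "B\<^sup>H * B" ?r] B BH by (metis mult_carrier_mat)
  define L where "L = C * B\<^sup>H"
  have L: "L \<in> carrier_mat ?r n" using C BH by (simp add: L_def)
  have LB: "L * B = 1\<^sub>m ?r" using C B BH by (simp add: L_def assoc_mult_mat[of _ ?r ?r _ n _ ?r])
  have "A * (E * L) * A = B * L * (B * R)"
    using A E L AER by (simp add: B_def assoc_mult_mat[of _ n k _ ?r _ n])
  also have "\<dots> = B * (L * B) * R"
    using B L R assoc_mult_mat[OF B L, of "B * R" k] assoc_mult_mat[OF L B R]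
      assoc_mult_mat[OF B _ R, of "L * B"] by simp
  also have "\<dots> = A" using LB B AER by (simp add: B_def[symmetric])
  finally show thesis using E L by (intro that[of "E * L"]) auto
qed

text \<open>For an inner inverse \<open>G\<close> of \<open>B\<close>, the vector
  \<open>u - G B u\<close> lies in the kernel of \<open>B\<close>, hence in that of
  \<open>A\<close>; so \<open>A = A G B\<close>, and \<open>Y = A G\<close>.\<close>

lemma factor_through_kernel:
  fixes A :: "complex mat"
  assumes A: "A \<in> carrier_mat n k" and B: "B \<in> carrier_mat l k"
    and ker: "\<And>x. x \<in> carrier_vec k \<Longrightarrow> B *\<^sub>v x = 0\<^sub>v l \<Longrightarrow> A *\<^sub>v x = 0\<^sub>v n"
  obtains Y where "Y \<in> carrier_mat n l" "A = Y * B"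
proof -
  obtain G where G: "G \<in> carrier_mat k l" "B * G * B = B" using inner_inverse_exists[OF B] by metis
  have GB: "G * B \<in> carrier_mat k k" using G B by auto
  have "A = A * (G * B)"
  proof (rule mat_col_eqI)
    fix i assume "i < dim_col (A * (G * B))"
    then have i: "i < k" using GB by auto
    define u where "u = (unit_vec k i :: complex vec)"
    have u: "u \<in> carrier_vec k" by (simp add: u_def)
    have Gu: "G * B *\<^sub>v u \<in> carrier_vec k" using GB u by (rule mult_mat_vec_carrier)
    have "B *\<^sub>v (G * B *\<^sub>v u) = B *\<^sub>v u"
      using G B u assoc_mult_mat_vec[of B l k "G * B" k u] assoc_mult_mat[of B l k G l B k] by auto
    then have "B *\<^sub>v (u - G * B *\<^sub>v u) = 0\<^sub>v l"
      using B u Gu mult_minus_distrib_mat_vec[OF B u Gu] mult_mat_vec_carrier[OF B u] by simp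
    then have "A *\<^sub>v (u - G * B *\<^sub>v u) = 0\<^sub>v n" using ker u Gu by simp
    then have "A *\<^sub>v u - A *\<^sub>v (G * B *\<^sub>v u) = 0\<^sub>v n"
      using mult_minus_distrib_mat_vec[OF A u Gu] by simp
    then have "A *\<^sub>v u = A *\<^sub>v (G * B *\<^sub>v u)"
      using vec_minus_eq_0 mult_mat_vec_carrier[OF A u] mult_mat_vec_carrier[OF A Gu] by blast
    moreover have "col M i = M *\<^sub>v u" if "M \<in> carrier_mat p k" for M :: "complex mat" and p
      using that i unfolding u_def by (intro eq_vecI) auto
    moreover have "A * (G * B) *\<^sub>v u = A *\<^sub>v (G * B *\<^sub>v u)"
      using A GB u by simp
    ultimately show "col A i = col (A * (G * B)) i" using A GB by (metis mult_carrier_mat)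
  qed (use A B G in auto)
  then have "A = A * G * B" using A B G by simp
  then show thesis using that[of "A * G"] A G by simp
qed

section \<open>The spectral theorem\<close>

abbreviation real_diag :: "nat \<Rightarrow> (nat \<Rightarrow> real) \<Rightarrow> complex mat" where
  "real_diag n d \<equiv> mat n n (\<lambda>(i, j). if i = j then complex_of_real (d i) else 0)"

lemma cscalar_prod_self: "x \<bullet>c x = complex_of_real (re_inner x x)"
proof -
  have x: "x \<in> carrier_vec (dim_vec x)" by simp
  have "x \<bullet>c x = (\<Sum>i<dim_vec x. complex_of_real ((cmod (x $ i))\<^sup>2))"
    by (auto simp: scalar_prod_def lessThan_atLeast0 complex_norm_square
        simp del: of_real_power intro!: sum.cong)
  then show ?thesis by (simp add: re_inner_self[OF x])
qed

lemma unitary_completion: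
  assumes v: "v \<in> carrier_vec n" "v \<noteq> 0\<^sub>v n"
  obtains W :: "complex mat" and a where "W \<in> carrier_mat n n" "W\<^sup>H * W = 1\<^sub>m n" "col W 0 = a \<cdot>\<^sub>v v"
proof -
  interpret cof_vec_space n "TYPE(complex)" .
  note basis = basis_completion[OF v]
  define ws where "ws = gram_schmidt n (basis_completion v)"
  have ws: "set ws \<subseteq> carrier_vec n" "corthogonal ws" "length ws = n"
    using gram_schmidt_result[OF basis(2,4,5) ws_def] basis(6) by auto
  have n: "n \<noteq> 0" using v by (cases n) auto
  obtain us where us: "basis_completion v = v # us"
    using basis(6,7) n by (cases "basis_completion v") auto
  have hd: "ws ! 0 = v"
  proof -
    have "hd ws = v" using gram_schmidt_hd[OF v(1), of us] by (simp add: ws_def us)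
    moreover have "ws \<noteq> []" using ws(3) n by auto
    ultimately show ?thesis by (simp add: hd_conv_nth)
  qed
  have wsi: "ws ! i \<in> carrier_vec n" if "i < n" for i using ws that by auto
  \<comment> \<open>\<open>gram_schmidt\<close> yields orthogonal vectors of arbitrary length;
    dividing by the norms \<open>c i\<close> makes the columns orthonormal, at the price of the
    scalar \<open>a\<close> in front of \<open>v\<close>.\<close>
  define c where "c i = sqrt (re_inner (ws ! i) (ws ! i))" for i
  have c2: "complex_of_real (c i) * complex_of_real (c i) = ws ! i \<bullet>c ws ! i" if "i < n" for i
    using re_inner_self_ge_0[OF wsi[OF that]]
    by (simp add: c_def cscalar_prod_self flip: of_real_mult)
  define W where "W = mat n n (\<lambda>(i, j). ws ! j $ i / complex_of_real (c j))"
  have W: "W \<in> carrier_mat n n" by (simp add: W_def)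
  have "W\<^sup>H * W = 1\<^sub>m n"
  proof (rule eq_matI)
    fix i j assume "i < dim_row (1\<^sub>m n)" "j < dim_col (1\<^sub>m n)"
    then have ij: "i < n" "j < n" by auto
    have "(W\<^sup>H * W) $$ (i, j) = (\<Sum>l = 0..<n. ws ! j $ l * cnj (ws ! i $ l) / (c i * c j))"
      using W ij by (auto simp: scalar_prod_def W_def field_simps intro!: sum.cong)
    also have "\<dots> = (ws ! j \<bullet>c ws ! i) / (c i * c j)"
      using wsi[OF ij(1)] wsi[OF ij(2)] by (simp add: scalar_prod_def sum_divide_distrib)
    also have "\<dots> = 1\<^sub>m n $$ (i, j)"
    proof (cases "i = j")
      case True
      then show ?thesis using corthogonalD[OF ws(2), of i i] c2[of i] ws ij by auto
    next
      case False
      then show ?thesis using corthogonalD[OF ws(2), of j i] ws ij by auto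
    qed
    finally show "(W\<^sup>H * W) $$ (i, j) = 1\<^sub>m n $$ (i, j)" .
  qed (use W in auto)
  moreover have "col W 0 = (1 / complex_of_real (c 0)) \<cdot>\<^sub>v v"
    using n v hd by (intro eq_vecI) (auto simp: W_def)
  ultimately show thesis using W that by blast
qed

lemma eigenvalue_exists:
  fixes A :: "complex mat"
  assumes A: "A \<in> carrier_mat (Suc n) (Suc n)"
  obtains e where "eigenvalue A e"
proof -
  have "degree (char_poly A) = Suc n" using degree_monic_char_poly[OF A] by simp
  then have "\<not> constant (poly (char_poly A))" by (simp add: constant_degree)
  then obtain e where "poly (char_poly A) e = 0" using fundamental_theorem_of_algebra by blast
  then show thesis using eigenvalue_root_char_poly[OF A] that by blast
qed

text \<open>Induction by deflation. In an orthonormal basis starting with an eigenvector, the first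
  column of \<open>B\<close> is \<open>e\<close> times a unit vector; Hermitian symmetry clears the
  first row too and makes \<open>e\<close> real, and the remaining block \<open>C\<close> is again
  Hermitian.\<close>

lemma unitary_diagonalization:
  assumes "A \<in> carrier_mat n n" "hermitian A"
  obtains U d where "U \<in> carrier_mat n n" "U\<^sup>H * U = 1\<^sub>m n" "A = U * real_diag n d * U\<^sup>H"
proof -
  have "\<exists>U d. U \<in> carrier_mat n n \<and> U\<^sup>H * U = 1\<^sub>m n \<and> A = U * real_diag n d * U\<^sup>H"
    using assms
  proof (induction n arbitrary: A)
    case 0
    then show ?case by (intro exI[of _ "1\<^sub>m 0"] exI[of _ "\<lambda>_. 0"]) auto
  next
    case (Suc n)
    note A = Suc.prems(1)
    obtain e where "eigenvalue A e" using eigenvalue_exists[OF A] .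
    then obtain v where v: "v \<in> carrier_vec (Suc n)" "v \<noteq> 0\<^sub>v (Suc n)" "A *\<^sub>v v = e \<cdot>\<^sub>v v"
      using A by (auto simp: eigenvalue_def eigenvector_def)
    obtain W a where W: "W \<in> carrier_mat (Suc n) (Suc n)" "W\<^sup>H * W = 1\<^sub>m (Suc n)" "col W 0 = a \<cdot>\<^sub>v v"
      using unitary_completion[OF v(1,2)] by metis
    have WH: "W\<^sup>H \<in> carrier_mat (Suc n) (Suc n)" using W by simp
    have WW: "W * W\<^sup>H = 1\<^sub>m (Suc n)" using mat_mult_left_right_inverse[OF WH W(1)] W by simp
    define B where "B = W\<^sup>H * A * W"
    have B: "B \<in> carrier_mat (Suc n) (Suc n)" 
      unfolding B_def using mult_carrier_mat[OF mult_carrier_mat[OF WH A] W(1)] .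
    have B_herm: "B\<^sup>H = B"
      using A W WH Suc.prems(2)
      by (simp add: B_def hermitian_def mat_adjoint_mult[of _ "Suc n" "Suc n" _ "Suc n"]
          assoc_mult_mat[of _ "Suc n" "Suc n" _ "Suc n" _ "Suc n"])
    have colW: "W\<^sup>H *\<^sub>v col W 0 = unit_vec (Suc n) 0"
      using col_mult2[OF WH W(1), of 0] W(2) by simp
    have "col B 0 = W\<^sup>H *\<^sub>v (A *\<^sub>v col W 0)"
      using A W(1) WH col_mult2[OF WH mult_carrier_mat[OF A W(1)], of 0] col_mult2[OF A W(1), of 0]
      by (simp only: B_def assoc_mult_mat[OF WH A W(1)])
    also have "A *\<^sub>v col W 0 = e \<cdot>\<^sub>v col W 0"
      using v A W by (simp add: mult_mat_vec[OF A] smult_smult_assoc mult.commute)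
    also have "W\<^sup>H *\<^sub>v (e \<cdot>\<^sub>v col W 0) = e \<cdot>\<^sub>v unit_vec (Suc n) 0"
      using W colW v(1) by (subst mult_mat_vec[OF WH]) auto
    finally have col_B: "col B 0 = e \<cdot>\<^sub>v unit_vec (Suc n) 0" .
    have B_col: "B $$ (i, 0) = (if i = 0 then e else 0)" if "i < Suc n" for i
      using arg_cong[OF col_B, of "\<lambda>v. v $ i"] that B by auto
    have B_sym: "B $$ (j, i) = cnj (B $$ (i, j))" if "i < Suc n" "j < Suc n" for i j
      using arg_cong[OF B_herm, of "\<lambda>M. M $$ (j, i)"] that B by simp
    have e: "e = complex_of_real (Re e)"
    proof -
      have "e = cnj e" using B_sym[of 0 0] unfolding B_col[of 0, simplified] by simp
      then show ?thesis by (metis Reals_cnj_iff of_real_Re)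
    qed
    define C where "C = mat n n (\<lambda>(i, j). B $$ (Suc i, Suc j))"
    have C: "C \<in> carrier_mat n n" by (simp add: C_def)
    have "hermitian C" unfolding hermitian_def
    proof (rule eq_matI)
      fix i j assume "i < dim_row C" "j < dim_col C"
      then show "C\<^sup>H $$ (i, j) = C $$ (i, j)"
        using B_sym[of "Suc j" "Suc i"] by (simp add: C_def)
    qed (auto simp: C_def)
    then obtain V d where V: "V \<in> carrier_mat n n" "V\<^sup>H * V = 1\<^sub>m n" "C = V * real_diag n d * V\<^sup>H"
      using Suc.IH[OF C] by blast
    define d' where "d' i = (if i = 0 then Re e else d (i - 1))" for i
    define F where "F = four_block_mat (1\<^sub>m 1) (0\<^sub>m 1 n) (0\<^sub>m n 1) V"
    have F: "F \<in> carrier_mat (Suc n) (Suc n)" using four_block_carrier_mat[of "1\<^sub>m 1" 1 1 V n n] V(1) by (simp add: F_def)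
    have FH: "F\<^sup>H = four_block_mat (1\<^sub>m 1) (0\<^sub>m 1 n) (0\<^sub>m n 1) (V\<^sup>H)"
      unfolding F_def using V by (subst mat_adjoint_four_block[of _ 1 1 _ n _ n]) auto
    have FHc: "F\<^sup>H \<in> carrier_mat (Suc n) (Suc n)" using F by simp
    have FF: "F\<^sup>H * F = 1\<^sub>m (Suc n)"
      unfolding FH unfolding F_def using V
      by (subst mult_four_block_mat[of _ 1 1 _ n _ n _ _ 1 _ n]) (auto intro!: eq_matI)
    have D: "real_diag (Suc n) d' =
        four_block_mat (mat 1 1 (\<lambda>_. e)) (0\<^sub>m 1 n) (0\<^sub>m n 1) (real_diag n d)"
      using e by (intro eq_matI) (auto simp: d'_def)
    have "F * real_diag (Suc n) d' * F\<^sup>H = four_block_mat (mat 1 1 (\<lambda>_. e)) (0\<^sub>m 1 n) (0\<^sub>m n 1) C"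
      unfolding D FH V(3) unfolding F_def using V
      by (subst mult_four_block_mat[of _ 1 1 _ n _ n _ _ 1 _ n], auto)
        (subst mult_four_block_mat[of _ 1 1 _ n _ n _ _ 1 _ n], auto)
    also have "\<dots> = B"
    proof (rule eq_matI)
      fix i j assume "i < dim_row B" "j < dim_col B"
      then have ij: "i < Suc n" "j < Suc n" using B by auto
      show "four_block_mat (mat 1 1 (\<lambda>_. e)) (0\<^sub>m 1 n) (0\<^sub>m n 1) C $$ (i, j) = B $$ (i, j)"
      proof (cases "i = 0")
        case i: True
        show ?thesis
        proof (cases "j = 0")
          case True
          then show ?thesis using i ij C B_col[of 0] by simp
        next
          case False
          then have "B $$ (0, j) = 0" using B_sym[of j 0] B_col[of j] ij by simp
          then show ?thesis using False i ij C by simp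
        qed
      next
        case i: False
        then show ?thesis using ij C B_col[of i] by (cases "j = 0") (auto simp: C_def)
      qed
    qed (use B C in auto)
    finally have FDF: "F * real_diag (Suc n) d' * F\<^sup>H = B" .
    have WB: "W * B * W\<^sup>H = A"
    proof -
      have "W * B * W\<^sup>H = (W * W\<^sup>H) * A * (W * W\<^sup>H)"
        using A W(1) WH by (simp add: B_def assoc_mult_mat[of _ "Suc n" "Suc n" _ "Suc n" _ "Suc n"])
      then show ?thesis using WW A by simp
    qed
    have UH: "(W * F)\<^sup>H = F\<^sup>H * W\<^sup>H" using mat_adjoint_mult[OF W(1) F] .
    have "(W * F)\<^sup>H * (W * F) = F\<^sup>H * (W\<^sup>H * W) * F"
      unfolding UH using W(1) WH F FHc
      by (simp add: assoc_mult_mat[of _ "Suc n" "Suc n" _ "Suc n" _ "Suc n"] del: W)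
    then have "(W * F)\<^sup>H * (W * F) = 1\<^sub>m (Suc n)" using W(2) FHc FF by simp
    moreover have "W * F * real_diag (Suc n) d' * (W * F)\<^sup>H = A"
    proof -
      define D where "D = real_diag (Suc n) d'"
      have Dc: "D \<in> carrier_mat (Suc n) (Suc n)" by (simp add: D_def)
      have "W * F * D * (W * F)\<^sup>H = W * F * D * F\<^sup>H * W\<^sup>H"
        unfolding UH using assoc_mult_mat[OF _ FHc WH, of "W * F * D" "Suc n"] W(1) F Dc by simp
      also have "W * F * D * F\<^sup>H = W * (F * D * F\<^sup>H)"
        using assoc_mult_mat[OF W(1) F Dc] assoc_mult_mat[OF W(1) mult_carrier_mat[OF F Dc] FHc] by simp
      finally have "W * F * real_diag (Suc n) d' * (W * F)\<^sup>H =
          W * (F * real_diag (Suc n) d' * F\<^sup>H) * W\<^sup>H"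
        by (simp only: D_def)
      then show ?thesis using FDF WB by simp
    qed
    ultimately show ?case
      using W F by (intro exI[of _ "W * F"] exI[of _ d']) auto
  qed
  then show thesis using that by blast
qed

section \<open>Inertia\<close>

lemma real_diag_mult_vec:
  assumes y: "y \<in> carrier_vec n"
  shows "real_diag n d *\<^sub>v y = vec n (\<lambda>i. d i * y $ i)"
proof (rule eq_vecI)
  fix i assume "i < dim_vec (vec n (\<lambda>i. d i * y $ i))"
  then have i: "i < n" by simp
  have "(real_diag n d *\<^sub>v y) $ i = (\<Sum>l = 0..<n. if l = i then d i * y $ i else 0)"
    using y i by (subst index_mult_mat_vec, simp, unfold scalar_prod_def, intro sum.cong) auto
  then show "(real_diag n d *\<^sub>v y) $ i = vec n (\<lambda>i. d i * y $ i) $ i"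
    using i by simp
qed auto

lemma order_char_poly_diag:
  fixes U :: "complex mat"
  assumes U: "U \<in> carrier_mat n n" "U\<^sup>H * U = 1\<^sub>m n" and A: "A = U * real_diag n d * U\<^sup>H"
  shows "order (complex_of_real x) (char_poly A) = card {i. i < n \<and> d i = x}"
proof -
  have UH: "U\<^sup>H \<in> carrier_mat n n" using U by simp
  have "U * U\<^sup>H = 1\<^sub>m n" using mat_mult_left_right_inverse[OF UH U(1)] U by simp
  then have "similar_mat A (real_diag n d)"
    using U UH A by (intro similar_matI[of _ _ U "U\<^sup>H" n]) auto
  then have "char_poly A = char_poly (real_diag n d)" by (rule char_poly_similar)
  also have "\<dots> = (\<Prod>a\<leftarrow>diag_mat (real_diag n d). [:- a, 1:])"
    by (rule char_poly_upper_triangular[of _ n]) auto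
  also have "diag_mat (real_diag n d) = map (\<lambda>i. complex_of_real (d i)) [0..<n]"
    by (auto simp: diag_mat_def)
  finally have "order (complex_of_real x) (char_poly A) =
      sum_list (map (\<lambda>i. if d i = x then 1 else 0) [0..<n])"
    by (simp, subst order_prod_list) (auto simp: o_def order_linear' intro!: arg_cong[of _ _ sum_list])
  also have "\<dots> = (\<Sum>i = 0..<n. if d i = x then 1 else 0)"
    by (simp add: sum_list_distinct_conv_sum_set)
  also have "\<dots> = card ({0..<n} \<inter> {i. d i = x})"
    by (subst card_eq_sum) (simp add: sum.If_cases)
  also have "{0..<n} \<inter> {i. d i = x} = {i. i < n \<and> d i = x}" by auto
  finally show ?thesis .
qed

text \<open>The definition sums multiplicities over distinct eigenvalues; the sets of indices with a
  given value of \<open>d\<close> are disjoint, so the sum counts indices. From here on the inertia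
  is handled through the signs of the diagonal entries alone.\<close>

lemma inertia_diag:
  fixes U :: "complex mat"
  assumes U: "U \<in> carrier_mat n n" "U\<^sup>H * U = 1\<^sub>m n" and A: "A = U * real_diag n d * U\<^sup>H"
  shows "i\<^sub>+ A = card {i. i < n \<and> 0 < d i}" "i\<^sub>- A = card {i. i < n \<and> d i < 0}"
proof -
  have Ac: "A \<in> carrier_mat n n" using U A by auto
  have "char_poly A \<noteq> 0" using degree_monic_char_poly[OF Ac] by auto
  then have ev: "eigenvalue A (complex_of_real x) \<longleftrightarrow> (\<exists>i<n. d i = x)" for x
    using order_root[of "char_poly A" "complex_of_real x"] order_char_poly_diag[OF assms, of x]
    by (auto simp: eigenvalue_root_char_poly[OF Ac])
  have count: "(\<Sum>x | P x \<and> eigenvalue A (complex_of_real x).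
      order (complex_of_real x) (char_poly A)) = card {i. i < n \<and> P (d i)}" for P
  proof -
    have "{x. P x \<and> eigenvalue A (complex_of_real x)} = d ` {i. i < n \<and> P (d i)}"
      unfolding ev by auto
    then have "(\<Sum>x | P x \<and> eigenvalue A (complex_of_real x). order (complex_of_real x) (char_poly A))
        = (\<Sum>x\<in>d ` {i. i < n \<and> P (d i)}. card {i. i < n \<and> d i = x})"
      by (simp add: order_char_poly_diag[OF assms])
    also have "\<dots> = card (\<Union>x\<in>d ` {i. i < n \<and> P (d i)}. {i. i < n \<and> d i = x})"
      by (rule card_UN_disjoint[symmetric]) auto
    also have "(\<Union>x\<in>d ` {i. i < n \<and> P (d i)}. {i. i < n \<and> d i = x}) = {i. i < n \<and> P (d i)}"
      by auto
    finally show ?thesis .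
  qed
  show "i\<^sub>+ A = card {i. i < n \<and> 0 < d i}" "i\<^sub>- A = card {i. i < n \<and> d i < 0}"
    unfolding pos_inertia_def neg_inertia_def by (rule count)+
qed

lemma neg_inertia_uminus:
  assumes A: "A \<in> carrier_mat n n" "hermitian A"
  shows "i\<^sub>- A = i\<^sub>+ (- A)"
proof -
  obtain U d where U: "U \<in> carrier_mat n n" "U\<^sup>H * U = 1\<^sub>m n" "A = U * real_diag n d * U\<^sup>H"
    by (rule unitary_diagonalization[OF A])
  have "real_diag n (\<lambda>i. - d i) = - real_diag n d" by (intro eq_matI) auto
  then have "- A = U * real_diag n (\<lambda>i. - d i) * U\<^sup>H" using U by simp
  then show ?thesis using inertia_diag(2)[OF U] inertia_diag(1)[OF U(1,2)] by simp
qed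

lemma Re_mult_cnj: "Re (complex_of_real r * z * cnj z) = r * (cmod z)\<^sup>2"
  by (simp add: cmod_power2) (simp add: power2_eq_square algebra_simps)

lemma quad_form_diag:
  fixes U :: "complex mat"
  assumes U: "U \<in> carrier_mat n n" and A: "A = U * real_diag n d * U\<^sup>H" and x: "x \<in> carrier_vec n"
  shows "quad_form A x = (\<Sum>i<n. d i * (cmod ((U\<^sup>H *\<^sub>v x) $ i))\<^sup>2)"
proof -
  define y where "y = U\<^sup>H *\<^sub>v x"
  have UH: "U\<^sup>H \<in> carrier_mat n n" using U by simp
  have y: "y \<in> carrier_vec n" unfolding y_def using UH x by (rule mult_mat_vec_carrier)
  have Dy: "real_diag n d *\<^sub>v y = vec n (\<lambda>i. d i * y $ i)"
    by (rule real_diag_mult_vec[OF y])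
  have "A *\<^sub>v x = U *\<^sub>v (real_diag n d *\<^sub>v y)"
    using U UH x by (simp add: A y_def assoc_mult_mat_vec[of _ n n _ n])
  then have "quad_form A x = re_inner (real_diag n d *\<^sub>v y) y"
    using re_inner_adjoint[OF U _ x, of "real_diag n d *\<^sub>v y"] y
    by (simp add: quad_form_re_inner y_def mult_mat_vec_carrier[of _ n n])
  also have "\<dots> = (\<Sum>i<n. d i * (cmod (y $ i))\<^sup>2)"
    unfolding Dy using y
    by (subst re_inner_sum[of _ n]) (auto simp: Re_mult_cnj simp del: times_complex.sel intro!: sum.cong)
  finally show ?thesis by (simp add: y_def)
qed

text \<open>\<open>g\<close> reads off the coordinates of \<open>x\<close> along the eigenvectors
  with positive eigenvalue. If they vanish, the form is a sum of nonpositive terms, and if that sum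
  is zero, so is each term, which puts \<open>x\<close> into the kernel.\<close>

lemma pos_functionals:
  assumes A: "A \<in> carrier_mat n n" "hermitian A"
  obtains g where "lin n (i\<^sub>+ A) g"
    "\<And>x. x \<in> carrier_vec n \<Longrightarrow> g x = 0\<^sub>v (i\<^sub>+ A) \<Longrightarrow> quad_form A x \<le> 0"
    "\<And>x. x \<in> carrier_vec n \<Longrightarrow> g x = 0\<^sub>v (i\<^sub>+ A) \<Longrightarrow> quad_form A x = 0 \<Longrightarrow> A *\<^sub>v x = 0\<^sub>v n"
proof -
  obtain U d where U: "U \<in> carrier_mat n n" "U\<^sup>H * U = 1\<^sub>m n" "A = U * real_diag n d * U\<^sup>H"
    by (rule unitary_diagonalization[OF A])
  have UH: "U\<^sup>H \<in> carrier_mat n n" using U by simp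
  define I where "I = {i. i < n \<and> 0 < d i}"
  obtain b where b: "bij_betw b {0..<i\<^sub>+ A} I"
    using ex_bij_betw_nat_finite[of I] inertia_diag(1)[OF U] by (auto simp: I_def)
  have b_less: "b j < n" if "j < i\<^sub>+ A" for j
    using bij_betwE[OF b] that by (auto simp: I_def)
  define G where "G = mat (i\<^sub>+ A) n (\<lambda>(j, l). U\<^sup>H $$ (b j, l))"
  have G: "G \<in> carrier_mat (i\<^sub>+ A) n" by (simp add: G_def)
  have Gx: "(U\<^sup>H *\<^sub>v x) $ i = 0" if x: "x \<in> carrier_vec n" "G *\<^sub>v x = 0\<^sub>v (i\<^sub>+ A)" and i: "i \<in> I" for x i
  proof -
    obtain j where j: "j < i\<^sub>+ A" "b j = i" using b i by (auto simp: bij_betw_def)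
    have "row G j = row (U\<^sup>H) i" using j b_less UH U(1) by (intro eq_vecI) (auto simp: G_def)
    then have "(U\<^sup>H *\<^sub>v x) $ i = (G *\<^sub>v x) $ j" using j b_less[of j] U(1) G by auto
    then show ?thesis using x j by simp
  qed
  have nonpos: "d i * (cmod ((U\<^sup>H *\<^sub>v x) $ i))\<^sup>2 \<le> 0"
    if "x \<in> carrier_vec n" "G *\<^sub>v x = 0\<^sub>v (i\<^sub>+ A)" "i < n" for x i
    using Gx[OF that(1,2), of i] that(3) by (cases "0 < d i") (auto simp: I_def mult_nonpos_nonneg)
  show thesis
  proof (rule that[of "\<lambda>x. G *\<^sub>v x"])
    show "lin n (i\<^sub>+ A) (\<lambda>x. G *\<^sub>v x)" using G by (auto intro: linI)
    fix x assume x: "x \<in> carrier_vec n" "G *\<^sub>v x = 0\<^sub>v (i\<^sub>+ A)"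
    show "quad_form A x \<le> 0"
      unfolding quad_form_diag[OF U(1,3) x(1)] using nonpos[OF x] by (intro sum_nonpos) auto
    assume "quad_form A x = 0"
    then have "(\<Sum>i<n. - (d i * (cmod ((U\<^sup>H *\<^sub>v x) $ i))\<^sup>2)) = 0"
      unfolding quad_form_diag[OF U(1,3) x(1)] by (simp add: sum_negf)
    then have "\<forall>i\<in>{..<n}. - (d i * (cmod ((U\<^sup>H *\<^sub>v x) $ i))\<^sup>2) = 0"
      using nonpos[OF x] by (subst (asm) sum_nonneg_eq_0_iff) auto
    then have 0: "d i * (U\<^sup>H *\<^sub>v x) $ i = 0" if "i < n" for i using that by auto
    have y: "U\<^sup>H *\<^sub>v x \<in> carrier_vec n" using UH x(1) by (rule mult_mat_vec_carrier)
    then have "real_diag n d *\<^sub>v (U\<^sup>H *\<^sub>v x) = vec n (\<lambda>i. d i * (U\<^sup>H *\<^sub>v x) $ i)"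
      by (rule real_diag_mult_vec)
    also have "\<dots> = 0\<^sub>v n" using 0 by (intro eq_vecI) (auto simp del: index_mult_mat_vec)
    finally have "U *\<^sub>v (real_diag n d *\<^sub>v (U\<^sup>H *\<^sub>v x)) = 0\<^sub>v n"
      using mult_mat_vec_zero[OF U(1)] by simp
    moreover have "A *\<^sub>v x = U *\<^sub>v (real_diag n d *\<^sub>v (U\<^sup>H *\<^sub>v x))"
      using U(1) UH x(1) by (simp add: U(3) assoc_mult_mat_vec[of _ n n _ n])
    ultimately show "A *\<^sub>v x = 0\<^sub>v n" by simp
  qed
qed

text \<open>The parameters run over the span of the eigenvectors with positive eigenvalue:
  \<open>E\<close> places the entries of \<open>c\<close> at the positive entries of
  \<open>d\<close> and fills up with zeros.\<close>

lemma pos_domain: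
  assumes A: "A \<in> carrier_mat n n" "hermitian A"
  obtains f where "lin (i\<^sub>+ A) n f"
    "\<And>c. c \<in> carrier_vec (i\<^sub>+ A) \<Longrightarrow> c \<noteq> 0\<^sub>v (i\<^sub>+ A) \<Longrightarrow> 0 < quad_form A (f c)"
proof -
  obtain U d where U: "U \<in> carrier_mat n n" "U\<^sup>H * U = 1\<^sub>m n" "A = U * real_diag n d * U\<^sup>H"
    by (rule unitary_diagonalization[OF A])
  have UH: "U\<^sup>H \<in> carrier_mat n n" using U by simp
  define I where "I = {i. i < n \<and> 0 < d i}"
  let ?k = "i\<^sub>+ A"
  obtain b where b: "bij_betw b {0..<?k} I"
    using ex_bij_betw_nat_finite[of I] inertia_diag(1)[OF U] by (auto simp: I_def)
  have bI: "b j \<in> I" if "j < ?k" for j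
    using bij_betwE[OF b] that by auto
  define E where "E = mat n ?k (\<lambda>(i, j). if b j = i then 1 else 0 :: complex)"
  have E: "E \<in> carrier_mat n ?k" by (simp add: E_def)
  have Eb: "(E *\<^sub>v c) $ b j = c $ j" if "c \<in> carrier_vec ?k" "j < ?k" for c :: "complex vec" and j
  proof -
    have "(E *\<^sub>v c) $ b j = (\<Sum>l = 0..<?k. (if b l = b j then 1 else 0) * c $ l)"
      using that bI[OF that(2)] by (auto simp: E_def scalar_prod_def I_def intro!: sum.cong)
    also have "\<dots> = (\<Sum>l = 0..<?k. if l = j then c $ j else 0)"
      using bij_betw_imp_inj_on[OF b] that(2) by (intro sum.cong) (auto simp: inj_on_def)
    finally show ?thesis using that by simp
  qed
  have E0: "(E *\<^sub>v c) $ i = 0" if "c \<in> carrier_vec ?k" "i < n" "i \<notin> I" for c :: "complex vec" and i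
    using that bI by (auto simp: E_def scalar_prod_def intro!: sum.neutral)
  show thesis
  proof (rule that[of "\<lambda>c. U *\<^sub>v (E *\<^sub>v c)"])
    show "lin ?k n (\<lambda>c. U *\<^sub>v (E *\<^sub>v c))"
      using lin_mat[OF U(1) lin_mat[OF E lin_id]] .
    fix c :: "complex vec" assume c: "c \<in> carrier_vec ?k" "c \<noteq> 0\<^sub>v ?k"
    have Ec: "E *\<^sub>v c \<in> carrier_vec n" using E c(1) by (rule mult_mat_vec_carrier)
    have "U\<^sup>H *\<^sub>v (U *\<^sub>v (E *\<^sub>v c)) = E *\<^sub>v c"
      using assoc_mult_mat_vec[OF UH U(1) Ec] U(2) Ec by simp
    then have q: "quad_form A (U *\<^sub>v (E *\<^sub>v c)) = (\<Sum>i<n. d i * (cmod ((E *\<^sub>v c) $ i))\<^sup>2)"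
      using quad_form_diag[OF U(1,3), of "U *\<^sub>v (E *\<^sub>v c)"] mult_mat_vec_carrier[OF U(1) Ec] by simp
    obtain j where j: "j < ?k" "c $ j \<noteq> 0"
      using c by (metis carrier_vecD eq_vecI index_zero_vec)
    have nonneg: "0 \<le> d i * (cmod ((E *\<^sub>v c) $ i))\<^sup>2" if "i < n" for i
      using E0[OF c(1) that] by (cases "i \<in> I") (auto simp: I_def)
    have "0 < d (b j) * (cmod ((E *\<^sub>v c) $ b j))\<^sup>2"
      using bI[OF j(1)] Eb[OF c(1) j(1)] j(2) by (simp add: I_def)
    then show "0 < quad_form A (U *\<^sub>v (E *\<^sub>v c))"
      unfolding q using bI[OF j(1)] nonneg by (intro sum_pos2[of _ "b j"]) (auto simp: I_def)
  qed
qed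

text \<open>Sylvester's argument: a positive subspace of dimension above \<open>i\<^sub>+ A\<close>
  would meet the subspace cut out by \<open>pos_functionals\<close>, where the form is
  nonpositive.\<close>

lemma pos_inertia_ge:
  assumes A: "A \<in> carrier_mat n n" "hermitian A" and f: "lin k n f"
    and pos: "\<And>c. c \<in> carrier_vec k \<Longrightarrow> c \<noteq> 0\<^sub>v k \<Longrightarrow> 0 < quad_form A (f c)"
  shows "k \<le> i\<^sub>+ A"
proof (rule ccontr)
  assume "\<not> k \<le> i\<^sub>+ A"
  moreover obtain g where g: "lin n (i\<^sub>+ A) g"
    "\<And>x. x \<in> carrier_vec n \<Longrightarrow> g x = 0\<^sub>v (i\<^sub>+ A) \<Longrightarrow> quad_form A x \<le> 0"
    using pos_functionals[OF A] by metis
  ultimately obtain c where "c \<in> carrier_vec k" "c \<noteq> 0\<^sub>v k" "g (f c) = 0\<^sub>v (i\<^sub>+ A)"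
    using lin_kernel_nontrivial[OF lin_compose[OF g(1) f]] by (metis not_le)
  then show False using pos g(2) f lin_carrier by (metis not_le)
qed

lemma neg_functionals:
  assumes A: "A \<in> carrier_mat n n" "hermitian A"
  obtains g where "lin n (i\<^sub>- A) g"
    "\<And>x. x \<in> carrier_vec n \<Longrightarrow> g x = 0\<^sub>v (i\<^sub>- A) \<Longrightarrow> 0 \<le> quad_form A x"
    "\<And>x. x \<in> carrier_vec n \<Longrightarrow> g x = 0\<^sub>v (i\<^sub>- A) \<Longrightarrow> quad_form A x = 0 \<Longrightarrow> A *\<^sub>v x = 0\<^sub>v n"
proof -
  have A': "- A \<in> carrier_mat n n" "hermitian (- A)" using A by (auto intro: hermitian_uminus)
  obtain g where g: "lin n (i\<^sub>- A) g"
    "\<And>x. x \<in> carrier_vec n \<Longrightarrow> g x = 0\<^sub>v (i\<^sub>- A) \<Longrightarrow> quad_form (- A) x \<le> 0"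
    "\<And>x. x \<in> carrier_vec n \<Longrightarrow> g x = 0\<^sub>v (i\<^sub>- A) \<Longrightarrow> quad_form (- A) x = 0 \<Longrightarrow> - A *\<^sub>v x = 0\<^sub>v n"
    using pos_functionals[OF A'] neg_inertia_uminus[OF A] by metis
  show thesis
  proof (rule that[OF g(1)])
    fix x assume x: "x \<in> carrier_vec n" "g x = 0\<^sub>v (i\<^sub>- A)"
    show "0 \<le> quad_form A x" using g(2)[OF x] quad_form_uminus[OF A(1) x(1)] by simp
    assume "quad_form A x = 0"
    then have "- (A *\<^sub>v x) = 0\<^sub>v n"
      using g(3)[OF x] quad_form_uminus[OF A(1) x(1)] A x by simp
    then show "A *\<^sub>v x = 0\<^sub>v n"
      using A(1) x by (metis uminus_uminus_vec uminus_zero_vec)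
  qed
qed

lemma neg_domain:
  assumes A: "A \<in> carrier_mat n n" "hermitian A"
  obtains f where "lin (i\<^sub>- A) n f"
    "\<And>c. c \<in> carrier_vec (i\<^sub>- A) \<Longrightarrow> c \<noteq> 0\<^sub>v (i\<^sub>- A) \<Longrightarrow> quad_form A (f c) < 0"
proof -
  have A': "- A \<in> carrier_mat n n" "hermitian (- A)" using A by (auto intro: hermitian_uminus)
  obtain f where f: "lin (i\<^sub>- A) n f"
    "\<And>c. c \<in> carrier_vec (i\<^sub>- A) \<Longrightarrow> c \<noteq> 0\<^sub>v (i\<^sub>- A) \<Longrightarrow> 0 < quad_form (- A) (f c)"
    using pos_domain[OF A'] neg_inertia_uminus[OF A] by metis
  show thesis
    by (rule that[OF f(1)]) (use f quad_form_uminus[OF A(1)] lin_carrier in fastforce)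
qed

lemma neg_inertia_ge:
  assumes A: "A \<in> carrier_mat n n" "hermitian A" and f: "lin k n f"
    and neg: "\<And>c. c \<in> carrier_vec k \<Longrightarrow> c \<noteq> 0\<^sub>v k \<Longrightarrow> quad_form A (f c) < 0"
  shows "k \<le> i\<^sub>- A"
  unfolding neg_inertia_uminus[OF A]
  by (rule pos_inertia_ge[of "- A" n k f])
    (use A f neg quad_form_uminus[OF A(1)] lin_carrier[OF f] in \<open>auto intro: hermitian_uminus\<close>)

lemma rank_eq_inertia:
  assumes A: "A \<in> carrier_mat n n" "hermitian A"
  shows "mat_rank A = i\<^sub>+ A + i\<^sub>- A"
proof (rule antisym)
  obtain g where g: "lin n (i\<^sub>+ A) g"
    "\<And>x. x \<in> carrier_vec n \<Longrightarrow> g x = 0\<^sub>v (i\<^sub>+ A) \<Longrightarrow> quad_form A x \<le> 0"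
    "\<And>x. x \<in> carrier_vec n \<Longrightarrow> g x = 0\<^sub>v (i\<^sub>+ A) \<Longrightarrow> quad_form A x = 0 \<Longrightarrow> A *\<^sub>v x = 0\<^sub>v n"
    using pos_functionals[OF A] by metis
  obtain h where h: "lin n (i\<^sub>- A) h"
    "\<And>x. x \<in> carrier_vec n \<Longrightarrow> h x = 0\<^sub>v (i\<^sub>- A) \<Longrightarrow> 0 \<le> quad_form A x"
    using neg_functionals[OF A] by metis
  show "mat_rank A \<le> i\<^sub>+ A + i\<^sub>- A"
  proof (rule rank_le[OF A(1) lin_append[OF g(1) h(1)]])
    fix x assume x: "x \<in> carrier_vec n" "g x @\<^sub>v h x = 0\<^sub>v (i\<^sub>+ A + i\<^sub>- A)"
    then have "g x = 0\<^sub>v (i\<^sub>+ A)" "h x = 0\<^sub>v (i\<^sub>- A)"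
      using append_vec_eq_0 lin_carrier[OF g(1) x(1)] lin_carrier[OF h(1) x(1)] by blast+
    then show "A *\<^sub>v x = 0\<^sub>v n" using g h x by (metis antisym)
  qed
next
  obtain f where f: "lin (i\<^sub>+ A) n f"
    "\<And>c. c \<in> carrier_vec (i\<^sub>+ A) \<Longrightarrow> c \<noteq> 0\<^sub>v (i\<^sub>+ A) \<Longrightarrow> 0 < quad_form A (f c)"
    using pos_domain[OF A] by metis
  obtain h where h: "lin (i\<^sub>- A) n h"
    "\<And>c. c \<in> carrier_vec (i\<^sub>- A) \<Longrightarrow> c \<noteq> 0\<^sub>v (i\<^sub>- A) \<Longrightarrow> quad_form A (h c) < 0"
    using neg_domain[OF A] by metis
  show "i\<^sub>+ A + i\<^sub>- A \<le> mat_rank A"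
  proof (rule rank_ge[OF A(1)])
    show "lin (i\<^sub>+ A + i\<^sub>- A) n (\<lambda>c. f (vec_first c (i\<^sub>+ A)) + h (vec_last c (i\<^sub>- A)))"
      by (intro lin_add lin_compose[OF f(1)] lin_compose[OF h(1)] lin_first lin_last)
    fix c assume c: "c \<in> carrier_vec (i\<^sub>+ A + i\<^sub>- A)"
      "A *\<^sub>v (f (vec_first c (i\<^sub>+ A)) + h (vec_last c (i\<^sub>- A))) = 0\<^sub>v n"
    define u where "u = f (vec_first c (i\<^sub>+ A))"
    define w where "w = h (vec_last c (i\<^sub>- A))"
    have u: "u \<in> carrier_vec n" and w: "w \<in> carrier_vec n"
      unfolding u_def w_def using lin_carrier[OF f(1)] lin_carrier[OF h(1)] by auto
    have Au: "A *\<^sub>v u \<in> carrier_vec n" and Aw: "A *\<^sub>v w \<in> carrier_vec n"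
      using u w A mult_mat_vec_carrier by blast+
    have 0: "A *\<^sub>v u + A *\<^sub>v w = 0\<^sub>v n"
      using c(2) u w A mult_add_distrib_mat_vec[of A n n u w] by (simp add: u_def w_def)
    have "re_inner (A *\<^sub>v u) u + re_inner (A *\<^sub>v w) u = 0"
      "re_inner (A *\<^sub>v u) w + re_inner (A *\<^sub>v w) w = 0"
      using arg_cong[OF 0, of "\<lambda>v. re_inner v u"] arg_cong[OF 0, of "\<lambda>v. re_inner v w"] u w Au Aw
      by (simp_all add: re_inner_add_left[of _ n])
    \<comment> \<open>Pairing \<open>A (u + w) = 0\<close> with \<open>u\<close> and with
      \<open>w\<close> gives both forms the value \<open>- re_inner (A u) w\<close>. Since the form
      is nonnegative at \<open>u\<close> and nonpositive at \<open>w\<close>, both values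
      vanish.\<close>
    then have eq: "quad_form A u = quad_form A w"
      using hermitian_re_inner[OF A u w] by (simp add: quad_form_re_inner)
    show "c = 0\<^sub>v (i\<^sub>+ A + i\<^sub>- A)"
    proof (rule ccontr)
      assume ne: "c \<noteq> 0\<^sub>v (i\<^sub>+ A + i\<^sub>- A)"
      have u0: "vec_first c (i\<^sub>+ A) = 0\<^sub>v (i\<^sub>+ A) \<Longrightarrow> u = 0\<^sub>v n"
        and w0: "vec_last c (i\<^sub>- A) = 0\<^sub>v (i\<^sub>- A) \<Longrightarrow> w = 0\<^sub>v n"
        using lin_zero_arg[OF f(1)] lin_zero_arg[OF h(1)] by (simp_all add: u_def w_def)
      have "vec_first c (i\<^sub>+ A) \<noteq> 0\<^sub>v (i\<^sub>+ A) \<Longrightarrow> 0 < quad_form A u"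
        "vec_last c (i\<^sub>- A) \<noteq> 0\<^sub>v (i\<^sub>- A) \<Longrightarrow> quad_form A w < 0"
        using f(2) h(2) by (simp_all add: u_def w_def)
      then show False
        using vec_split_cases[OF c(1) ne] eq u0 w0 quad_form_zero[OF A(1)]
        by (metis less_asym order.irrefl)
    qed
  qed
qed

lemma pos_inertia_eq_dim_iff:
  assumes A: "A \<in> carrier_mat n n" "hermitian A"
  shows "i\<^sub>+ A = n \<longleftrightarrow> pos_def A"
proof
  assume i: "i\<^sub>+ A = n"
  then have r: "mat_rank A = n" "i\<^sub>- A = 0"
    using rank_le_dim[OF A(1)] rank_eq_inertia[OF A] by auto
  obtain g where g: "lin n 0 g"
    "\<And>x. x \<in> carrier_vec n \<Longrightarrow> g x = 0\<^sub>v 0 \<Longrightarrow> 0 \<le> quad_form A x"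
    "\<And>x. x \<in> carrier_vec n \<Longrightarrow> g x = 0\<^sub>v 0 \<Longrightarrow> quad_form A x = 0 \<Longrightarrow> A *\<^sub>v x = 0\<^sub>v n"
    using neg_functionals[OF A] r by metis
  have "g x = 0\<^sub>v 0" if "x \<in> carrier_vec n" for x using lin_carrier[OF g(1) that] by auto
  then have "quad_form A x > 0" if "x \<in> carrier_vec n" "x \<noteq> 0\<^sub>v n" for x
    using g(2,3) that rank_eq_dim_iff[OF A(1)] r(1) by (metis order_le_less)
  then show "pos_def A" using A by (auto simp: pos_def_def)
next
  assume "pos_def A"
  then have "n \<le> i\<^sub>+ A" using A by (intro pos_inertia_ge[OF A lin_id]) (auto simp: pos_def_def)
  then show "i\<^sub>+ A = n" using rank_le_dim[OF A(1)] rank_eq_inertia[OF A] by auto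
qed

lemma neg_inertia_eq_0_iff:
  assumes A: "A \<in> carrier_mat n n" "hermitian A"
  shows "i\<^sub>- A = 0 \<longleftrightarrow> pos_semidef A"
proof
  assume i: "i\<^sub>- A = 0"
  obtain g where g: "lin n 0 g"
    "\<And>x. x \<in> carrier_vec n \<Longrightarrow> g x = 0\<^sub>v 0 \<Longrightarrow> 0 \<le> quad_form A x"
    using neg_functionals[OF A] i by metis
  have "g x = 0\<^sub>v 0" if "x \<in> carrier_vec n" for x using lin_carrier[OF g(1) that] by auto
  then show "pos_semidef A" using A g by (auto simp: pos_semidef_def)
next
  assume psd: "pos_semidef A"
  obtain f where f: "lin (i\<^sub>- A) n f"
    "\<And>c. c \<in> carrier_vec (i\<^sub>- A) \<Longrightarrow> c \<noteq> 0\<^sub>v (i\<^sub>- A) \<Longrightarrow> quad_form A (f c) < 0"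
    using neg_domain[OF A] by metis
  show "i\<^sub>- A = 0"
  proof (rule ccontr)
    assume "i\<^sub>- A \<noteq> 0"
    define c where "c = (unit_vec (i\<^sub>- A) 0 :: complex vec)"
    have c: "c \<in> carrier_vec (i\<^sub>- A)" "c \<noteq> 0\<^sub>v (i\<^sub>- A)"
      using unit_vec_nonzero[of 0 "i\<^sub>- A"] \<open>i\<^sub>- A \<noteq> 0\<close> by (simp_all add: c_def)
    have "quad_form A (f c) < 0" "f c \<in> carrier_vec n"
      by (rule f(2)[OF c], rule lin_carrier[OF f(1) c(1)])
    then show False using psd carrier_matD(1)[OF A(1)] by (metis not_less pos_semidef_def)
  qed
qed

lemma neg_inertia_eq_dim_iff:
  assumes A: "A \<in> carrier_mat n n" "hermitian A"
  shows "i\<^sub>- A = n \<longleftrightarrow> neg_def A"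
proof -
  have "pos_def (- A) \<longleftrightarrow> neg_def A"
    using A hermitian_uminus[OF A(2)] by (auto simp: pos_def_def neg_def_def quad_form_uminus[of A n])
  then show ?thesis
    using pos_inertia_eq_dim_iff[of "- A" n] neg_inertia_uminus[OF A] A hermitian_uminus by auto
qed

lemma pos_inertia_eq_0_iff:
  assumes A: "A \<in> carrier_mat n n" "hermitian A"
  shows "i\<^sub>+ A = 0 \<longleftrightarrow> neg_semidef A"
proof -
  have A': "- A \<in> carrier_mat n n" "hermitian (- A)" using A by (auto intro: hermitian_uminus)
  have "pos_semidef (- A) \<longleftrightarrow> neg_semidef A"
    using A A'(2) by (auto simp: pos_semidef_def neg_semidef_def quad_form_uminus[of A n])
  then show ?thesis
    using neg_inertia_eq_0_iff[OF A'] neg_inertia_uminus[OF A'] by simp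
qed

section \<open>Spectral bounds, congruence and Gram perturbations\<close>

lemma quad_form_bounded:
  assumes A: "A \<in> carrier_mat n n" "hermitian A"
  obtains t where "0 < t" "\<And>x. x \<in> carrier_vec n \<Longrightarrow> quad_form A x \<le> t * re_inner x x"
proof -
  obtain U d where U: "U \<in> carrier_mat n n" "U\<^sup>H * U = 1\<^sub>m n" "A = U * real_diag n d * U\<^sup>H"
    by (rule unitary_diagonalization[OF A])
  have UH: "U\<^sup>H \<in> carrier_mat n n" using U by simp
  have UU: "U * U\<^sup>H = 1\<^sub>m n" using mat_mult_left_right_inverse[OF UH U(1)] U by simp
  \<comment> \<open>The summand 1 keeps \<open>t\<close> positive for the zero matrix and in
    dimension 0.\<close>
  define t where "t = 1 + (\<Sum>i<n. \<bar>d i\<bar>)"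
  have d: "d i \<le> t" if "i < n" for i
    using member_le_sum[of i "{..<n}" "\<lambda>i. \<bar>d i\<bar>"] that by (auto simp: t_def)
  show thesis
  proof (rule that[of t])
    show "0 < t" by (simp add: t_def add_pos_nonneg sum_nonneg)
    fix x :: "complex vec" assume x: "x \<in> carrier_vec n"
    have Ux: "U\<^sup>H *\<^sub>v x \<in> carrier_vec n" using UH x by (rule mult_mat_vec_carrier)
    have "quad_form A x \<le> (\<Sum>i<n. t * (cmod ((U\<^sup>H *\<^sub>v x) $ i))\<^sup>2)"
      unfolding quad_form_diag[OF U(1,3) x] using d by (intro sum_mono mult_right_mono) auto
    also have "\<dots> = t * re_inner (U\<^sup>H *\<^sub>v x) (U\<^sup>H *\<^sub>v x)"
      using Ux by (simp add: re_inner_self sum_distrib_left)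
    also have "re_inner (U\<^sup>H *\<^sub>v x) (U\<^sup>H *\<^sub>v x) = re_inner x x"
      using re_inner_adjoint[OF UH x Ux] U(1) UU UH x assoc_mult_mat_vec[OF U(1) UH x] by simp
    finally show "quad_form A x \<le> t * re_inner x x" .
  qed
qed

lemma pos_semidef_kernel:
  assumes A: "A \<in> carrier_mat n n" "pos_semidef A" and x: "x \<in> carrier_vec n" "quad_form A x = 0"
  shows "A *\<^sub>v x = 0\<^sub>v n"
proof -
  have h: "hermitian A" using A by (simp add: pos_semidef_def)
  then have i: "i\<^sub>- A = 0" using neg_inertia_eq_0_iff A by blast
  obtain g where g: "lin n 0 g"
    "\<And>x. x \<in> carrier_vec n \<Longrightarrow> g x = 0\<^sub>v 0 \<Longrightarrow> quad_form A x = 0 \<Longrightarrow> A *\<^sub>v x = 0\<^sub>v n"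
    using neg_functionals[OF A(1) h] i by metis
  have "g x = 0\<^sub>v 0" using lin_carrier[OF g(1) x(1)] by auto
  then show ?thesis using g x by blast
qed

lemma pos_def_lower_bound:
  assumes A: "A \<in> carrier_mat n n" "pos_def A"
  obtains e where "0 < e" "\<And>x. x \<in> carrier_vec n \<Longrightarrow> e * re_inner x x \<le> quad_form A x"
proof -
  have h: "hermitian A" using A by (simp add: pos_def_def)
  obtain U d where U: "U \<in> carrier_mat n n" "U\<^sup>H * U = 1\<^sub>m n" "A = U * real_diag n d * U\<^sup>H"
    by (rule unitary_diagonalization[OF A(1) h])
  have UH: "U\<^sup>H \<in> carrier_mat n n" using U by simp
  have UU: "U * U\<^sup>H = 1\<^sub>m n" using mat_mult_left_right_inverse[OF UH U(1)] U by simp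
  have "card {i. i < n \<and> 0 < d i} = card {..<n}"
    using inertia_diag(1)[OF U] pos_inertia_eq_dim_iff[OF A(1) h] A(2) by simp
  moreover have "{i. i < n \<and> 0 < d i} \<subseteq> {..<n}" by auto
  ultimately have "{i. i < n \<and> 0 < d i} = {..<n}" by (intro card_subset_eq) auto
  then have dpos: "0 < d i" if "i < n" for i using that by auto
  \<comment> \<open>Including 1 keeps the set nonempty for \<open>n = 0\<close> and can only lower
    the minimum.\<close>
  define e where "e = Min (insert 1 (d ` {..<n}))"
  show thesis
  proof (rule that[of e])
    show "0 < e" using dpos by (auto simp: e_def)
    fix x :: "complex vec" assume x: "x \<in> carrier_vec n"
    have Ux: "U\<^sup>H *\<^sub>v x \<in> carrier_vec n" using UH x by (rule mult_mat_vec_carrier)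
    have "re_inner x x = re_inner (U\<^sup>H *\<^sub>v x) (U\<^sup>H *\<^sub>v x)"
      using re_inner_adjoint[OF UH x Ux] UU x assoc_mult_mat_vec[OF U(1) UH x] by simp
    then have "e * re_inner x x = (\<Sum>i<n. e * (cmod ((U\<^sup>H *\<^sub>v x) $ i))\<^sup>2)"
      using Ux by (simp add: re_inner_self sum_distrib_left)
    also have "\<dots> \<le> quad_form A x"
      unfolding quad_form_diag[OF U(1,3) x] by (intro sum_mono mult_right_mono) (auto simp: e_def)
    finally show "e * re_inner x x \<le> quad_form A x" .
  qed
qed

lemma quad_form_congruence:
  fixes A V :: "complex mat"
  assumes A: "A \<in> carrier_mat n n" and V: "V \<in> carrier_mat n k" and c: "c \<in> carrier_vec k"
  shows "quad_form (V\<^sup>H * A * V) c = quad_form A (V *\<^sub>v c)"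
proof -
  have VH: "V\<^sup>H \<in> carrier_mat k n" using V by simp
  have Vc: "V *\<^sub>v c \<in> carrier_vec n" using V c by (rule mult_mat_vec_carrier)
  have AVc: "A *\<^sub>v (V *\<^sub>v c) \<in> carrier_vec n" using A Vc by (rule mult_mat_vec_carrier)
  have "V\<^sup>H * A * V *\<^sub>v c = V\<^sup>H *\<^sub>v (A *\<^sub>v (V *\<^sub>v c))"
    using assoc_mult_mat_vec[OF mult_carrier_mat[OF VH A] V c] assoc_mult_mat_vec[OF VH A Vc] by simp
  then show ?thesis
    using re_inner_adjoint[OF VH AVc c] by (simp add: quad_form_re_inner)
qed

lemma hermitian_congruence:
  assumes A: "A \<in> carrier_mat n n" "hermitian A" and V: "V \<in> carrier_mat n k"
  shows "hermitian (V\<^sup>H * A * V)"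
proof -
  have VH: "V\<^sup>H \<in> carrier_mat k n" using V by simp
  show ?thesis
    unfolding hermitian_def mat_adjoint_mult[OF mult_carrier_mat[OF VH A(1)] V]
      mat_adjoint_mult[OF VH A(1)]
    using A(2) assoc_mult_mat[OF VH A(1) V] by (simp add: hermitian_def)
qed

lemma hermitian_add: "A \<in> carrier_mat n n \<Longrightarrow> B \<in> carrier_mat n n \<Longrightarrow> hermitian A \<Longrightarrow> hermitian B \<Longrightarrow>
    hermitian (A + B)"
  by (simp add: hermitian_def mat_adjoint_add[of _ n n])

lemma hermitian_minus: "A \<in> carrier_mat n n \<Longrightarrow> B \<in> carrier_mat n n \<Longrightarrow> hermitian A \<Longrightarrow> hermitian B \<Longrightarrow>
    hermitian (A - B)"
  by (simp add: hermitian_def mat_adjoint_minus[of _ n n])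

lemma hermitian_smult: "hermitian A \<Longrightarrow> hermitian (complex_of_real t \<cdot>\<^sub>m A)"
  by (simp add: hermitian_def mat_adjoint_smult_real)

lemma quad_form_mat_add:
  assumes "A \<in> carrier_mat n n" "B \<in> carrier_mat n n" "x \<in> carrier_vec n"
  shows "quad_form (A + B) x = quad_form A x + quad_form B x"
  using assms by (simp add: quad_form_re_inner add_mult_distrib_mat_vec[of A n n]
      re_inner_add_left[of _ n] mult_mat_vec_carrier[of _ n n])

lemma quad_form_mat_minus:
  assumes "A \<in> carrier_mat n n" "B \<in> carrier_mat n n" "x \<in> carrier_vec n"
  shows "quad_form (A - B) x = quad_form A x - quad_form B x"
  using assms by (simp add: quad_form_re_inner minus_mult_distrib_mat_vec[of A n n]
      re_inner_minus_left[of _ n] mult_mat_vec_carrier[of _ n n])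

lemma smult_mult_mat_vec:
  fixes A :: "complex mat"
  assumes "A \<in> carrier_mat n k" "x \<in> carrier_vec k"
  shows "a \<cdot>\<^sub>m A *\<^sub>v x = a \<cdot>\<^sub>v (A *\<^sub>v x)"
  using assms by (intro eq_vecI) auto

lemma quad_form_gram:
  fixes Y :: "complex mat"
  assumes Y: "Y \<in> carrier_mat n k" and x: "x \<in> carrier_vec n"
  shows "quad_form (complex_of_real t \<cdot>\<^sub>m (Y * Y\<^sup>H)) x = t * re_inner (Y\<^sup>H *\<^sub>v x) (Y\<^sup>H *\<^sub>v x)"
proof -
  have YH: "Y\<^sup>H \<in> carrier_mat k n" using Y by simp
  have Yx: "Y\<^sup>H *\<^sub>v x \<in> carrier_vec k" using YH x by (rule mult_mat_vec_carrier)
  have "complex_of_real t \<cdot>\<^sub>m (Y * Y\<^sup>H) *\<^sub>v x = complex_of_real t \<cdot>\<^sub>v (Y *\<^sub>v (Y\<^sup>H *\<^sub>v x))"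
    using smult_mult_mat_vec[OF mult_carrier_mat[OF Y YH] x] assoc_mult_mat_vec[OF Y YH x] by simp
  then show ?thesis
    using re_inner_adjoint[OF Y Yx x] mult_mat_vec_carrier[OF Y Yx] x
    by (simp add: quad_form_re_inner re_inner_smult_left[of _ n])
qed

lemma hermitian_gram: "Y \<in> carrier_mat n k \<Longrightarrow> hermitian (Y * Y\<^sup>H)"
  using mat_adjoint_mult[of Y n k "Y\<^sup>H" n] by (simp add: hermitian_def)

text \<open>A spectral substitute for compactness: in the parameter \<open>c\<close>, the negative
  form is at most \<open>- e\<close> times the squared norm of \<open>c\<close>, and the squared
  norm of \<open>g c\<close> at most \<open>t\<close> times it, so dividing the latter by a large
  number keeps the sum negative.\<close>

lemma neg_form_perturbation:
  assumes A: "A \<in> carrier_mat n n" "hermitian A" and f: "lin k n f" and g: "lin k l g"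
    and neg: "\<And>c. c \<in> carrier_vec k \<Longrightarrow> c \<noteq> 0\<^sub>v k \<Longrightarrow> quad_form A (f c) < 0"
  obtains t where "0 < t"
    "\<And>c. c \<in> carrier_vec k \<Longrightarrow> c \<noteq> 0\<^sub>v k \<Longrightarrow> quad_form A (f c) + re_inner (g c) (g c) / t < 0"
proof -
  obtain V where V: "V \<in> carrier_mat n k" "\<And>c. c \<in> carrier_vec k \<Longrightarrow> f c = V *\<^sub>v c"
    using f by (rule linE) blast
  obtain Y where Y: "Y \<in> carrier_mat l k" "\<And>c. c \<in> carrier_vec k \<Longrightarrow> g c = Y *\<^sub>v c"
    using g by (rule linE) blast
  define B where "B = - (V\<^sup>H * A * V)"
  have VAV: "V\<^sup>H * A * V \<in> carrier_mat k k"
    using mult_carrier_mat[OF mult_carrier_mat[OF _ A(1)] V(1)] V(1) by auto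
  have qB: "quad_form B c = - quad_form A (f c)" if "c \<in> carrier_vec k" for c
    using that V quad_form_congruence[OF A(1) V(1) that] quad_form_uminus[OF VAV that]
    by (simp add: B_def)
  have B: "B \<in> carrier_mat k k" using VAV by (simp add: B_def)
  have "pos_def B"
    using hermitian_uminus[OF hermitian_congruence[OF A V(1)]] neg qB B
    by (auto simp: pos_def_def B_def[symmetric])
  then obtain e where e: "0 < e" "\<And>c. c \<in> carrier_vec k \<Longrightarrow> e * re_inner c c \<le> quad_form B c"
    using pos_def_lower_bound[OF B] by metis
  have YH: "Y\<^sup>H \<in> carrier_mat k l" using Y by simp
  \<comment> \<open>Inserting the identity presents the squared norm of \<open>g c\<close> as the
    form of a Hermitian matrix, to which the spectral bound applies.\<close>
  have "1\<^sub>m l \<in> carrier_mat l l" "hermitian (1\<^sub>m l)" by (auto simp: hermitian_def)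
  then have "hermitian (Y\<^sup>H * 1\<^sub>m l * Y)" using hermitian_congruence Y(1) by blast
  moreover have "Y\<^sup>H * 1\<^sub>m l * Y \<in> carrier_mat k k" using Y(1) by auto
  ultimately obtain t where t: "0 < t"
    "\<And>c. c \<in> carrier_vec k \<Longrightarrow> quad_form (Y\<^sup>H * 1\<^sub>m l * Y) c \<le> t * re_inner c c"
    using quad_form_bounded by metis
  have gt: "re_inner (g c) (g c) \<le> t * re_inner c c" if c: "c \<in> carrier_vec k" for c
    using t(2)[OF c] quad_form_congruence[of "1\<^sub>m l" l Y k c] Y c mult_mat_vec_carrier[OF Y(1) c]
    by (simp add: quad_form_re_inner)
  show thesis
  \<comment> \<open>With this constant the added term is at most \<open>e / 2\<close> times the
    squared norm of \<open>c\<close>, half of the available margin.\<close>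
  proof (rule that[of "2 * t / e"])
    show "0 < 2 * t / e" using t e by simp
    fix c :: "complex vec" assume c: "c \<in> carrier_vec k" "c \<noteq> 0\<^sub>v k"
    have pos: "0 < re_inner c c" using c by (rule re_inner_self_pos)
    have "re_inner (g c) (g c) / (2 * t / e) \<le> t * re_inner c c / (2 * t / e)"
      using gt[OF c(1)] t e by (intro divide_right_mono) auto
    also have "\<dots> = e * re_inner c c / 2" using t e by (simp add: field_simps)
    also have "\<dots> < e * re_inner c c" using pos e by simp
    finally show "quad_form A (f c) + re_inner (g c) (g c) / (2 * t / e) < 0"
      using e(2)[OF c(1)] qB[OF c(1)] by simp
  qed
qed

text \<open>Subtracting \<open>P x x\<^sup>* P / (x\<^sup>* P x)\<close> splits off the positive direction \<open>x\<close>: the new form is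
  that of \<open>P\<close> on the \<open>P\<close>-orthogonal projection along \<open>x\<close>.\<close>

lemma rank_one_reduction:
  fixes P Q :: "complex mat"
  assumes P: "P \<in> carrier_mat n n" "hermitian P" and Q: "Q \<in> carrier_mat n n" "hermitian Q"
    and x: "x \<in> carrier_vec n" and pos: "0 < quad_form P x"
    and q: "\<And>u. u \<in> carrier_vec n \<Longrightarrow>
      quad_form Q u = quad_form P u - (cmod (u \<bullet>c (P *\<^sub>v x)))\<^sup>2 / quad_form P x"
  shows "i\<^sub>+ Q < i\<^sub>+ P" "i\<^sub>- Q \<le> i\<^sub>- P"
proof -
  define s where "s = quad_form P x"
  have s: "0 < s" using pos by (simp add: s_def)
  define b where "b u = (u \<bullet>c (P *\<^sub>v x)) / complex_of_real s" for u
  \<comment> \<open>\<open>E u = u - b u x\<close> is the projection along \<open>x\<close> onto the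
    \<open>P\<close>-orthogonal complement of \<open>x\<close>. The decomposition of
    \<open>u\<close> into \<open>E u\<close> and \<open>b u x\<close> is
    \<open>P\<close>-orthogonal, so the form of \<open>Q\<close> at \<open>u\<close> is that of
    \<open>P\<close> at \<open>E u\<close>.\<close>
  define E where "E = 1\<^sub>m n - mat n n (\<lambda>(i, j). x $ i * cnj ((P *\<^sub>v x) $ j) / complex_of_real s)"
  have E: "E \<in> carrier_mat n n" unfolding E_def by (rule minus_carrier_mat) simp
  have Px: "P *\<^sub>v x \<in> carrier_vec n" using P(1) x by (rule mult_mat_vec_carrier)
  have Eu: "E *\<^sub>v u = u - b u \<cdot>\<^sub>v x" if u: "u \<in> carrier_vec n" for u
  proof -
    have "mat n n (\<lambda>(i, j). x $ i * cnj ((P *\<^sub>v x) $ j) / complex_of_real s) *\<^sub>v u = b u \<cdot>\<^sub>v x"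
      using u x Px P(1)
      by (intro eq_vecI) (auto simp: b_def scalar_prod_def sum_distrib_left sum_divide_distrib
          simp del: index_mult_mat_vec intro!: sum.cong, auto simp: scalar_prod_def sum_distrib_left
          sum_divide_distrib mult_ac intro!: sum.cong)
    then show ?thesis
      using u unfolding E_def by (subst minus_mult_distrib_mat_vec[of _ n n]) auto
  qed
  have Eu_c: "E *\<^sub>v u \<in> carrier_vec n" if "u \<in> carrier_vec n" for u
    using E that by (rule mult_mat_vec_carrier)
  \<comment> \<open>\<open>quad_form\<close> records only the real part; Hermitian symmetry shows
    that nothing is lost.\<close>
  have xPx: "(P *\<^sub>v x) \<bullet>c x = complex_of_real s"
  proof -
    have "(P *\<^sub>v x) \<bullet>c x = x \<bullet>c (P *\<^sub>v x)"
      using cscalar_prod_adjoint[OF P(1) x x] P(2) by (simp add: hermitian_def)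
    also have "\<dots> = cnj ((P *\<^sub>v x) \<bullet>c x)"
      using conjugate_conjugate_sprod[of "P *\<^sub>v x" n x] conjugate_vec_sprod_comm[OF Px x] Px x
      by (metis conjugate_complex_def conjugate_sprod_vec carrier_vec_conjugate conjugate_id
          comm_scalar_prod)
    finally show ?thesis
      by (simp add: s_def quad_form_def complex_eq_iff)
  qed
  have PE: "(P *\<^sub>v (E *\<^sub>v u)) \<bullet>c x = 0" if u: "u \<in> carrier_vec n" for u
  proof -
    have Pu: "P *\<^sub>v u \<in> carrier_vec n" using P(1) u by (rule mult_mat_vec_carrier)
    have "(P *\<^sub>v (E *\<^sub>v u)) = P *\<^sub>v u - b u \<cdot>\<^sub>v (P *\<^sub>v x)"
      using Eu[OF u] P(1) u x mult_minus_distrib_mat_vec[OF P(1) u, of "b u \<cdot>\<^sub>v x"]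
        mult_mat_vec[OF P(1) x] by simp
    then have "(P *\<^sub>v (E *\<^sub>v u)) \<bullet>c x = (P *\<^sub>v u) \<bullet>c x - b u * ((P *\<^sub>v x) \<bullet>c x)"
      using Pu Px x by (simp add: minus_scalar_prod_distrib[of _ n])
    also have "(P *\<^sub>v u) \<bullet>c x = u \<bullet>c (P *\<^sub>v x)"
      using cscalar_prod_adjoint[OF P(1) u x] P(2) by (simp add: hermitian_def)
    finally show ?thesis using s by (simp add: xPx b_def)
  qed
  have PE_smult: "re_inner (P *\<^sub>v (E *\<^sub>v u)) (a \<cdot>\<^sub>v x) = 0" if u: "u \<in> carrier_vec n" for u a
    using PE[OF u] x mult_mat_vec_carrier[OF P(1) Eu_c[OF u]]
    by (simp add: re_inner_def conjugate_smult_vec)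
  have q_smult: "quad_form P (a \<cdot>\<^sub>v x) = (cmod a)\<^sup>2 * s" for a
  proof -
    have "(P *\<^sub>v (a \<cdot>\<^sub>v x)) \<bullet>c (a \<cdot>\<^sub>v x) = a * cnj a * ((P *\<^sub>v x) \<bullet>c x)"
      using x Px by (simp add: mult_mat_vec[OF P(1) x] conjugate_smult_vec)
    also have "\<dots> = complex_of_real ((cmod a)\<^sup>2 * s)"
      by (simp only: xPx complex_norm_square of_real_mult)
    finally show ?thesis by (simp only: quad_form_def Re_complex_of_real)
  qed
  have qE: "quad_form P (E *\<^sub>v u) = quad_form Q u" if u: "u \<in> carrier_vec n" for u
  proof -
    have bx: "b u \<cdot>\<^sub>v x \<in> carrier_vec n" using x by simp
    have "u = E *\<^sub>v u + b u \<cdot>\<^sub>v x" using Eu[OF u] u x by (intro eq_vecI) auto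
    then have "quad_form P u = quad_form P (E *\<^sub>v u + b u \<cdot>\<^sub>v x)" by simp
    also have "\<dots> = quad_form P (E *\<^sub>v u) + (cmod (b u))\<^sup>2 * s"
      using quad_form_add[OF P Eu_c[OF u] bx] PE_smult[OF u] q_smult by simp
    also have "(cmod (b u))\<^sup>2 * s = (cmod (u \<bullet>c (P *\<^sub>v x)))\<^sup>2 / s"
      using s by (simp add: b_def norm_divide power2_eq_square)
    finally show ?thesis using q[OF u] by (simp add: s_def)
  qed
  obtain f where f: "lin (i\<^sub>- Q) n f"
    "\<And>c. c \<in> carrier_vec (i\<^sub>- Q) \<Longrightarrow> c \<noteq> 0\<^sub>v (i\<^sub>- Q) \<Longrightarrow> quad_form Q (f c) < 0"
    using neg_domain[OF Q] by metis
  show "i\<^sub>- Q \<le> i\<^sub>- P"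
    by (rule neg_inertia_ge[OF P lin_mat[OF E f(1)]]) (use f qE lin_carrier[OF f(1)] in auto)
  obtain h where h: "lin (i\<^sub>+ Q) n h"
    "\<And>c. c \<in> carrier_vec (i\<^sub>+ Q) \<Longrightarrow> c \<noteq> 0\<^sub>v (i\<^sub>+ Q) \<Longrightarrow> 0 < quad_form Q (h c)"
    using pos_domain[OF Q] by metis
  \<comment> \<open>\<open>R\<close> embeds the multiples of \<open>x\<close>. Since
    \<open>x\<close> is positive for \<open>P\<close> and \<open>P\<close>-orthogonal to the range
    of \<open>E\<close>, it adds one dimension to the image under \<open>E\<close> of a positive
    subspace of \<open>Q\<close>.\<close>
  define R where "R = mat n 1 (\<lambda>(i, j). x $ i)"
  have R: "R \<in> carrier_mat n 1" by (simp add: R_def)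
  have Rc: "R *\<^sub>v c = c $ 0 \<cdot>\<^sub>v x" if "c \<in> carrier_vec 1" for c
    using that x by (intro eq_vecI) (auto simp: R_def scalar_prod_def)
  have "i\<^sub>+ Q + 1 \<le> i\<^sub>+ P"
  proof (rule pos_inertia_ge[OF P])
    show "lin (i\<^sub>+ Q + 1) n (\<lambda>c. E *\<^sub>v h (vec_first c (i\<^sub>+ Q)) + R *\<^sub>v vec_last c 1)"
      by (intro lin_add lin_mat[OF E] lin_mat[OF R] lin_compose[OF h(1)] lin_first lin_last)
    fix c :: "complex vec" assume c: "c \<in> carrier_vec (i\<^sub>+ Q + 1)" "c \<noteq> 0\<^sub>v (i\<^sub>+ Q + 1)"
    define u where "u = h (vec_first c (i\<^sub>+ Q))"
    define a where "a = vec_last c 1 $ 0"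
    have u: "u \<in> carrier_vec n" unfolding u_def using lin_carrier[OF h(1)] by simp
    have ax: "a \<cdot>\<^sub>v x \<in> carrier_vec n" using x by simp
    have eq: "quad_form P (E *\<^sub>v u + a \<cdot>\<^sub>v x) = quad_form Q u + (cmod a)\<^sup>2 * s"
      using quad_form_add[OF P Eu_c[OF u] ax] PE_smult[OF u] q_smult qE[OF u] by simp
    have Qu: "0 < quad_form Q u" if "vec_first c (i\<^sub>+ Q) \<noteq> 0\<^sub>v (i\<^sub>+ Q)"
      using h(2) that by (simp add: u_def)
    have "0 < quad_form Q u + (cmod a)\<^sup>2 * s"
    proof (cases "vec_first c (i\<^sub>+ Q) = 0\<^sub>v (i\<^sub>+ Q)")
      case True
      then have "vec_last c 1 \<noteq> 0\<^sub>v 1" using vec_split_cases[OF c] by blast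
      then have "a \<noteq> 0"
        unfolding a_def by (metis One_nat_def dim_vec_last eq_vecI index_zero_vec less_Suc0)
      moreover have "u = 0\<^sub>v n" using True lin_zero_arg[OF h(1)] by (simp add: u_def)
      ultimately show ?thesis using s quad_form_zero[OF Q(1)] by simp
    next
      case False
      then show ?thesis using Qu s by (simp add: add_pos_nonneg)
    qed
    then show "0 < quad_form P (E *\<^sub>v h (vec_first c (i\<^sub>+ Q)) + R *\<^sub>v vec_last c 1)"
      using eq Rc by (simp add: u_def a_def)
  qed
  then show "i\<^sub>+ Q < i\<^sub>+ P" by simp
qed

section \<open>The block matrices\<close>

text \<open>The bottom row of blocks in \<open>block33\<close> is a double transpose; as a
  four-block matrix with empty lower blocks it can be multiplied and adjoined blockwise.\<close>

lemma append_rows_transpose: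
  fixes G :: "complex mat"
  assumes "G \<in> carrier_mat l p" "H \<in> carrier_mat l q"
  shows "((G\<^sup>T) @\<^sub>r (H\<^sup>T))\<^sup>T = four_block_mat G H (0\<^sub>m 0 p) (0\<^sub>m 0 q)"
  using assms unfolding append_rows_def
  by (subst transpose_four_block_mat[of _ p l _ 0 _ q]) auto

lemma append_rows_transpose_mult_vec:
  fixes G :: "complex mat"
  assumes "G \<in> carrier_mat l p" "H \<in> carrier_mat l q" "x \<in> carrier_vec p" "y \<in> carrier_vec q"
  shows "((G\<^sup>T) @\<^sub>r (H\<^sup>T))\<^sup>T *\<^sub>v (x @\<^sub>v y) = G *\<^sub>v x + H *\<^sub>v y"
proof -
  have "((G\<^sup>T) @\<^sub>r (H\<^sup>T))\<^sup>T *\<^sub>v (x @\<^sub>v y) = (G *\<^sub>v x + H *\<^sub>v y) @\<^sub>v (0\<^sub>m 0 p *\<^sub>v x + 0\<^sub>m 0 q *\<^sub>v y)"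
    unfolding append_rows_transpose[OF assms(1,2)]
    by (rule four_block_mat_mult_vec[of _ l p _ q _ 0]) (use assms in auto)
  also have "\<dots> = G *\<^sub>v x + H *\<^sub>v y" by (rule eq_vecI) (use assms in auto)
  finally show ?thesis .
qed

locale block_data =
  fixes A1 B1 A4 B4 :: "complex mat" and m1 n m :: nat
  assumes A1 [simp]: "A1 \<in> carrier_mat m1 m1" and A1_herm: "hermitian A1"
    and B1 [simp]: "B1 \<in> carrier_mat m1 n"
    and A4 [simp]: "A4 \<in> carrier_mat m n"
    and B4 [simp]: "B4 \<in> carrier_mat m n"
begin

definition "P X = A1 - B1 * X * B1\<^sup>H"
definition "M1 = four_block_mat A1 B1 (A4 * B1\<^sup>H) B4"
definition "M2 = four_block_mat A1 (B1 * A4\<^sup>H) (A4 * B1\<^sup>H) (A4 * B4\<^sup>H)"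
definition "N = block33 A1 B1 (0\<^sub>m m1 m) (B1\<^sup>H) (0\<^sub>m n n) (B4\<^sup>H) (0\<^sub>m m m1) B4 (- (A4 * B4\<^sup>H))"

lemma adj_carrier [simp]:
  "B1\<^sup>H \<in> carrier_mat n m1" "B4\<^sup>H \<in> carrier_mat n m" "A4\<^sup>H \<in> carrier_mat n m"
  by simp_all

lemma dims [simp]: "dim_row A1 = m1" "dim_col A1 = m1" "dim_row B1 = m1" "dim_col B1 = n"
  "dim_row A4 = m" "dim_col A4 = n" "dim_row B4 = m" "dim_col B4 = n"
  using A1 B1 A4 B4 by (auto simp del: A1 B1 A4 B4)

lemma vec_carrier [simp]:
  "x \<in> carrier_vec m1 \<Longrightarrow> A1 *\<^sub>v x \<in> carrier_vec m1"
  "y \<in> carrier_vec n \<Longrightarrow> B1 *\<^sub>v y \<in> carrier_vec m1"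
  "y \<in> carrier_vec n \<Longrightarrow> B4 *\<^sub>v y \<in> carrier_vec m"
  "y \<in> carrier_vec n \<Longrightarrow> A4 *\<^sub>v y \<in> carrier_vec m"
  "x \<in> carrier_vec m1 \<Longrightarrow> B1\<^sup>H *\<^sub>v x \<in> carrier_vec n"
  "w \<in> carrier_vec m \<Longrightarrow> B4\<^sup>H *\<^sub>v w \<in> carrier_vec n"
  "w \<in> carrier_vec m \<Longrightarrow> A4\<^sup>H *\<^sub>v w \<in> carrier_vec n"
  by (rule mult_mat_vec_carrier; simp)+

lemma product_vec:
  "x \<in> carrier_vec m1 \<Longrightarrow> A4 * B1\<^sup>H *\<^sub>v x = A4 *\<^sub>v (B1\<^sup>H *\<^sub>v x)"
  "w \<in> carrier_vec m \<Longrightarrow> A4 * B4\<^sup>H *\<^sub>v w = A4 *\<^sub>v (B4\<^sup>H *\<^sub>v w)"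
  "w \<in> carrier_vec m \<Longrightarrow> B1 * A4\<^sup>H *\<^sub>v w = B1 *\<^sub>v (A4\<^sup>H *\<^sub>v w)"
  by (rule assoc_mult_mat_vec[OF A4 adj_carrier(1)] assoc_mult_mat_vec[OF A4 adj_carrier(2)]
      assoc_mult_mat_vec[OF B1 adj_carrier(3)]; assumption)+

lemma B1_adj: "y \<in> carrier_vec n \<Longrightarrow> x \<in> carrier_vec m1 \<Longrightarrow>
    re_inner (B1 *\<^sub>v y) x = re_inner y (B1\<^sup>H *\<^sub>v x)"
  by (rule re_inner_adjoint) simp_all

lemma B4_adj: "y \<in> carrier_vec n \<Longrightarrow> w \<in> carrier_vec m \<Longrightarrow>
    re_inner (B4 *\<^sub>v y) w = re_inner y (B4\<^sup>H *\<^sub>v w)"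
  by (rule re_inner_adjoint) simp_all

lemma M1_carrier: "M1 \<in> carrier_mat (m1 + m) (m1 + n)"
  unfolding M1_def by (rule four_block_carrier_mat) simp_all

lemma M2_carrier: "M2 \<in> carrier_mat (m1 + m) (m1 + m)"
  unfolding M2_def by (rule four_block_carrier_mat) (auto intro!: mult_carrier_mat[of _ m n])

lemma N_carrier: "N \<in> carrier_mat (m1 + n + m) (m1 + n + m)"
  unfolding N_def block33_def
  by (intro four_block_carrier_mat) (auto intro!: mult_carrier_mat[of _ m n])

lemma P_carrier: "X \<in> carrier_mat n n \<Longrightarrow> P X \<in> carrier_mat m1 m1"
  unfolding P_def by (intro minus_carrier_mat mult_carrier_mat[of _ m1 n] mult_carrier_mat[of _ n n]) auto

lemma P_hermitian:
  assumes X: "X \<in> carrier_mat n n" "hermitian X"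
  shows "hermitian (P X)"
proof -
  have "hermitian (B1 * X * B1\<^sup>H)" using hermitian_congruence[OF X, of "B1\<^sup>H" m1] by simp
  moreover have "B1 * X * B1\<^sup>H \<in> carrier_mat m1 m1"
    by (rule mult_carrier_mat[of _ m1 n]) (use X in \<open>auto intro: mult_carrier_mat[of _ m1 n]\<close>)
  ultimately show ?thesis unfolding P_def using A1_herm by (intro hermitian_minus) auto
qed

lemma P_mult_vec:
  assumes X: "X \<in> carrier_mat n n" and x: "x \<in> carrier_vec m1"
  shows "P X *\<^sub>v x = A1 *\<^sub>v x - B1 *\<^sub>v (X *\<^sub>v (B1\<^sup>H *\<^sub>v x))"
proof -
  have BX: "B1 * X \<in> carrier_mat m1 n" using X by (intro mult_carrier_mat[of _ m1 n]) auto
  have "P X *\<^sub>v x = A1 *\<^sub>v x - B1 * X * B1\<^sup>H *\<^sub>v x"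
    unfolding P_def using BX x
    by (intro minus_mult_distrib_mat_vec[of _ m1 m1]) (auto intro: mult_carrier_mat[of _ m1 n])
  also have "B1 * X * B1\<^sup>H *\<^sub>v x = B1 *\<^sub>v (X *\<^sub>v (B1\<^sup>H *\<^sub>v x))"
    using assoc_mult_mat_vec[OF BX, of "B1\<^sup>H" m1 x] assoc_mult_mat_vec[OF B1 X, of "B1\<^sup>H *\<^sub>v x"] x by simp
  finally show ?thesis .
qed

lemma quad_form_P:
  assumes X: "X \<in> carrier_mat n n" and x: "x \<in> carrier_vec m1"
  shows "quad_form (P X) x = quad_form A1 x - quad_form X (B1\<^sup>H *\<^sub>v x)"
  using x mult_mat_vec_carrier[OF X, of "B1\<^sup>H *\<^sub>v x"]
  by (simp add: quad_form_re_inner P_mult_vec[OF X x] re_inner_minus_left[of _ m1] B1_adj)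

lemma M2_mult_vec:
  assumes x: "x \<in> carrier_vec m1" and w: "w \<in> carrier_vec m"
  shows "M2 *\<^sub>v (x @\<^sub>v w) = (A1 *\<^sub>v x + B1 *\<^sub>v (A4\<^sup>H *\<^sub>v w)) @\<^sub>v
    (A4 *\<^sub>v (B1\<^sup>H *\<^sub>v x) + A4 *\<^sub>v (B4\<^sup>H *\<^sub>v w))"
  unfolding M2_def using x w
  by (subst four_block_mat_mult_vec[of _ m1 m1 _ m _ m])
    (auto intro!: mult_carrier_mat[of _ m n] mult_carrier_mat[of _ m1 n]
      simp: product_vec)

lemma M1_mult_vec:
  assumes x: "x \<in> carrier_vec m1" and y: "y \<in> carrier_vec n"
  shows "M1 *\<^sub>v (x @\<^sub>v y) = (A1 *\<^sub>v x + B1 *\<^sub>v y) @\<^sub>v (A4 *\<^sub>v (B1\<^sup>H *\<^sub>v x) + B4 *\<^sub>v y)"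
  unfolding M1_def using x y
  by (subst four_block_mat_mult_vec[of _ m1 m1 _ n _ m])
    (auto intro!: mult_carrier_mat[of _ m n] simp: product_vec)

lemma M1_adjoint_mult_vec:
  assumes x: "x \<in> carrier_vec m1" and w: "w \<in> carrier_vec m"
  shows "M1\<^sup>H *\<^sub>v (x @\<^sub>v w) = (A1 *\<^sub>v x + B1 *\<^sub>v (A4\<^sup>H *\<^sub>v w)) @\<^sub>v (B1\<^sup>H *\<^sub>v x + B4\<^sup>H *\<^sub>v w)"
proof -
  have "M1\<^sup>H = four_block_mat A1 (B1 * A4\<^sup>H) (B1\<^sup>H) (B4\<^sup>H)"
    unfolding M1_def using A1_herm mat_adjoint_mult[of A4 m n "B1\<^sup>H" m1]
    by (subst mat_adjoint_four_block[of _ m1 m1 _ n _ m])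
      (auto simp: hermitian_def intro!: mult_carrier_mat[of _ m n])
  then show ?thesis
    using x w by (simp, subst four_block_mat_mult_vec[of _ m1 m1 _ m _ n])
      (auto intro!: mult_carrier_mat[of _ m1 n] simp: product_vec)
qed

lemma N_mult_vec:
  assumes x: "x \<in> carrier_vec m1" and y: "y \<in> carrier_vec n" and w: "w \<in> carrier_vec m"
  shows "N *\<^sub>v ((x @\<^sub>v y) @\<^sub>v w) =
    ((A1 *\<^sub>v x + B1 *\<^sub>v y) @\<^sub>v (B1\<^sup>H *\<^sub>v x + B4\<^sup>H *\<^sub>v w)) @\<^sub>v (B4 *\<^sub>v y - A4 *\<^sub>v (B4\<^sup>H *\<^sub>v w))"
proof -
  have AB: "A4 * B4\<^sup>H \<in> carrier_mat m m" by (rule mult_carrier_mat[of _ m n]) simp_all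
  define R where "R = (((0\<^sub>m m m1)\<^sup>T) @\<^sub>r (B4\<^sup>T))\<^sup>T"
  have R: "R \<in> carrier_mat m (m1 + n)" by (simp add: R_def)
  have "N *\<^sub>v ((x @\<^sub>v y) @\<^sub>v w) =
    (four_block_mat A1 B1 (B1\<^sup>H) (0\<^sub>m n n) *\<^sub>v (x @\<^sub>v y) + (0\<^sub>m m1 m @\<^sub>r B4\<^sup>H) *\<^sub>v w) @\<^sub>v
    (R *\<^sub>v (x @\<^sub>v y) + - (A4 * B4\<^sup>H) *\<^sub>v w)"
    unfolding N_def block33_def R_def[symmetric]
    by (rule four_block_mat_mult_vec[of _ "m1 + n" "m1 + n" _ m _ m]) (use x y w R AB in auto)
  also have "four_block_mat A1 B1 (B1\<^sup>H) (0\<^sub>m n n) *\<^sub>v (x @\<^sub>v y) = (A1 *\<^sub>v x + B1 *\<^sub>v y) @\<^sub>v (B1\<^sup>H *\<^sub>v x)"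
    using x y by (subst four_block_mat_mult_vec[of _ m1 m1 _ n _ n]) auto
  also have "(0\<^sub>m m1 m @\<^sub>r B4\<^sup>H) *\<^sub>v w = 0\<^sub>v m1 @\<^sub>v (B4\<^sup>H *\<^sub>v w)"
    using w by (subst mat_mult_append[of _ m1 m _ n]) auto
  also have "((A1 *\<^sub>v x + B1 *\<^sub>v y) @\<^sub>v (B1\<^sup>H *\<^sub>v x)) + (0\<^sub>v m1 @\<^sub>v (B4\<^sup>H *\<^sub>v w)) =
      (A1 *\<^sub>v x + B1 *\<^sub>v y) @\<^sub>v (B1\<^sup>H *\<^sub>v x + B4\<^sup>H *\<^sub>v w)"
    using x y w by (subst append_vec_add[of _ m1 _ _ n]) auto
  also have "R *\<^sub>v (x @\<^sub>v y) = B4 *\<^sub>v y"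
    unfolding R_def using x y by (subst append_rows_transpose_mult_vec[of _ m m1 _ n]) auto
  also have "B4 *\<^sub>v y + - (A4 * B4\<^sup>H) *\<^sub>v w = B4 *\<^sub>v y - A4 *\<^sub>v (B4\<^sup>H *\<^sub>v w)"
  proof -
    have "A4 * B4\<^sup>H *\<^sub>v w = A4 *\<^sub>v (B4\<^sup>H *\<^sub>v w)" using assoc_mult_mat_vec[OF A4, of "B4\<^sup>H" m w] w by simp
    then show ?thesis
      using w y AB by (simp add: uminus_mult_mat_vec minus_add_uminus_vec[of _ m])
  qed
  finally show ?thesis .
qed

lemma quad_form_N:
  assumes x: "x \<in> carrier_vec m1" and y: "y \<in> carrier_vec n" and w: "w \<in> carrier_vec m"
  shows "quad_form N ((x @\<^sub>v y) @\<^sub>v w) = quad_form A1 x + 2 * re_inner y (B1\<^sup>H *\<^sub>v x) +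
    2 * re_inner y (B4\<^sup>H *\<^sub>v w) - re_inner (A4 *\<^sub>v (B4\<^sup>H *\<^sub>v w)) w"
  using x y w
  by (simp add: quad_form_re_inner N_mult_vec re_inner_append[of _ "m1 + n" _ m]
      re_inner_append[of _ m1 _ n] re_inner_add_left[of _ m1] re_inner_add_left[of _ n]
      re_inner_minus_left[of _ m] B1_adj B4_adj re_inner_commute[of "B1\<^sup>H *\<^sub>v x" n y]
      re_inner_commute[of "B4\<^sup>H *\<^sub>v w" n y])

end

text \<open>A Hermitian solution of \<open>B4 * X = A4\<close> eliminates \<open>A4\<close> from all block matrices.\<close>

locale solution = block_data +
  fixes X :: "complex mat"
  assumes X [simp]: "X \<in> carrier_mat n n" and X_herm: "hermitian X" and sol: "B4 * X = A4"
begin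

lemma X_vec [simp]: "y \<in> carrier_vec n \<Longrightarrow> X *\<^sub>v y \<in> carrier_vec n"
  by (rule mult_mat_vec_carrier[OF X])

lemma A4_adj: "A4\<^sup>H = X * B4\<^sup>H"
  using mat_adjoint_mult[OF B4 X] X_herm sol by (simp add: hermitian_def)

lemma A4_vec: "y \<in> carrier_vec n \<Longrightarrow> A4 *\<^sub>v y = B4 *\<^sub>v (X *\<^sub>v y)"
  using assoc_mult_mat_vec[OF B4 X] sol by simp

lemma A4_adj_vec: "w \<in> carrier_vec m \<Longrightarrow> A4\<^sup>H *\<^sub>v w = X *\<^sub>v (B4\<^sup>H *\<^sub>v w)"
  unfolding A4_adj by (rule assoc_mult_mat_vec[of _ n n _ m]) simp_all

lemma gram_eq: "A4 * B4\<^sup>H = B4 * X * B4\<^sup>H"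
  by (simp add: sol)

lemma gram_hermitian: "hermitian (A4 * B4\<^sup>H)"
  unfolding gram_eq using hermitian_congruence[OF X X_herm, of "B4\<^sup>H" m] by simp

lemma quad_form_gram_eq: "w \<in> carrier_vec m \<Longrightarrow> quad_form (A4 * B4\<^sup>H) w = quad_form X (B4\<^sup>H *\<^sub>v w)"
  unfolding gram_eq using quad_form_congruence[OF X, of "B4\<^sup>H" m w] by simp

lemma P_carr [simp]: "P X \<in> carrier_mat m1 m1"
  by (rule P_carrier) simp

lemma P_herm [simp]: "hermitian (P X)"
  by (rule P_hermitian) (simp_all add: X_herm)

lemma P_vec [simp]: "x \<in> carrier_vec m1 \<Longrightarrow> P X *\<^sub>v x \<in> carrier_vec m1"
  by (rule mult_mat_vec_carrier[OF P_carr])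

lemma M2_hermitian: "hermitian M2"
  unfolding hermitian_def M2_def
  using A1_herm gram_hermitian mat_adjoint_mult[of A4 m n "B1\<^sup>H" m1]
    mat_adjoint_mult[of B1 m1 n "A4\<^sup>H" m]
  by (subst mat_adjoint_four_block[of _ m1 m1 _ m _ m])
    (auto simp: hermitian_def intro!: mult_carrier_mat[of _ m n] mult_carrier_mat[of _ m1 n])

lemma N_hermitian: "hermitian N"
proof -
  have AB: "A4 * B4\<^sup>H \<in> carrier_mat m m" by (rule mult_carrier_mat[of _ m n]) simp_all
  have R: "((0\<^sub>m m m1)\<^sup>T @\<^sub>r B4\<^sup>T)\<^sup>T = four_block_mat (0\<^sub>m m m1) B4 (0\<^sub>m 0 m1) (0\<^sub>m 0 n)"
    by (rule append_rows_transpose[of _ m m1 _ n]) simp_all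
  have C: "0\<^sub>m m1 m @\<^sub>r B4\<^sup>H = four_block_mat (0\<^sub>m m1 m) (0\<^sub>m m1 0) (B4\<^sup>H) (0\<^sub>m n 0)"
    by (simp add: append_rows_def)
  have RH: "(((0\<^sub>m m m1)\<^sup>T @\<^sub>r B4\<^sup>T)\<^sup>T)\<^sup>H = 0\<^sub>m m1 m @\<^sub>r B4\<^sup>H"
    unfolding R C by (subst mat_adjoint_four_block[of _ m m1 _ n _ 0]) auto
  then have CH: "(0\<^sub>m m1 m @\<^sub>r B4\<^sup>H)\<^sup>H = ((0\<^sub>m m m1)\<^sup>T @\<^sub>r B4\<^sup>T)\<^sup>T"
    by (metis mat_adjoint_adjoint)
  have I: "(four_block_mat A1 B1 (B1\<^sup>H) (0\<^sub>m n n))\<^sup>H = four_block_mat A1 B1 (B1\<^sup>H) (0\<^sub>m n n)"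
    using A1_herm by (subst mat_adjoint_four_block[of _ m1 m1 _ n _ n]) (auto simp: hermitian_def)
  show ?thesis
    unfolding hermitian_def N_def block33_def
    using gram_hermitian AB
    by (subst mat_adjoint_four_block[of _ "m1 + n" "m1 + n" _ m _ m])
      (auto simp: hermitian_def mat_adjoint_uminus RH[simplified] CH[simplified] I)
qed

lemma re_inner_X_sym: "y \<in> carrier_vec n \<Longrightarrow> z \<in> carrier_vec n \<Longrightarrow>
    re_inner (X *\<^sub>v y) z = re_inner (X *\<^sub>v z) y"
  by (rule hermitian_re_inner) (simp_all add: X_herm)

text \<open>Since \<open>A4 = B4 X\<close>, \<open>M2\<close> is the sum of the block diagonal
  matrix of \<open>P X\<close> and 0 and of \<open>V X V\<^sup>H\<close>, with \<open>V\<close>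
  formed by \<open>B1\<close> above \<open>B4\<close>.\<close>

lemma quad_form_M2:
  assumes x: "x \<in> carrier_vec m1" and w: "w \<in> carrier_vec m"
  shows "quad_form M2 (x @\<^sub>v w) = quad_form (P X) x + quad_form X (B1\<^sup>H *\<^sub>v x + B4\<^sup>H *\<^sub>v w)"
proof -
  have "quad_form (P X) x + quad_form X (B1\<^sup>H *\<^sub>v x + B4\<^sup>H *\<^sub>v w) = quad_form A1 x
      + quad_form X (B4\<^sup>H *\<^sub>v w) + 2 * re_inner (X *\<^sub>v (B1\<^sup>H *\<^sub>v x)) (B4\<^sup>H *\<^sub>v w)"
    using x w by (simp add: quad_form_P quad_form_add[OF X X_herm])
  also have "\<dots> = quad_form M2 (x @\<^sub>v w)"
    using x w re_inner_X_sym[of "B1\<^sup>H *\<^sub>v x" "B4\<^sup>H *\<^sub>v w"]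
    by (simp add: quad_form_re_inner M2_mult_vec re_inner_append[of _ m1 _ m]
        re_inner_add_left[of _ m1] re_inner_add_left[of _ m] A4_vec A4_adj_vec B1_adj B4_adj)
  finally show ?thesis by simp
qed

text \<open>Once \<open>u = B1\<^sup>H x + B4\<^sup>H w\<close> is zero,
  \<open>A4\<^sup>H w = X B4\<^sup>H w = - X B1\<^sup>H x\<close> turns the first component into
  \<open>P X x\<close>. The adjoint of \<open>M1\<close> is taken because its kernel involves the
  same \<open>u\<close> as the forms of \<open>M2\<close> and \<open>N\<close>, and it has the rank
  of \<open>M1\<close>.\<close>

lemma M1_adjoint_kernel:
  assumes x: "x \<in> carrier_vec m1" and w: "w \<in> carrier_vec m"
  shows "M1\<^sup>H *\<^sub>v (x @\<^sub>v w) = 0\<^sub>v (m1 + n) \<longleftrightarrow>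
    P X *\<^sub>v x = 0\<^sub>v m1 \<and> B1\<^sup>H *\<^sub>v x + B4\<^sup>H *\<^sub>v w = 0\<^sub>v n"
proof -
  have "A1 *\<^sub>v x + B1 *\<^sub>v (A4\<^sup>H *\<^sub>v w) = P X *\<^sub>v x" if 0: "B1\<^sup>H *\<^sub>v x + B4\<^sup>H *\<^sub>v w = 0\<^sub>v n"
  proof -
    have "P X *\<^sub>v x + B1 *\<^sub>v (X *\<^sub>v (B1\<^sup>H *\<^sub>v x + B4\<^sup>H *\<^sub>v w)) = A1 *\<^sub>v x + B1 *\<^sub>v (A4\<^sup>H *\<^sub>v w)"
      using x w
      by (simp add: P_mult_vec A4_adj_vec mult_add_distrib_mat_vec[of _ n n]
          mult_add_distrib_mat_vec[of _ m1 n]) (intro eq_vecI, auto)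
    then show ?thesis
      using 0 x w mult_mat_vec_zero[OF X] mult_mat_vec_zero[OF B1] by simp
  qed
  then show ?thesis
    using x w by (auto simp: M1_adjoint_mult_vec append_vec_eq_0[of _ m1 _ n])
qed

text \<open>With \<open>u = B1\<^sup>H x\<close> and \<open>b = B4\<^sup>H w\<close>, replacing
  \<open>y\<close> by \<open>y - z\<close> adds \<open>- 2 re_inner z (u + b)\<close> to the form of
  \<open>N\<close>. This should supply the missing \<open>- re_inner (X u) u\<close> of
  \<open>P X\<close> and cancel \<open>- re_inner (X b) b\<close>; so
  \<open>2 re_inner z (u + b)\<close> has to be \<open>re_inner (X u) u - re_inner (X b) b\<close>,
  which \<open>z = X (u - b) / 2\<close> achieves because \<open>X\<close> is Hermitian.\<close>

definition shift :: "complex vec \<Rightarrow> complex vec \<Rightarrow> complex vec \<Rightarrow> complex vec" where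
  "shift x y w = (x @\<^sub>v (y - complex_of_real (1/2) \<cdot>\<^sub>v (X *\<^sub>v (B1\<^sup>H *\<^sub>v x - B4\<^sup>H *\<^sub>v w)))) @\<^sub>v w"

lemma lin_shift:
  assumes "lin k m1 f" "lin k n g" "lin k m h"
  shows "lin k (m1 + n + m) (\<lambda>c. shift (f c) (g c) (h c))"
  unfolding shift_def
  by (intro lin_append lin_minus lin_smult assms lin_mat[OF X] lin_mat[of "B1\<^sup>H" n m1]
      lin_mat[of "B4\<^sup>H" n m]) simp_all

text \<open>The substitution \<open>shift\<close> is a congruence that decouples \<open>X\<close> from the border of \<open>N\<close>.\<close>

lemma quad_form_N_shift:
  assumes x: "x \<in> carrier_vec m1" and y: "y \<in> carrier_vec n" and w: "w \<in> carrier_vec m"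
  shows "quad_form N (shift x y w) = quad_form (P X) x + 2 * re_inner y (B1\<^sup>H *\<^sub>v x + B4\<^sup>H *\<^sub>v w)"
proof -
  define u where "u = B1\<^sup>H *\<^sub>v x"
  define b where "b = B4\<^sup>H *\<^sub>v w"
  have u: "u \<in> carrier_vec n" and b: "b \<in> carrier_vec n" using x w by (simp_all add: u_def b_def)
  define z where "z = complex_of_real (1/2) \<cdot>\<^sub>v (X *\<^sub>v (u - b))"
  have z: "z \<in> carrier_vec n" using u b by (simp add: z_def)
  have zv: "2 * re_inner z v = re_inner (X *\<^sub>v u) v - re_inner (X *\<^sub>v b) v" if "v \<in> carrier_vec n" for v
    using that u b
    by (simp only: z_def, subst re_inner_smult_left[of _ n])
      (auto simp: mult_minus_distrib_mat_vec[of _ n n] re_inner_minus_left[of _ n])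
  have "shift x y w = (x @\<^sub>v (y - z)) @\<^sub>v w" by (simp add: shift_def u_def b_def z_def)
  then have "quad_form N (shift x y w) = quad_form A1 x + 2 * re_inner (y - z) u + 2 * re_inner (y - z) b
      - re_inner (X *\<^sub>v b) b"
    using x y z w quad_form_N[of x "y - z" w] by (simp add: u_def b_def A4_vec B4_adj)
  also have "\<dots> = quad_form (P X) x + 2 * re_inner y (u + b)"
    using x y z u b zv[OF u] zv[OF b] re_inner_X_sym[OF u b]
    by (simp add: re_inner_minus_left[of _ n] re_inner_add_right[of _ n] quad_form_P
        flip: u_def) (simp add: quad_form_re_inner algebra_simps)
  finally show ?thesis by (simp add: u_def b_def)
qed

text \<open>A column operation: subtracting the second block column times
  \<open>X B1\<^sup>H\<close> from the first makes \<open>M1\<close> block triangular, with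
  \<open>P X\<close> and \<open>B4\<close> on the diagonal.\<close>

lemma M1_shifted_mult_vec:
  assumes x: "x \<in> carrier_vec m1" and y: "y \<in> carrier_vec n"
  shows "M1 *\<^sub>v (x @\<^sub>v (y - X *\<^sub>v (B1\<^sup>H *\<^sub>v x))) = (P X *\<^sub>v x + B1 *\<^sub>v y) @\<^sub>v (B4 *\<^sub>v y)"
proof -
  have "A1 *\<^sub>v x + B1 *\<^sub>v (y - X *\<^sub>v (B1\<^sup>H *\<^sub>v x)) = P X *\<^sub>v x + B1 *\<^sub>v y"
    using x y by (simp add: P_mult_vec mult_minus_distrib_mat_vec[of _ m1 n]) (intro eq_vecI, auto)
  moreover have "A4 *\<^sub>v (B1\<^sup>H *\<^sub>v x) + B4 *\<^sub>v (y - X *\<^sub>v (B1\<^sup>H *\<^sub>v x)) = B4 *\<^sub>v y"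
    using x y by (simp add: A4_vec mult_minus_distrib_mat_vec[of _ m n]) (intro eq_vecI, auto)
  ultimately show ?thesis using x y by (simp add: M1_mult_vec)
qed

end

section \<open>Bounds valid for every solution\<close>

context solution begin

text \<open>Let \<open>x\<close> and \<open>w\<close> run over domains on which \<open>P X\<close>
  and \<open>B4\<^sup>H\<close> are injective. A pair in the kernel of \<open>M1\<^sup>H\<close> has
  \<open>P X x = 0\<close>, so \<open>x = 0\<close>, and then \<open>B4\<^sup>H w = 0\<close> gives
  \<open>w = 0\<close>.\<close>

lemma rank_P_upper: "mat_rank (P X) + mat_rank B4 \<le> mat_rank M1"
proof -
  obtain f where f: "lin (mat_rank (P X)) m1 f"
    "\<And>c. c \<in> carrier_vec (mat_rank (P X)) \<Longrightarrow> P X *\<^sub>v f c = 0\<^sub>v m1 \<Longrightarrow> c = 0\<^sub>v (mat_rank (P X))"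
    using rank_domain[OF P_carr] by metis
  obtain h where h: "lin (mat_rank B4) m h"
    "\<And>c. c \<in> carrier_vec (mat_rank B4) \<Longrightarrow> B4\<^sup>H *\<^sub>v h c = 0\<^sub>v n \<Longrightarrow> c = 0\<^sub>v (mat_rank B4)"
    using rank_domain[OF adj_carrier(2)] rank_adjoint[OF B4] by metis
  let ?r = "mat_rank (P X)" and ?q = "mat_rank B4"
  have "?r + ?q \<le> mat_rank (M1\<^sup>H)"
  proof (rule rank_ge[of _ "m1 + n" "m1 + m"])
    show "lin (?r + ?q) (m1 + m) (\<lambda>c. f (vec_first c ?r) @\<^sub>v h (vec_last c ?q))"
      by (intro lin_append lin_compose[OF f(1)] lin_compose[OF h(1)] lin_first lin_last)
    fix c :: "complex vec" assume c: "c \<in> carrier_vec (?r + ?q)"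
      and 0: "M1\<^sup>H *\<^sub>v (f (vec_first c ?r) @\<^sub>v h (vec_last c ?q)) = 0\<^sub>v (m1 + n)"
    have x: "f (vec_first c ?r) \<in> carrier_vec m1" and w: "h (vec_last c ?q) \<in> carrier_vec m"
      using lin_carrier[OF f(1)] lin_carrier[OF h(1)] by simp_all
    from 0 have k: "P X *\<^sub>v f (vec_first c ?r) = 0\<^sub>v m1"
      "B1\<^sup>H *\<^sub>v f (vec_first c ?r) + B4\<^sup>H *\<^sub>v h (vec_last c ?q) = 0\<^sub>v n"
      using M1_adjoint_kernel[OF x w] by auto
    have a: "vec_first c ?r = 0\<^sub>v ?r" using f(2) k(1) by simp
    then have "f (vec_first c ?r) = 0\<^sub>v m1" using lin_zero_arg[OF f(1)] by simp
    then have "B4\<^sup>H *\<^sub>v h (vec_last c ?q) = 0\<^sub>v n"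
      using k(2) w mult_mat_vec_zero[OF adj_carrier(1)] by simp
    then have "vec_last c ?q = 0\<^sub>v ?q" using h(2) by simp
    with a show "c = 0\<^sub>v (?r + ?q)" using vec_split_cases[OF c] by blast
  qed (use M1_carrier in simp)
  then show ?thesis using rank_adjoint[OF M1_carrier] by simp
qed

text \<open>At \<open>y = - u\<close> the shifted form of \<open>N\<close> is that of
  \<open>P X\<close> at \<open>x\<close> minus twice the squared norm of \<open>u\<close>. The
  conditions from \<open>P X\<close> make the former nonpositive, those from \<open>N\<close> make
  the total nonnegative; so both parts vanish and the pair of \<open>x\<close> and \<open>w\<close>
  lies in the kernel of \<open>M1\<^sup>H\<close>.\<close>

lemma rank_M1_le: "mat_rank M1 \<le> i\<^sub>+ (P X) + i\<^sub>- N"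
proof -
  obtain g where g: "lin m1 (i\<^sub>+ (P X)) g"
    "\<And>x. x \<in> carrier_vec m1 \<Longrightarrow> g x = 0\<^sub>v (i\<^sub>+ (P X)) \<Longrightarrow> quad_form (P X) x \<le> 0"
    "\<And>x. x \<in> carrier_vec m1 \<Longrightarrow> g x = 0\<^sub>v (i\<^sub>+ (P X)) \<Longrightarrow> quad_form (P X) x = 0 \<Longrightarrow> P X *\<^sub>v x = 0\<^sub>v m1"
    using pos_functionals[OF P_carr P_herm] by metis
  obtain h where h: "lin (m1 + n + m) (i\<^sub>- N) h"
    "\<And>z. z \<in> carrier_vec (m1 + n + m) \<Longrightarrow> h z = 0\<^sub>v (i\<^sub>- N) \<Longrightarrow> 0 \<le> quad_form N z"
    using neg_functionals[OF N_carrier N_hermitian] by metis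
  define u where "u z = B1\<^sup>H *\<^sub>v vec_first z m1 + B4\<^sup>H *\<^sub>v vec_last z m" for z
  have lu: "lin (m1 + m) n u"
    unfolding u_def by (intro lin_add lin_mat[of _ n m1] lin_mat[of _ n m] lin_first lin_last) simp_all
  have lf: "lin (m1 + m) (m1 + n + m) (\<lambda>z. shift (vec_first z m1) (- u z) (vec_last z m))"
    by (intro lin_shift lin_first lin_last lin_uminus lu)
  have "mat_rank (M1\<^sup>H) \<le> i\<^sub>+ (P X) + i\<^sub>- N"
  proof (rule rank_le[of _ "m1 + n" "m1 + m"])
    show "lin (m1 + m) (i\<^sub>+ (P X) + i\<^sub>- N)
      (\<lambda>z. g (vec_first z m1) @\<^sub>v h (shift (vec_first z m1) (- u z) (vec_last z m)))"
      by (intro lin_append lin_compose[OF g(1)] lin_compose[OF h(1)] lf lin_first)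
    fix z :: "complex vec" assume z: "z \<in> carrier_vec (m1 + m)" and
      0: "g (vec_first z m1) @\<^sub>v h (shift (vec_first z m1) (- u z) (vec_last z m)) = 0\<^sub>v (i\<^sub>+ (P X) + i\<^sub>- N)"
    define x where "x = vec_first z m1"
    define w where "w = vec_last z m"
    have x: "x \<in> carrier_vec m1" and w: "w \<in> carrier_vec m" by (simp_all add: x_def w_def)
    have uz: "u z \<in> carrier_vec n" using lin_carrier[OF lu z] .
    have sh: "shift x (- u z) w \<in> carrier_vec (m1 + n + m)"
      using lin_carrier[OF lf z] by (simp add: x_def w_def)
    from 0 have 1: "g x = 0\<^sub>v (i\<^sub>+ (P X))" "h (shift x (- u z) w) = 0\<^sub>v (i\<^sub>- N)"
      using append_vec_eq_0[OF lin_carrier[OF g(1) x] lin_carrier[OF h(1) sh]]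
      by (simp_all add: x_def w_def)
    have "0 \<le> quad_form (P X) x - 2 * re_inner (u z) (u z)"
      using h(2)[OF sh 1(2)] quad_form_N_shift[OF x _ w, of "- u z"] uz
      by (simp add: u_def re_inner_uminus_left[of _ n] flip: x_def w_def)
    then have "re_inner (u z) (u z) = 0" "quad_form (P X) x = 0"
      using g(2)[OF x 1(1)] re_inner_self_ge_0[OF uz] by linarith+
    then have "u z = 0\<^sub>v n" "P X *\<^sub>v x = 0\<^sub>v m1"
      using re_inner_self_eq_0[OF uz] g(3)[OF x 1(1)] by auto
    then have "M1\<^sup>H *\<^sub>v (x @\<^sub>v w) = 0\<^sub>v (m1 + n)"
      using M1_adjoint_kernel[OF x w] by (simp add: u_def x_def w_def)
    then show "M1\<^sup>H *\<^sub>v z = 0\<^sub>v (m1 + n)" using z by (simp add: x_def w_def)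
  qed (use M1_carrier in simp)
  then show ?thesis using rank_adjoint[OF M1_carrier] by simp
qed

text \<open>Again \<open>y = - u\<close>: the form of \<open>N\<close> is negative wherever that of
  \<open>P X\<close> is, and for \<open>x = 0\<close> as soon as \<open>B4\<^sup>H w\<close> is
  nonzero.\<close>

lemma neg_inertia_P_upper: "i\<^sub>- (P X) + mat_rank B4 \<le> i\<^sub>- N"
proof -
  obtain f where f: "lin (i\<^sub>- (P X)) m1 f"
    "\<And>c. c \<in> carrier_vec (i\<^sub>- (P X)) \<Longrightarrow> c \<noteq> 0\<^sub>v (i\<^sub>- (P X)) \<Longrightarrow> quad_form (P X) (f c) < 0"
    using neg_domain[OF P_carr P_herm] by metis
  obtain h where h: "lin (mat_rank B4) m h"
    "\<And>c. c \<in> carrier_vec (mat_rank B4) \<Longrightarrow> B4\<^sup>H *\<^sub>v h c = 0\<^sub>v n \<Longrightarrow> c = 0\<^sub>v (mat_rank B4)"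
    using rank_domain[OF adj_carrier(2)] rank_adjoint[OF B4] by metis
  let ?p = "i\<^sub>- (P X)" and ?q = "mat_rank B4"
  define x where "x c = f (vec_first c ?p)" for c
  define w where "w c = h (vec_last c ?q)" for c
  define u where "u c = B1\<^sup>H *\<^sub>v x c + B4\<^sup>H *\<^sub>v w c" for c
  have lx: "lin (?p + ?q) m1 x" and lw: "lin (?p + ?q) m w"
    unfolding x_def w_def by (intro lin_compose[OF f(1)] lin_compose[OF h(1)] lin_first lin_last)+
  have lu: "lin (?p + ?q) n u"
    unfolding u_def by (intro lin_add lin_mat[of _ n m1] lin_mat[of _ n m] lx lw) simp_all
  show ?thesis
  proof (rule neg_inertia_ge[OF N_carrier N_hermitian])
    show "lin (?p + ?q) (m1 + n + m) (\<lambda>c. shift (x c) (- u c) (w c))"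
      by (intro lin_shift lin_uminus lx lw lu)
    fix c :: "complex vec" assume c: "c \<in> carrier_vec (?p + ?q)" "c \<noteq> 0\<^sub>v (?p + ?q)"
    have xc: "x c \<in> carrier_vec m1" and wc: "w c \<in> carrier_vec m" and uc: "u c \<in> carrier_vec n"
      using lin_carrier[OF lx] lin_carrier[OF lw] lin_carrier[OF lu] c(1) by auto
    have q: "quad_form N (shift (x c) (- u c) (w c)) = quad_form (P X) (x c) - 2 * re_inner (u c) (u c)"
      using quad_form_N_shift[OF xc _ wc, of "- u c"] uc
      by (simp add: re_inner_uminus_left[of _ n] flip: u_def)
    show "quad_form N (shift (x c) (- u c) (w c)) < 0"
    proof (cases "vec_first c ?p = 0\<^sub>v ?p")
      case True
      then have x0: "x c = 0\<^sub>v m1" using lin_zero_arg[OF f(1)] by (simp add: x_def)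
      have "vec_last c ?q \<noteq> 0\<^sub>v ?q" using vec_split_cases[OF c] True by blast
      then have "B4\<^sup>H *\<^sub>v w c \<noteq> 0\<^sub>v n" using h(2)[of "vec_last c ?q"] by (auto simp: w_def)
      then have "u c \<noteq> 0\<^sub>v n" using x0 wc mult_mat_vec_zero[OF adj_carrier(1)] by (simp add: u_def)
      then show ?thesis using re_inner_self_pos[OF uc] x0 q by simp
    next
      case False
      then have "quad_form (P X) (x c) < 0" using f(2) by (simp add: x_def)
      then show ?thesis using q re_inner_self_ge_0[OF uc] by linarith
    qed
  qed
qed

text \<open>The form of \<open>M2\<close> exceeds that of \<open>P X\<close> at the first component
  by a value of the form of \<open>X\<close>, which is nonnegative; so a negative subspace of
  \<open>M2\<close> projects injectively onto one of \<open>P X\<close>.\<close>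

lemma neg_inertia_P_lower:
  assumes psd: "pos_semidef X"
  shows "i\<^sub>- M2 \<le> i\<^sub>- (P X)"
proof -
  obtain f where f: "lin (i\<^sub>- M2) (m1 + m) f"
    "\<And>c. c \<in> carrier_vec (i\<^sub>- M2) \<Longrightarrow> c \<noteq> 0\<^sub>v (i\<^sub>- M2) \<Longrightarrow> quad_form M2 (f c) < 0"
    using neg_domain[OF M2_carrier M2_hermitian] by metis
  show ?thesis
  proof (rule neg_inertia_ge[OF P_carr P_herm])
    show "lin (i\<^sub>- M2) m1 (\<lambda>c. vec_first (f c) m1)" by (rule lin_compose[OF lin_first f(1)])
    fix c :: "complex vec" assume c: "c \<in> carrier_vec (i\<^sub>- M2)" "c \<noteq> 0\<^sub>v (i\<^sub>- M2)"
    have "vec_first (f c) m1 @\<^sub>v vec_last (f c) m = f c" using lin_carrier[OF f(1) c(1)] by simp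
    then have "quad_form M2 (f c) = quad_form (P X) (vec_first (f c) m1) +
        quad_form X (B1\<^sup>H *\<^sub>v vec_first (f c) m1 + B4\<^sup>H *\<^sub>v vec_last (f c) m)"
      using quad_form_M2[of "vec_first (f c) m1" "vec_last (f c) m"] by simp
    moreover have "0 \<le> quad_form X (B1\<^sup>H *\<^sub>v vec_first (f c) m1 + B4\<^sup>H *\<^sub>v vec_last (f c) m)"
      using psd carrier_matD(1)[OF X] by (simp add: pos_semidef_def)
    ultimately show "quad_form (P X) (vec_first (f c) m1) < 0" using f(2)[OF c] by linarith
  qed
qed

lemma pos_inertia_P_upper:
  assumes psd: "pos_semidef X"
  shows "i\<^sub>+ (P X) + mat_rank A4 \<le> i\<^sub>+ M2"
proof -
  obtain f where f: "lin (i\<^sub>+ (P X)) m1 f"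
    "\<And>c. c \<in> carrier_vec (i\<^sub>+ (P X)) \<Longrightarrow> c \<noteq> 0\<^sub>v (i\<^sub>+ (P X)) \<Longrightarrow> 0 < quad_form (P X) (f c)"
    using pos_domain[OF P_carr P_herm] by metis
  obtain h where h: "lin (mat_rank A4) m h"
    "\<And>c. c \<in> carrier_vec (mat_rank A4) \<Longrightarrow> A4\<^sup>H *\<^sub>v h c = 0\<^sub>v n \<Longrightarrow> c = 0\<^sub>v (mat_rank A4)"
    using rank_domain[OF adj_carrier(3)] rank_adjoint[OF A4] by metis
  let ?p = "i\<^sub>+ (P X)" and ?q = "mat_rank A4"
  have psdX: "0 \<le> quad_form X v" if "v \<in> carrier_vec n" for v
    using psd that carrier_matD(1)[OF X] by (simp add: pos_semidef_def)
  show ?thesis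
  proof (rule pos_inertia_ge[OF M2_carrier M2_hermitian])
    show "lin (?p + ?q) (m1 + m) (\<lambda>c. f (vec_first c ?p) @\<^sub>v h (vec_last c ?q))"
      by (intro lin_append lin_compose[OF f(1)] lin_compose[OF h(1)] lin_first lin_last)
    fix c :: "complex vec" assume c: "c \<in> carrier_vec (?p + ?q)" "c \<noteq> 0\<^sub>v (?p + ?q)"
    define x where "x = f (vec_first c ?p)"
    define w where "w = h (vec_last c ?q)"
    have x: "x \<in> carrier_vec m1" and w: "w \<in> carrier_vec m"
      unfolding x_def w_def using lin_carrier[OF f(1)] lin_carrier[OF h(1)] by simp_all
    have "0 < quad_form M2 (x @\<^sub>v w)"
    proof (cases "vec_first c ?p = 0\<^sub>v ?p")
      case True
      then have x0: "x = 0\<^sub>v m1" using lin_zero_arg[OF f(1)] by (simp add: x_def)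
      have "vec_last c ?q \<noteq> 0\<^sub>v ?q" using vec_split_cases[OF c] True by blast
      then have "X *\<^sub>v (B4\<^sup>H *\<^sub>v w) \<noteq> 0\<^sub>v n"
        using h(2)[of "vec_last c ?q"] A4_adj_vec[OF w] by (auto simp: w_def)
      \<comment> \<open>A positive semidefinite form vanishes only on the kernel of its matrix, here
        at the \<open>w\<close> with \<open>A4\<^sup>H w = 0\<close>.\<close>
      then have "quad_form X (B4\<^sup>H *\<^sub>v w) \<noteq> 0" using pos_semidef_kernel[OF X psd] w by auto
      then have "0 < quad_form X (B4\<^sup>H *\<^sub>v w)" using psdX[of "B4\<^sup>H *\<^sub>v w"] w by simp
      then show ?thesis
        using quad_form_M2[OF x w] x0 w mult_mat_vec_zero[OF adj_carrier(1)] by simp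
    next
      case False
      then have "0 < quad_form (P X) x" using f(2) by (simp add: x_def)
      then show ?thesis
        using quad_form_M2[OF x w] psdX[of "B1\<^sup>H *\<^sub>v x + B4\<^sup>H *\<^sub>v w"] x w by simp
    qed
    then show "0 < quad_form M2 (f (vec_first c ?p) @\<^sub>v h (vec_last c ?q))" by (simp add: x_def w_def)
  qed
qed

section \<open>Extremal solutions\<close>

text \<open>A solution \<open>X = A4\<^sup>H * Z\<close> is the smallest positive semidefinite one: \<open>w\<close> can be chosen so that
  the second term of \<open>quad_form_M2\<close> vanishes.\<close>

lemma minimal_solution_inertia:
  assumes Z: "Z \<in> carrier_mat m n" and XZ: "X = A4\<^sup>H * Z"
  shows "i\<^sub>- (P X) \<le> i\<^sub>- M2" "i\<^sub>+ M2 \<le> i\<^sub>+ (P X) + mat_rank A4"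
proof -
  obtain f where f: "lin (i\<^sub>- (P X)) m1 f"
    "\<And>c. c \<in> carrier_vec (i\<^sub>- (P X)) \<Longrightarrow> c \<noteq> 0\<^sub>v (i\<^sub>- (P X)) \<Longrightarrow> quad_form (P X) (f c) < 0"
    using neg_domain[OF P_carr P_herm] by metis
  have Zv: "Z *\<^sub>v y \<in> carrier_vec m" if "y \<in> carrier_vec n" for y
    using mult_mat_vec_carrier[OF Z that] .
  show "i\<^sub>- (P X) \<le> i\<^sub>- M2"
  proof (rule neg_inertia_ge[OF M2_carrier M2_hermitian])
    \<comment> \<open>The choice \<open>w = - Z B1\<^sup>H x\<close> gives
      \<open>X B4\<^sup>H w = A4\<^sup>H w = - X B1\<^sup>H x\<close>, so that
      \<open>X u = 0\<close>.\<close>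
    show "lin (i\<^sub>- (P X)) (m1 + m) (\<lambda>c. f c @\<^sub>v - (Z *\<^sub>v (B1\<^sup>H *\<^sub>v f c)))"
      by (intro lin_append lin_uminus lin_mat[OF Z] lin_mat[of _ n m1] f(1)) simp
    fix c :: "complex vec" assume c: "c \<in> carrier_vec (i\<^sub>- (P X))" "c \<noteq> 0\<^sub>v (i\<^sub>- (P X))"
    define x where "x = f c"
    define w where "w = - (Z *\<^sub>v (B1\<^sup>H *\<^sub>v x))"
    have x: "x \<in> carrier_vec m1" using lin_carrier[OF f(1) c(1)] by (simp add: x_def)
    have w: "w \<in> carrier_vec m" using x Zv by (simp add: w_def)
    have "X *\<^sub>v (B4\<^sup>H *\<^sub>v w) = A4\<^sup>H *\<^sub>v w" using A4_adj_vec[OF w] by simp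
    also have "\<dots> = - (A4\<^sup>H *\<^sub>v (Z *\<^sub>v (B1\<^sup>H *\<^sub>v x)))"
      unfolding w_def using Zv[of "B1\<^sup>H *\<^sub>v x"] x Z
      by (intro eq_vecI) auto
    also have "A4\<^sup>H *\<^sub>v (Z *\<^sub>v (B1\<^sup>H *\<^sub>v x)) = X *\<^sub>v (B1\<^sup>H *\<^sub>v x)"
      using assoc_mult_mat_vec[OF adj_carrier(3) Z, of "B1\<^sup>H *\<^sub>v x"] x by (simp add: XZ)
    finally have "X *\<^sub>v (B1\<^sup>H *\<^sub>v x + B4\<^sup>H *\<^sub>v w) = 0\<^sub>v n"
      using x w by (simp add: mult_add_distrib_mat_vec[of _ n n])
    then have "quad_form M2 (x @\<^sub>v w) = quad_form (P X) x"
      using quad_form_M2[OF x w] x w by (simp add: quad_form_re_inner[of X])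
    then show "quad_form M2 (f c @\<^sub>v - (Z *\<^sub>v (B1\<^sup>H *\<^sub>v f c))) < 0"
      using f(2)[OF c] by (simp add: x_def w_def)
  qed
  obtain f where f: "lin (i\<^sub>+ M2) (m1 + m) f"
    "\<And>c. c \<in> carrier_vec (i\<^sub>+ M2) \<Longrightarrow> c \<noteq> 0\<^sub>v (i\<^sub>+ M2) \<Longrightarrow> 0 < quad_form M2 (f c)"
    using pos_domain[OF M2_carrier M2_hermitian] by metis
  obtain g where g: "lin m1 (i\<^sub>+ (P X)) g"
    "\<And>x. x \<in> carrier_vec m1 \<Longrightarrow> g x = 0\<^sub>v (i\<^sub>+ (P X)) \<Longrightarrow> quad_form (P X) x \<le> 0"
    using pos_functionals[OF P_carr P_herm] by metis
  obtain h where h: "lin n (mat_rank A4) h"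
    "\<And>y. y \<in> carrier_vec n \<Longrightarrow> h y = 0\<^sub>v (mat_rank A4) \<longleftrightarrow> A4 *\<^sub>v y = 0\<^sub>v m"
    using rank_functionals[OF A4] by metis
  define x where "x c = vec_first (f c) m1" for c
  define w where "w c = vec_last (f c) m" for c
  define u where "u c = B1\<^sup>H *\<^sub>v x c + B4\<^sup>H *\<^sub>v w c" for c
  have lx: "lin (i\<^sub>+ M2) m1 x" and lw: "lin (i\<^sub>+ M2) m w"
    unfolding x_def w_def by (rule lin_compose[OF lin_first f(1)] lin_compose[OF lin_last f(1)])+
  have lu: "lin (i\<^sub>+ M2) n u"
    unfolding u_def by (intro lin_add lin_mat[of _ n m1] lin_mat[of _ n m] lx lw) simp_all
  \<comment> \<open>The condition \<open>A4 u = 0\<close> amounts to \<open>r(A4)\<close> equations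
    and forces \<open>X u = 0\<close>, since \<open>X = Z\<^sup>H A4\<close>; together with the
    conditions for \<open>P X\<close> it makes the form of \<open>M2\<close> nonpositive.\<close>
  have lgh: "lin (i\<^sub>+ M2) (i\<^sub>+ (P X) + mat_rank A4) (\<lambda>c. g (x c) @\<^sub>v h (u c))"
    by (intro lin_append lin_compose[OF g(1)] lin_compose[OF h(1)] lx lu)
  show "i\<^sub>+ M2 \<le> i\<^sub>+ (P X) + mat_rank A4"
  proof (rule ccontr)
    assume "\<not> ?thesis"
    then obtain c where c: "c \<in> carrier_vec (i\<^sub>+ M2)" "c \<noteq> 0\<^sub>v (i\<^sub>+ M2)"
      "g (x c) @\<^sub>v h (u c) = 0\<^sub>v (i\<^sub>+ (P X) + mat_rank A4)"
      using lin_kernel_nontrivial[OF lgh] by (metis not_le)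
    have xc: "x c \<in> carrier_vec m1" and wc: "w c \<in> carrier_vec m" and uc: "u c \<in> carrier_vec n"
      using lin_carrier[OF lx] lin_carrier[OF lw] lin_carrier[OF lu] c(1) by auto
    have 0: "g (x c) = 0\<^sub>v (i\<^sub>+ (P X))" "h (u c) = 0\<^sub>v (mat_rank A4)"
      using append_vec_eq_0[OF lin_carrier[OF g(1) xc] lin_carrier[OF h(1) uc]] c(3) by auto
    have "X = Z\<^sup>H * A4"
      using mat_adjoint_mult[OF adj_carrier(3) Z] X_herm XZ by (simp add: hermitian_def)
    then have "X *\<^sub>v u c = Z\<^sup>H *\<^sub>v (A4 *\<^sub>v u c)"
      using assoc_mult_mat_vec[of "Z\<^sup>H" n m A4 n "u c"] Z uc by simp
    also have "A4 *\<^sub>v u c = 0\<^sub>v m" using h(2)[OF uc] 0(2) by simp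
    finally have "X *\<^sub>v u c = 0\<^sub>v n" using mult_mat_vec_zero[of "Z\<^sup>H" n m] Z by simp
    then have "quad_form X (u c) = 0" using uc by (simp add: quad_form_re_inner)
    moreover have "x c @\<^sub>v w c = f c" using lin_carrier[OF f(1) c(1)] by (simp add: x_def w_def)
    ultimately have "quad_form M2 (f c) = quad_form (P X) (x c)"
      using quad_form_M2[OF xc wc] by (simp add: u_def)
    then show False using f(2)[OF c(1,2)] g(2)[OF xc 0(1)] by simp
  qed
qed

text \<open>The columns of \<open>Y\<close> lie in the kernel of \<open>B4\<close>, so the equation
  is preserved while \<open>P X\<close> decreases. This serves for \<open>Y = K\<close> with a large
  factor and for a single column \<open>Y\<close> in the descent.\<close>

lemma solution_add_gram:
  assumes Y: "Y \<in> carrier_mat n k" "B4 * Y = 0\<^sub>m m k"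
  shows "solution A1 B1 A4 B4 m1 n m (X + complex_of_real t \<cdot>\<^sub>m (Y * Y\<^sup>H))"
    and "x \<in> carrier_vec m1 \<Longrightarrow> quad_form (P (X + complex_of_real t \<cdot>\<^sub>m (Y * Y\<^sup>H))) x =
      quad_form (P X) x - t * re_inner (Y\<^sup>H *\<^sub>v (B1\<^sup>H *\<^sub>v x)) (Y\<^sup>H *\<^sub>v (B1\<^sup>H *\<^sub>v x))"
    and "pos_semidef X \<Longrightarrow> 0 \<le> t \<Longrightarrow> pos_semidef (X + complex_of_real t \<cdot>\<^sub>m (Y * Y\<^sup>H))"
proof -
  have YH: "Y\<^sup>H \<in> carrier_mat k n" using Y by simp
  have YY: "complex_of_real t \<cdot>\<^sub>m (Y * Y\<^sup>H) \<in> carrier_mat n n" using mult_carrier_mat[OF Y(1) YH] by simp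
  have herm: "hermitian (X + complex_of_real t \<cdot>\<^sub>m (Y * Y\<^sup>H))"
    using YY X_herm hermitian_smult[OF hermitian_gram[OF Y(1)]] by (intro hermitian_add) auto
  have "B4 * (Y * Y\<^sup>H) = 0\<^sub>m m n"
    using assoc_mult_mat[OF B4 Y(1) YH] Y(2) YH by simp
  then have "B4 * (complex_of_real t \<cdot>\<^sub>m (Y * Y\<^sup>H)) = 0\<^sub>m m n"
    using mult_smult_distrib[OF B4 mult_carrier_mat[OF Y(1) YH]] by simp
  then have "B4 * (X + complex_of_real t \<cdot>\<^sub>m (Y * Y\<^sup>H)) = A4"
    using mult_add_distrib_mat[OF B4 X YY] sol by simp
  then show s: "solution A1 B1 A4 B4 m1 n m (X + complex_of_real t \<cdot>\<^sub>m (Y * Y\<^sup>H))"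
    using herm YY by unfold_locales auto
  show "quad_form (P (X + complex_of_real t \<cdot>\<^sub>m (Y * Y\<^sup>H))) x =
      quad_form (P X) x - t * re_inner (Y\<^sup>H *\<^sub>v (B1\<^sup>H *\<^sub>v x)) (Y\<^sup>H *\<^sub>v (B1\<^sup>H *\<^sub>v x))"
    if x: "x \<in> carrier_vec m1"
    using x YY quad_form_P[of "X + complex_of_real t \<cdot>\<^sub>m (Y * Y\<^sup>H)" x]
    by (simp add: quad_form_P quad_form_mat_add[of _ n] quad_form_gram[OF Y(1)])
  assume psd: "pos_semidef X" and t: "0 \<le> t"
  have "0 \<le> quad_form (X + complex_of_real t \<cdot>\<^sub>m (Y * Y\<^sup>H)) v" if v: "v \<in> carrier_vec n" for v
  proof -
    have "0 \<le> quad_form X v" using psd v carrier_matD(1)[OF X] by (simp add: pos_semidef_def)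
    moreover have "Y\<^sup>H *\<^sub>v v \<in> carrier_vec k" using mult_mat_vec_carrier[OF YH v] .
    ultimately show ?thesis
      using t v YY by (simp add: quad_form_mat_add[of _ n] quad_form_gram[OF Y(1)])
  qed
  then show "pos_semidef (X + complex_of_real t \<cdot>\<^sub>m (Y * Y\<^sup>H))"
    using herm YY carrier_matD(1)[OF Y(1)] by (auto simp: pos_semidef_def)
qed

end

section \<open>Enlarging solutions along the kernel of \<open>B4\<close>\<close>

context block_data begin

text \<open>An inner inverse \<open>G\<close> of \<open>B4\<close> gives the oblique projection
  \<open>1 - G B4\<close>. It is not Hermitian in general, hence the Gram matrix
  \<open>K K\<^sup>H\<close> in the perturbations.\<close>

lemma kernel_projection:
  obtains K where "K \<in> carrier_mat n n" "B4 * K = 0\<^sub>m m n"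
    "\<And>y. y \<in> carrier_vec n \<Longrightarrow> B4 *\<^sub>v y = 0\<^sub>v m \<Longrightarrow> K *\<^sub>v y = y"
proof -
  obtain G where G: "G \<in> carrier_mat n m" "B4 * G * B4 = B4" using inner_inverse_exists[OF B4] by metis
  have GB: "G * B4 \<in> carrier_mat n n" using G by (intro mult_carrier_mat[of _ n m]) auto
  show thesis
  proof (rule that[of "1\<^sub>m n - G * B4"])
    show "1\<^sub>m n - G * B4 \<in> carrier_mat n n" using GB by (rule minus_carrier_mat)
    have "B4 * (G * B4) = B4" using G assoc_mult_mat[OF B4 G(1) B4] by simp
    then show "B4 * (1\<^sub>m n - G * B4) = 0\<^sub>m m n"
      using mult_minus_distrib_mat[OF B4 one_carrier_mat GB] minus_r_inv_mat[OF B4]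
      by simp
    fix y :: "complex vec" assume y: "y \<in> carrier_vec n" "B4 *\<^sub>v y = 0\<^sub>v m"
    have "G * B4 *\<^sub>v y = 0\<^sub>v n"
      using assoc_mult_mat_vec[OF G(1) B4 y(1)] y(2) mult_mat_vec_zero[OF G(1)] by simp
    then show "(1\<^sub>m n - G * B4) *\<^sub>v y = y"
      using minus_mult_distrib_mat_vec[OF one_carrier_mat GB y(1)] y(1) by simp
  qed
qed

end

context solution begin

text \<open>\<open>shift\<close> is invertible: adding its correction \<open>z\<close> to the middle
  component beforehand brings every vector into shifted form.\<close>

lemma N_neg_domain:
  obtains x y w where "lin (i\<^sub>- N) m1 x" "lin (i\<^sub>- N) n y" "lin (i\<^sub>- N) m w"
    "\<And>c. c \<in> carrier_vec (i\<^sub>- N) \<Longrightarrow> c \<noteq> 0\<^sub>v (i\<^sub>- N) \<Longrightarrow> quad_form N (shift (x c) (y c) (w c)) < 0"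
proof -
  obtain f where f: "lin (i\<^sub>- N) (m1 + n + m) f"
    "\<And>c. c \<in> carrier_vec (i\<^sub>- N) \<Longrightarrow> c \<noteq> 0\<^sub>v (i\<^sub>- N) \<Longrightarrow> quad_form N (f c) < 0"
    using neg_domain[OF N_carrier N_hermitian] by metis
  define x where "x c = vec_first (vec_first (f c) (m1 + n)) m1" for c
  define y0 where "y0 c = vec_last (vec_first (f c) (m1 + n)) n" for c
  define w where "w c = vec_last (f c) m" for c
  define z where "z c = complex_of_real (1/2) \<cdot>\<^sub>v (X *\<^sub>v (B1\<^sup>H *\<^sub>v x c - B4\<^sup>H *\<^sub>v w c))" for c
  have lx: "lin (i\<^sub>- N) m1 x" and ly0: "lin (i\<^sub>- N) n y0" and lw: "lin (i\<^sub>- N) m w"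
    unfolding x_def y0_def w_def
    by (rule lin_compose[OF lin_first lin_compose[OF lin_first f(1)]]
        lin_compose[OF lin_last lin_compose[OF lin_first f(1)]] lin_compose[OF lin_last f(1)])+
  have lz: "lin (i\<^sub>- N) n z"
    unfolding z_def by (intro lin_smult lin_minus lin_mat[OF X] lin_mat[of _ n m1] lin_mat[of _ n m] lx lw)
      simp_all
  show thesis
  proof (rule that[OF lx lin_add[OF ly0 lz] lw])
    fix c :: "complex vec" assume c: "c \<in> carrier_vec (i\<^sub>- N)" "c \<noteq> 0\<^sub>v (i\<^sub>- N)"
    have "y0 c + z c - z c = y0 c"
      using lin_carrier[OF ly0 c(1)] lin_carrier[OF lz c(1)] by (intro eq_vecI) auto
    then have "shift (x c) (y0 c + z c) (w c) = (x c @\<^sub>v y0 c) @\<^sub>v w c"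
      by (simp only: shift_def z_def)
    also have "\<dots> = f c" using lin_carrier[OF f(1) c(1)] by (simp add: x_def y0_def w_def)
    finally show "quad_form N (shift (x c) (y0 c + z c) (w c)) < 0" using f(2)[OF c] by simp
  qed
qed

text \<open>Completing the square: \<open>2 Re (y\<^sup>* K\<^sup>* u) \<ge> - \<bar>y\<bar>\<^sup>2 / t - t \<bar>K\<^sup>* u\<bar>\<^sup>2\<close>, so a large multiple of \<open>K K\<^sup>*\<close>
  absorbs the border of \<open>N\<close>.\<close>

lemma large_solution_inertia:
  assumes K: "K \<in> carrier_mat n n"
    and K_id: "\<And>y. y \<in> carrier_vec n \<Longrightarrow> B4 *\<^sub>v y = 0\<^sub>v m \<Longrightarrow> K *\<^sub>v y = y"
    and BK: "B4 * K = 0\<^sub>m m n"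
  obtains t where "0 < t" "i\<^sub>- N \<le> i\<^sub>- (P (X + complex_of_real t \<cdot>\<^sub>m (K * K\<^sup>H))) + mat_rank B4"
proof -
  obtain x y w where lx: "lin (i\<^sub>- N) m1 x" and ly: "lin (i\<^sub>- N) n y" and lw: "lin (i\<^sub>- N) m w"
    and neg_N: "\<And>c. c \<in> carrier_vec (i\<^sub>- N) \<Longrightarrow> c \<noteq> 0\<^sub>v (i\<^sub>- N) \<Longrightarrow>
      quad_form N (shift (x c) (y c) (w c)) < 0"
    by (rule N_neg_domain) blast
  define f where "f c = shift (x c) (y c) (w c)" for c
  have lf: "lin (i\<^sub>- N) (m1 + n + m) f" unfolding f_def by (rule lin_shift[OF lx ly lw])
  have KH: "K\<^sup>H \<in> carrier_mat n n" using K by simp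
  \<comment> \<open>\<open>t\<close> is fixed by \<open>N\<close> before the new solution is formed:
    the negative subspace of \<open>N\<close> has a margin that tolerates the squared norm of
    \<open>y\<close> divided by \<open>t\<close>, which completing the square leaves over.\<close>
  obtain t where t: "0 < t"
    "\<And>c. c \<in> carrier_vec (i\<^sub>- N) \<Longrightarrow> c \<noteq> 0\<^sub>v (i\<^sub>- N) \<Longrightarrow>
      quad_form N (f c) + re_inner (y c) (y c) / t < 0"
    using neg_form_perturbation[OF N_carrier N_hermitian lf ly] neg_N unfolding f_def by metis
  define X' where "X' = X + complex_of_real t \<cdot>\<^sub>m (K * K\<^sup>H)"
  interpret X': solution A1 B1 A4 B4 m1 n m X'
    unfolding X'_def by (rule solution_add_gram(1)[OF K BK])
  have neg: "quad_form (P X') (x c) < 0"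
    if c: "c \<in> carrier_vec (i\<^sub>- N)" "c \<noteq> 0\<^sub>v (i\<^sub>- N)" and By: "B4 *\<^sub>v y c = 0\<^sub>v m" for c
  proof -
    have xc: "x c \<in> carrier_vec m1" and wc: "w c \<in> carrier_vec m" and yc: "y c \<in> carrier_vec n"
      using lin_carrier[OF lx] lin_carrier[OF lw] lin_carrier[OF ly] c(1) by auto
    define v where "v = K\<^sup>H *\<^sub>v (B1\<^sup>H *\<^sub>v x c)"
    have v: "v \<in> carrier_vec n" unfolding v_def using mult_mat_vec_carrier[OF KH] xc by simp
    \<comment> \<open>\<open>B4 y = 0\<close> removes \<open>w\<close> from the border, and
      \<open>K y = y\<close> moves \<open>K\<^sup>H\<close> onto \<open>B1\<^sup>H x\<close>, where
      the added Gram term acts.\<close>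
    have "re_inner (y c) (B4\<^sup>H *\<^sub>v w c) = 0" using B4_adj[OF yc wc] By wc by simp
    moreover have "re_inner (y c) (B1\<^sup>H *\<^sub>v x c) = re_inner (y c) v"
      using re_inner_adjoint[OF K yc, of "B1\<^sup>H *\<^sub>v x c"] K_id[OF yc By] xc by (simp add: v_def)
    ultimately have qN: "quad_form N (f c) = quad_form (P X) (x c) + 2 * re_inner (y c) v"
      using quad_form_N_shift[OF xc yc wc] yc xc wc
      by (simp add: f_def re_inner_add_right[of _ n])
    have ty: "complex_of_real t \<cdot>\<^sub>v v \<in> carrier_vec n" using v by simp
    have "0 \<le> re_inner (y c + complex_of_real t \<cdot>\<^sub>v v) (y c + complex_of_real t \<cdot>\<^sub>v v)"
      using yc ty by (intro re_inner_self_ge_0[of _ n]) simp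
    also have "\<dots> = re_inner (y c) (y c) + 2 * t * re_inner (y c) v + t * t * re_inner v v"
      using yc ty v re_inner_commute[OF yc v]
      by (simp add: re_inner_add_left[of _ n] re_inner_add_right[of _ n] re_inner_smult_left[of _ n]
          re_inner_smult_right[of _ n] distrib_left)
    finally have "0 \<le> (re_inner (y c) (y c) + 2 * t * re_inner (y c) v + t * t * re_inner v v) / t"
      using t(1) by simp
    also have "\<dots> = re_inner (y c) (y c) / t + 2 * re_inner (y c) v + t * re_inner v v"
      using t(1) by (simp add: field_simps)
    finally have "quad_form (P X) (x c) - t * re_inner v v \<le> quad_form N (f c) + re_inner (y c) (y c) / t"
      using qN by simp
    also have "\<dots> < 0" by (rule t(2)[OF c])
    finally show ?thesis
      using solution_add_gram(2)[OF K BK xc, of t] by (simp add: X'_def v_def)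
  qed
  obtain g where g: "lin m1 (i\<^sub>- (P X')) g"
    "\<And>x. x \<in> carrier_vec m1 \<Longrightarrow> g x = 0\<^sub>v (i\<^sub>- (P X')) \<Longrightarrow> 0 \<le> quad_form (P X') x"
    using neg_functionals[OF X'.P_carr X'.P_herm] by metis
  obtain h where h: "lin n (mat_rank B4) h"
    "\<And>y. y \<in> carrier_vec n \<Longrightarrow> h y = 0\<^sub>v (mat_rank B4) \<longleftrightarrow> B4 *\<^sub>v y = 0\<^sub>v m"
    using rank_functionals[OF B4] by metis
  \<comment> \<open>\<open>B4 y = 0\<close> amounts to \<open>r(B4)\<close> linear conditions; where
    they hold, the enlarged solution has a negative form at \<open>x\<close>.\<close>
  have lgh: "lin (i\<^sub>- N) (i\<^sub>- (P X') + mat_rank B4) (\<lambda>c. g (x c) @\<^sub>v h (y c))"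
    by (intro lin_append lin_compose[OF g(1)] lin_compose[OF h(1)] lx ly)
  have "i\<^sub>- N \<le> i\<^sub>- (P X') + mat_rank B4"
  proof (rule ccontr)
    assume "\<not> ?thesis"
    then obtain c where c: "c \<in> carrier_vec (i\<^sub>- N)" "c \<noteq> 0\<^sub>v (i\<^sub>- N)"
      "g (x c) @\<^sub>v h (y c) = 0\<^sub>v (i\<^sub>- (P X') + mat_rank B4)"
      using lin_kernel_nontrivial[OF lgh] by (metis not_le)
    have xc: "x c \<in> carrier_vec m1" and yc: "y c \<in> carrier_vec n"
      using lin_carrier[OF lx] lin_carrier[OF ly] c(1) by auto
    have "g (x c) = 0\<^sub>v (i\<^sub>- (P X'))" "h (y c) = 0\<^sub>v (mat_rank B4)"
      using append_vec_eq_0[OF lin_carrier[OF g(1) xc] lin_carrier[OF h(1) yc]] c(3) by auto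
    then show False using neg[OF c(1,2)] g(2)[OF xc] h(2)[OF yc] by auto
  qed
  then show thesis using that[OF t(1)] by (simp add: X'_def)
qed

text \<open>The dimension count takes pairs of a vector \<open>v\<close> from a positive subspace of
  \<open>P X\<close> and a vector from a negative subspace of \<open>N\<close>, with shifted
  coordinates \<open>x1\<close>, \<open>y\<close>, \<open>w\<close>. Put \<open>x = v + x1\<close>.
  By the block triangular form of \<open>M1\<close>, the equations \<open>P X x + B1 y = 0\<close>
  and \<open>B4 y = 0\<close> are \<open>r(M1)\<close> conditions, so the assumption leaves a
  nonzero pair. For it the form of \<open>P X\<close> at \<open>x\<close> equals that at
  \<open>v\<close> minus that of \<open>N\<close>, and neither part can be negative.\<close>

lemma descent:
  assumes psd: "pos_semidef X" and gt: "mat_rank M1 < i\<^sub>+ (P X) + i\<^sub>- N"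
  obtains X' where "solution A1 B1 A4 B4 m1 n m X'" "pos_semidef X'"
    "i\<^sub>+ (P X') < i\<^sub>+ (P X)" "i\<^sub>- (P X') \<le> i\<^sub>- (P X)"
proof -
  let ?p = "i\<^sub>+ (P X)" and ?q = "i\<^sub>- N"
  obtain h where h: "lin ?p m1 h" "\<And>c. c \<in> carrier_vec ?p \<Longrightarrow> c \<noteq> 0\<^sub>v ?p \<Longrightarrow> 0 < quad_form (P X) (h c)"
    using pos_domain[OF P_carr P_herm] by metis
  obtain x1 y w where lx: "lin ?q m1 x1" and ly: "lin ?q n y" and lw: "lin ?q m w"
    and neg_N: "\<And>c. c \<in> carrier_vec ?q \<Longrightarrow> c \<noteq> 0\<^sub>v ?q \<Longrightarrow> quad_form N (shift (x1 c) (y c) (w c)) < 0"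
    by (rule N_neg_domain) blast
  define f where "f c = shift (x1 c) (y c) (w c)" for c
  have lf: "lin ?q (m1 + n + m) f" unfolding f_def by (rule lin_shift[OF lx ly lw])
  obtain g where g: "lin (m1 + n) (mat_rank M1) g"
    "\<And>z. z \<in> carrier_vec (m1 + n) \<Longrightarrow> g z = 0\<^sub>v (mat_rank M1) \<longleftrightarrow> M1 *\<^sub>v z = 0\<^sub>v (m1 + m)"
    using rank_functionals[OF M1_carrier] by metis
  define s where "s c = h (vec_first c ?p) + x1 (vec_last c ?q)" for c
  have ls: "lin (?p + ?q) m1 s"
    unfolding s_def by (intro lin_add lin_compose[OF h(1)] lin_compose[OF lx] lin_first lin_last)
  have lyl: "lin (?p + ?q) n (\<lambda>c. y (vec_last c ?q))" by (intro lin_compose[OF ly] lin_last)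
  have lG: "lin (?p + ?q) (m1 + n) (\<lambda>c. s c @\<^sub>v (y (vec_last c ?q) - X *\<^sub>v (B1\<^sup>H *\<^sub>v s c)))"
    by (intro lin_append lin_minus lin_mat[OF X] lin_mat[of _ n m1] ls lyl) simp
  obtain c where c: "c \<in> carrier_vec (?p + ?q)" "c \<noteq> 0\<^sub>v (?p + ?q)"
    "g (s c @\<^sub>v (y (vec_last c ?q) - X *\<^sub>v (B1\<^sup>H *\<^sub>v s c))) = 0\<^sub>v (mat_rank M1)"
    by (rule lin_kernel_nontrivial[OF lin_compose[OF g(1) lG] gt])
  define a where "a = vec_first c ?p"
  define b where "b = vec_last c ?q"
  have a: "a \<in> carrier_vec ?p" and b: "b \<in> carrier_vec ?q" by (simp_all add: a_def b_def)
  define v where "v = h a"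
  define x where "x = s c"
  have v: "v \<in> carrier_vec m1" using lin_carrier[OF h(1) a] by (simp add: v_def)
  have xb: "x1 b \<in> carrier_vec m1" using lin_carrier[OF lx b] .
  have wb: "w b \<in> carrier_vec m" using lin_carrier[OF lw b] .
  have yb: "y b \<in> carrier_vec n" using lin_carrier[OF ly b] .
  have x_eq: "x = v + x1 b" by (simp add: x_def s_def v_def a_def b_def)
  have x: "x \<in> carrier_vec m1" using v xb by (simp add: x_eq)
  have "M1 *\<^sub>v (x @\<^sub>v (y b - X *\<^sub>v (B1\<^sup>H *\<^sub>v x))) = 0\<^sub>v (m1 + m)"
    using g(2)[OF lin_carrier[OF lG c(1)]] c(3) by (simp add: x_def b_def)
  then have k: "P X *\<^sub>v x + B1 *\<^sub>v y b = 0\<^sub>v m1" "B4 *\<^sub>v y b = 0\<^sub>v m"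
    using x yb by (simp_all add: M1_shifted_mult_vec append_vec_eq_0[of _ m1 _ m])
  have B1y: "re_inner (B1 *\<^sub>v y b) u = - re_inner (P X *\<^sub>v x) u" if "u \<in> carrier_vec m1" for u
    using arg_cong[OF k(1), of "\<lambda>z. re_inner z u"] that x yb by (simp add: re_inner_add_left[of _ m1])
  have qN: "quad_form N (f b) = quad_form (P X) (x1 b) + 2 * re_inner (B1 *\<^sub>v y b) (x1 b)"
    using quad_form_N_shift[OF xb yb wb] yb xb wb k(2) B4_adj[OF yb wb]
    by (simp add: f_def re_inner_add_right[of _ n] B1_adj)
  \<comment> \<open>\<open>B4 y = 0\<close> has removed \<open>w\<close> from the form of
    \<open>N\<close>, and \<open>B1 y\<close> may be replaced by \<open>- P X x\<close>; expanding
    at \<open>x = v + x1\<close> leaves exactly this difference.\<close>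
  have q_x: "quad_form (P X) x = quad_form (P X) v - quad_form N (f b)"
    unfolding qN B1y[OF xb]
    using quad_form_add[OF P_carr P_herm v xb] v xb
    by (simp add: x_eq mult_add_distrib_mat_vec[of _ m1 m1] re_inner_add_left[of _ m1])
      (simp add: quad_form_re_inner)
  have pos: "0 < quad_form (P X) x"
  proof -
    have v0: "a = 0\<^sub>v ?p \<Longrightarrow> quad_form (P X) v = 0" and n0: "b = 0\<^sub>v ?q \<Longrightarrow> quad_form N (f b) = 0"
      using lin_zero_arg[OF h(1)] lin_zero_arg[OF lf] quad_form_zero[OF P_carr]
        quad_form_zero[OF N_carrier] by (simp_all add: v_def)
    have v1: "a \<noteq> 0\<^sub>v ?p \<Longrightarrow> 0 < quad_form (P X) v" using h(2)[OF a] by (simp add: v_def)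
    have n1: "b \<noteq> 0\<^sub>v ?q \<Longrightarrow> quad_form N (f b) < 0" using neg_N[OF b] by (simp add: f_def)
    have "a \<noteq> 0\<^sub>v ?p \<or> b \<noteq> 0\<^sub>v ?q" using vec_split_cases[OF c(1,2)] by (simp add: a_def b_def)
    then show ?thesis using v0 n0 v1 n1 q_x by fastforce
  qed
  define Y where "Y = mat_of_cols n [y b]"
  have Y: "Y \<in> carrier_mat n 1" by (intro carrier_matI) (simp_all add: Y_def)
  have colY: "col Y 0 = y b" using yb by (simp add: Y_def)
  have BY: "B4 * Y = 0\<^sub>m m 1"
  proof (rule mat_col_eqI)
    fix i assume "i < dim_col (0\<^sub>m m 1)"
    then show "col (B4 * Y) i = col (0\<^sub>m m 1) i"
      using col_mult2[OF B4 Y, of 0] colY k(2) by simp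
  qed (use Y in auto)
  \<comment> \<open>Because \<open>B1 y = - P X x\<close>, this factor makes the change of
    \<open>P X\<close> the one treated in \<open>rank_one_reduction\<close>.\<close>
  define X' where "X' = X + complex_of_real (1 / quad_form (P X) x) \<cdot>\<^sub>m (Y * Y\<^sup>H)"
  interpret X': solution A1 B1 A4 B4 m1 n m X'
    unfolding X'_def by (rule solution_add_gram(1)[OF Y BY])
  have psd': "pos_semidef X'"
    unfolding X'_def using pos by (intro solution_add_gram(3)[OF Y BY psd]) simp
  have "quad_form (P X') u = quad_form (P X) u - (cmod (u \<bullet>c (P X *\<^sub>v x)))\<^sup>2 / quad_form (P X) x"
    if u: "u \<in> carrier_vec m1" for u
  proof -
    define z where "z = Y\<^sup>H *\<^sub>v (B1\<^sup>H *\<^sub>v u)"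
    have z: "z \<in> carrier_vec 1" unfolding z_def using Y u by (intro mult_mat_vec_carrier[of _ 1 n]) auto
    have Px: "P X *\<^sub>v x = - (B1 *\<^sub>v y b)"
    proof (rule eq_vecI)
      fix i assume "i < dim_vec (- (B1 *\<^sub>v y b))"
      then have i: "i < m1" by simp
      then have "(P X *\<^sub>v x) $ i + (B1 *\<^sub>v y b) $ i = 0"
        using arg_cong[OF k(1), of "\<lambda>v. v $ i"] by (simp del: index_mult_mat_vec)
      then show "(P X *\<^sub>v x) $ i = (- (B1 *\<^sub>v y b)) $ i"
        using i by (simp add: eq_neg_iff_add_eq_0 del: index_mult_mat_vec)
    qed (use carrier_matD(1)[OF P_carr] in simp)
    have "z $ 0 = (B1\<^sup>H *\<^sub>v u) \<bullet>c y b"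
    proof -
      have "row (Y\<^sup>H) 0 = conjugate (y b)" using Y yb colY by (intro eq_vecI) (auto simp: Y_def mat_of_cols_index)
      then have "z $ 0 = conjugate (y b) \<bullet> (B1\<^sup>H *\<^sub>v u)" using Y by (simp add: z_def)
      also have "\<dots> = (B1\<^sup>H *\<^sub>v u) \<bullet>c y b"
        using yb u by (intro comm_scalar_prod[of _ n]) auto
      finally show ?thesis .
    qed
    also have "\<dots> = u \<bullet>c (B1 *\<^sub>v y b)"
      using cscalar_prod_adjoint[OF adj_carrier(1) u yb] by simp
    also have "cmod (u \<bullet>c (B1 *\<^sub>v y b)) = cmod (u \<bullet>c (P X *\<^sub>v x))"
    proof -
      have "conjugate (- (B1 *\<^sub>v y b)) = - conjugate (B1 *\<^sub>v y b)" by (intro eq_vecI) auto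
      then show ?thesis unfolding Px using u yb by simp
    qed
    finally have "cmod (z $ 0) = cmod (u \<bullet>c (P X *\<^sub>v x))" by simp
    then have "re_inner z z = (cmod (u \<bullet>c (P X *\<^sub>v x)))\<^sup>2"
      using re_inner_self[OF z] by simp
    then show ?thesis
      using solution_add_gram(2)[OF Y BY u, of "1 / quad_form (P X) x"]
      by (simp add: X'_def z_def del: of_real_divide)
  qed
  note red = rank_one_reduction[OF P_carr P_herm X'.P_carr X'.P_herm x pos this]
  show thesis
    by (rule that[OF X'.solution_axioms psd' red])
qed

end

section \<open>Existence of solutions and extremal values\<close>

text \<open>Adjoining a vector \<open>x\<close> with \<open>B x = 0\<close> and
  \<open>A x \<noteq> 0\<close> to a domain of dimension \<open>mat_rank B\<close> on which
  \<open>B\<close> is injective would make \<open>A\<close> injective on one dimension more, against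
  the rank bound.\<close>

lemma kernel_subset_of_rank_le:
  assumes A: "A \<in> carrier_mat n k" and B: "B \<in> carrier_mat l k"
    and ker: "\<And>x. x \<in> carrier_vec k \<Longrightarrow> A *\<^sub>v x = 0\<^sub>v n \<Longrightarrow> B *\<^sub>v x = 0\<^sub>v l"
    and rank: "mat_rank A \<le> mat_rank B" and x: "x \<in> carrier_vec k" "B *\<^sub>v x = 0\<^sub>v l"
  shows "A *\<^sub>v x = 0\<^sub>v n"
proof (rule ccontr)
  assume ne: "A *\<^sub>v x \<noteq> 0\<^sub>v n"
  let ?r = "mat_rank B"
  obtain f where f: "lin ?r k f"
    "\<And>c. c \<in> carrier_vec ?r \<Longrightarrow> B *\<^sub>v f c = 0\<^sub>v l \<Longrightarrow> c = 0\<^sub>v ?r"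
    using rank_domain[OF B] by metis
  define R where "R = mat k 1 (\<lambda>(i, j). x $ i)"
  have R: "R \<in> carrier_mat k 1" by (simp add: R_def)
  have Rc: "R *\<^sub>v c = c $ 0 \<cdot>\<^sub>v x" if "c \<in> carrier_vec 1" for c
    using that x by (intro eq_vecI) (auto simp: R_def scalar_prod_def)
  have "?r + 1 \<le> mat_rank A"
  proof (rule rank_ge[OF A])
    show "lin (?r + 1) k (\<lambda>c. f (vec_first c ?r) + R *\<^sub>v vec_last c 1)"
      by (intro lin_add lin_mat[OF R] lin_compose[OF f(1)] lin_first lin_last)
    fix c :: "complex vec"
    assume c: "c \<in> carrier_vec (?r + 1)" "A *\<^sub>v (f (vec_first c ?r) + R *\<^sub>v vec_last c 1) = 0\<^sub>v n"
    define u where "u = f (vec_first c ?r)"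
    define a where "a = vec_last c 1 $ 0"
    have u: "u \<in> carrier_vec k" using lin_carrier[OF f(1)] by (simp add: u_def)
    have eq: "f (vec_first c ?r) + R *\<^sub>v vec_last c 1 = u + a \<cdot>\<^sub>v x" by (simp add: u_def a_def Rc)
    have "B *\<^sub>v (u + a \<cdot>\<^sub>v x) = 0\<^sub>v l" using ker[of "u + a \<cdot>\<^sub>v x"] c(2) u x(1) unfolding eq by simp
    moreover have "a \<cdot>\<^sub>v 0\<^sub>v l = 0\<^sub>v l" by (intro eq_vecI) auto
    ultimately have "B *\<^sub>v u = 0\<^sub>v l"
      using u x mult_mat_vec[OF B x(1)] mult_mat_vec_carrier[OF B u]
      by (simp add: mult_add_distrib_mat_vec[OF B])
    then have first: "vec_first c ?r = 0\<^sub>v ?r" using f(2) by (simp add: u_def)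
    then have "u = 0\<^sub>v k" using lin_zero_arg[OF f(1)] by (simp add: u_def)
    then have "a \<cdot>\<^sub>v (A *\<^sub>v x) = 0\<^sub>v n"
      using c(2) x(1) mult_mat_vec[OF A x(1)] unfolding eq by simp
    then have "a = 0"
    proof -
      obtain i where i: "i < n" "(A *\<^sub>v x) $ i \<noteq> 0"
        using ne mult_mat_vec_carrier[OF A x(1)]
        by (metis carrier_vecD eq_vecI index_zero_vec)
      have "(a \<cdot>\<^sub>v (A *\<^sub>v x)) $ i = a * (A *\<^sub>v x) $ i"
        using i A by (intro index_smult_vec) simp
      then show ?thesis using \<open>a \<cdot>\<^sub>v (A *\<^sub>v x) = 0\<^sub>v n\<close> i by simp
    qed
    then have "vec_last c 1 = 0\<^sub>v 1" by (intro eq_vecI) (auto simp: a_def)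
    with first show "c = 0\<^sub>v (?r + 1)" using vec_split_cases[OF c(1)] by blast
  qed
  then show False using rank by simp
qed

context block_data begin

lemma hermitian_solutions_iff:
  "X \<in> hermitian_solutions B4 A4 \<longleftrightarrow> solution A1 B1 A4 B4 m1 n m X"
  using block_data_axioms by (auto simp: hermitian_solutions_def solution_def solution_axioms_def)

lemma nonneg_solutions_iff:
  "X \<in> nonneg_solutions B4 A4 \<longleftrightarrow> solution A1 B1 A4 B4 m1 n m X \<and> pos_semidef X"
  using block_data_axioms
  by (auto simp: nonneg_solutions_def solution_def solution_axioms_def pos_semidef_def)

text \<open>If \<open>A4\<^sup>H = Y G\<close> for the Gram matrix \<open>G = A4 B4\<^sup>H\<close>, then \<open>Y G Y\<^sup>H\<close> is the smallest solution.\<close>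

lemma minimal_solution_exists:
  assumes psd: "pos_semidef (A4 * B4\<^sup>H)" and rank: "mat_rank (A4 * B4\<^sup>H) = mat_rank A4"
  obtains X Z where "X \<in> nonneg_solutions B4 A4" "Z \<in> carrier_mat m n" "X = A4\<^sup>H * Z"
proof -
  define G where "G = A4 * B4\<^sup>H"
  have G: "G \<in> carrier_mat m m" unfolding G_def by (rule mult_carrier_mat[of _ m n]) simp_all
  have G_herm: "hermitian G" using psd by (simp add: pos_semidef_def G_def)
  have G_adj: "G = B4 * A4\<^sup>H"
    using G_herm mat_adjoint_mult[OF A4 adj_carrier(2)] by (simp add: hermitian_def G_def)
  \<comment> \<open>Since \<open>G = B4 A4\<^sup>H\<close>, the kernel of \<open>A4\<^sup>H\<close>
    lies in that of \<open>G\<close>; equal ranks make the kernels equal, which is what the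
    factorization \<open>A4\<^sup>H = Y G\<close> requires.\<close>
  have "A4\<^sup>H *\<^sub>v w = 0\<^sub>v n" if w: "w \<in> carrier_vec m" "G *\<^sub>v w = 0\<^sub>v m" for w
  proof (rule kernel_subset_of_rank_le[OF adj_carrier(3) G _ _ w])
    show "mat_rank (A4\<^sup>H) \<le> mat_rank G" using rank rank_adjoint[OF A4] by (simp add: G_def)
    fix v assume "v \<in> carrier_vec m" "A4\<^sup>H *\<^sub>v v = 0\<^sub>v n"
    then show "G *\<^sub>v v = 0\<^sub>v m"
      unfolding G_adj using assoc_mult_mat_vec[OF B4 adj_carrier(3)] mult_mat_vec_zero[OF B4] by simp
  qed
  then obtain Y where Y: "Y \<in> carrier_mat n m" "A4\<^sup>H = Y * G"
    by (rule factor_through_kernel[OF adj_carrier(3) G])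
  have YH: "Y\<^sup>H \<in> carrier_mat m n" using Y by simp
  define X where "X = A4\<^sup>H * Y\<^sup>H"
  have X: "X \<in> carrier_mat n n" unfolding X_def using mult_carrier_mat[OF adj_carrier(3) YH] .
  have X_eq: "X = (Y\<^sup>H)\<^sup>H * G * Y\<^sup>H" using Y by (simp add: X_def)
  have "hermitian X" unfolding X_eq by (rule hermitian_congruence[OF G G_herm YH])
  moreover have "0 \<le> quad_form X v" if v: "v \<in> carrier_vec n" for v
    unfolding X_eq quad_form_congruence[OF G YH v]
    using psd mult_mat_vec_carrier[OF YH v] carrier_matD(1)[OF G] by (simp add: pos_semidef_def G_def)
  ultimately have "pos_semidef X" using X by (simp add: pos_semidef_def)
  moreover have "B4 * X = A4"
  proof -
    have "B4 * X = G * Y\<^sup>H" unfolding X_def G_adj using assoc_mult_mat[OF B4 adj_carrier(3) YH] by simp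
    also have "\<dots> = (Y * G)\<^sup>H" using mat_adjoint_mult[OF Y(1) G] G_herm by (simp add: hermitian_def)
    also have "\<dots> = A4" unfolding Y(2)[symmetric] by simp
    finally show ?thesis .
  qed
  ultimately show thesis
    using X YH by (intro that[of X "Y\<^sup>H"]) (auto simp: nonneg_solutions_def X_def)
qed

end

context solution begin

lemma range_subset: "mat_range A4 \<subseteq> mat_range B4"
proof -
  have "mat_range A4 = {y \<in> carrier_vec m. \<exists>x\<in>carrier_vec n. A4 *\<^sub>v x = y}"
    using vec_space.col_space_eq[OF A4] by simp
  moreover have "mat_range B4 = {y \<in> carrier_vec m. \<exists>x\<in>carrier_vec n. B4 *\<^sub>v x = y}"
    using vec_space.col_space_eq[OF B4] by simp
  ultimately show ?thesis using A4_vec X_vec by fastforce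
qed

lemma gram_pos_semidef:
  assumes "pos_semidef X" shows "pos_semidef (A4 * B4\<^sup>H)"
  using gram_hermitian quad_form_gram_eq assms carrier_matD(1)[OF X]
  by (auto simp: pos_semidef_def)

text \<open>Writing the product as \<open>B4 * A4\<^sup>H\<close> settles one inequality. For the
  other, \<open>A4 B4\<^sup>H w = 0\<close> makes the form of \<open>X\<close> vanish at
  \<open>B4\<^sup>H w\<close>, and semidefiniteness gives
  \<open>A4\<^sup>H w = X B4\<^sup>H w = 0\<close>.\<close>

lemma gram_rank:
  assumes psd: "pos_semidef X" shows "mat_rank (A4 * B4\<^sup>H) = mat_rank A4"
proof (rule antisym)
  have G: "A4 * B4\<^sup>H \<in> carrier_mat m m" by (rule mult_carrier_mat[of _ m n]) simp_all
  have GH: "A4 * B4\<^sup>H = B4 * A4\<^sup>H"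
    using gram_hermitian mat_adjoint_mult[OF A4 adj_carrier(2)] by (simp add: hermitian_def)
  have "mat_rank (A4 * B4\<^sup>H) \<le> mat_rank (A4\<^sup>H)"
    using rank_le_rank[OF G adj_carrier(3)] assoc_mult_mat_vec[OF B4 adj_carrier(3)]
      mult_mat_vec_zero[OF B4] by (simp add: GH)
  then show "mat_rank (A4 * B4\<^sup>H) \<le> mat_rank A4" using rank_adjoint[OF A4] by simp
  have "mat_rank (A4\<^sup>H) \<le> mat_rank (A4 * B4\<^sup>H)"
  proof (rule rank_le_rank[OF adj_carrier(3) G])
    fix w assume w: "w \<in> carrier_vec m" "A4 * B4\<^sup>H *\<^sub>v w = 0\<^sub>v m"
    then have "quad_form X (B4\<^sup>H *\<^sub>v w) = 0"
      using quad_form_gram_eq[OF w(1)] by (simp add: quad_form_re_inner[of "A4 * B4\<^sup>H"])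
    then show "A4\<^sup>H *\<^sub>v w = 0\<^sub>v n" using pos_semidef_kernel[OF X psd] w(1) by (simp add: A4_adj_vec)
  qed
  then show "mat_rank A4 \<le> mat_rank (A4 * B4\<^sup>H)" using rank_adjoint[OF A4] by simp
qed

text \<open>Two Hermitian solutions differ by \<open>Z = K Z K\<^sup>H\<close> with \<open>K\<close> the projection onto the kernel of
  \<open>B4\<close>, and \<open>Z\<close> is at most a multiple of \<open>K K\<^sup>H\<close>.\<close>

lemma dominating_solution:
  assumes X0: "X0 \<in> nonneg_solutions B4 A4"
  obtains X' where "X' \<in> nonneg_solutions B4 A4"
    "\<And>x. x \<in> carrier_vec m1 \<Longrightarrow> quad_form (P X') x \<le> quad_form (P X) x"
proof -
  interpret X0: solution A1 B1 A4 B4 m1 n m X0 using X0 nonneg_solutions_iff by blast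
  have psd: "pos_semidef X0" using X0 nonneg_solutions_iff by blast
  obtain K where K: "K \<in> carrier_mat n n" "B4 * K = 0\<^sub>m m n"
    "\<And>y. y \<in> carrier_vec n \<Longrightarrow> B4 *\<^sub>v y = 0\<^sub>v m \<Longrightarrow> K *\<^sub>v y = y"
    using kernel_projection by metis
  define Z where "Z = X - X0"
  have Z: "Z \<in> carrier_mat n n" unfolding Z_def by (rule minus_carrier_mat) simp
  have Z_herm: "hermitian Z" unfolding Z_def by (rule hermitian_minus[OF X X0.X X_herm X0.X_herm])
  have Zy: "Z *\<^sub>v y \<in> carrier_vec n" if "y \<in> carrier_vec n" for y
    using mult_mat_vec_carrier[OF Z that] .
  have KZ: "K *\<^sub>v (Z *\<^sub>v y) = Z *\<^sub>v y" if y: "y \<in> carrier_vec n" for y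
  proof (rule K(3)[OF Zy[OF y]])
    have "Z *\<^sub>v y = X *\<^sub>v y - X0 *\<^sub>v y"
      unfolding Z_def using y by (intro minus_mult_distrib_mat_vec[of _ n n]) auto
    then have "B4 *\<^sub>v (Z *\<^sub>v y) = A4 *\<^sub>v y - A4 *\<^sub>v y"
      using y mult_minus_distrib_mat_vec[OF B4 X_vec[OF y] X0.X_vec[OF y]] A4_vec[OF y] X0.A4_vec[OF y]
      by simp
    then show "B4 *\<^sub>v (Z *\<^sub>v y) = 0\<^sub>v m" using y by simp
  qed
  have KH: "K\<^sup>H \<in> carrier_mat n n" using K by simp
  \<comment> \<open>The range of \<open>Z\<close> lies in the kernel of \<open>B4\<close>, which
    \<open>K\<close> fixes, so \<open>K Z = Z\<close>; by symmetry \<open>K\<^sup>H\<close> may be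
    inserted in both arguments of the form.\<close>
  have qZ: "quad_form Z y = quad_form Z (K\<^sup>H *\<^sub>v y)" if y: "y \<in> carrier_vec n" for y
  proof -
    have Ky: "K\<^sup>H *\<^sub>v y \<in> carrier_vec n" using KH y by (rule mult_mat_vec_carrier)
    have "re_inner (Z *\<^sub>v v) y = re_inner (Z *\<^sub>v v) (K\<^sup>H *\<^sub>v y)" if v: "v \<in> carrier_vec n" for v
      using re_inner_adjoint[OF K(1) Zy[OF v] y] KZ[OF v] by simp
    from this[OF y] this[OF Ky] show ?thesis
      using hermitian_re_inner[OF Z Z_herm y Ky] by (simp add: quad_form_re_inner)
  qed
  obtain t where t: "0 < t" "\<And>y. y \<in> carrier_vec n \<Longrightarrow> quad_form Z y \<le> t * re_inner y y"
    using quad_form_bounded[OF Z Z_herm] by metis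
  define X' where "X' = X0 + complex_of_real t \<cdot>\<^sub>m (K * K\<^sup>H)"
  show thesis
  proof (rule that[of X'])
    show "X' \<in> nonneg_solutions B4 A4"
      unfolding nonneg_solutions_iff X'_def
      using X0.solution_add_gram(1,3)[OF K(1,2)] psd t(1) by simp
    fix x :: "complex vec" assume x: "x \<in> carrier_vec m1"
    have Kx: "K\<^sup>H *\<^sub>v (B1\<^sup>H *\<^sub>v x) \<in> carrier_vec n" using mult_mat_vec_carrier[OF KH] x by simp
    have "quad_form (P X') x = quad_form (P X0) x - t * re_inner (K\<^sup>H *\<^sub>v (B1\<^sup>H *\<^sub>v x)) (K\<^sup>H *\<^sub>v (B1\<^sup>H *\<^sub>v x))"
      unfolding X'_def by (rule X0.solution_add_gram(2)[OF K(1,2) x])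
    also have "\<dots> \<le> quad_form (P X0) x - quad_form Z (B1\<^sup>H *\<^sub>v x)"
      using t(2)[OF Kx] qZ[of "B1\<^sup>H *\<^sub>v x"] x by simp
    also have "\<dots> = quad_form (P X) x"
      using x by (simp add: quad_form_P Z_def quad_form_mat_minus[of _ n])
    finally show "quad_form (P X') x \<le> quad_form (P X) x" .
  qed
qed

end

text \<open>\<open>S\<close> is infinite in general, whereas \<open>Max\<close> and
  \<open>Min\<close> are determined only on finite nonempty sets. The values are natural numbers
  below a bound; a maximizer supplies it, while \<open>Min_image_eq\<close> needs a separate bound
  \<open>k\<close>.\<close>

lemma Max_image_eq:
  fixes f :: "'a \<Rightarrow> nat"
  assumes "a \<in> S" "\<And>x. x \<in> S \<Longrightarrow> f x \<le> f a"
  shows "Max (f ` S) = f a"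
proof (rule Max_eqI)
  have "f ` S \<subseteq> {..f a}" using assms by auto
  then show "finite (f ` S)" by (rule finite_subset) simp
qed (use assms in auto)

lemma Min_image_eq:
  fixes f :: "'a \<Rightarrow> nat"
  assumes "a \<in> S" "\<And>x. x \<in> S \<Longrightarrow> f a \<le> f x" "\<And>x. x \<in> S \<Longrightarrow> f x \<le> k"
  shows "Min (f ` S) = f a"
proof (rule Min_eqI)
  have "f ` S \<subseteq> {..k}" using assms by auto
  then show "finite (f ` S)" by (rule finite_subset) simp
qed (use assms in auto)

section \<open>Relations for all nonnegative solutions and the three extremal ones\<close>

context block_data begin

context
  fixes S
  assumes S: "S = nonneg_solutions B4 A4" and ne: "S \<noteq> {}"
begin

lemma S_bounds:
  assumes "X \<in> S"
  shows "mat_rank (P X) = i\<^sub>+ (P X) + i\<^sub>- (P X)" "mat_rank (P X) \<le> m1"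
    "mat_rank (P X) + mat_rank B4 \<le> mat_rank M1" "mat_rank M1 \<le> i\<^sub>+ (P X) + i\<^sub>- N"
    "i\<^sub>- (P X) + mat_rank B4 \<le> i\<^sub>- N" "i\<^sub>- M2 \<le> i\<^sub>- (P X)" "i\<^sub>+ (P X) + mat_rank A4 \<le> i\<^sub>+ M2"
proof -
  have psd: "pos_semidef X" using assms S nonneg_solutions_iff by blast
  interpret I: solution A1 B1 A4 B4 m1 n m X using assms S nonneg_solutions_iff by blast
  show "mat_rank (P X) = i\<^sub>+ (P X) + i\<^sub>- (P X)" using rank_eq_inertia[OF I.P_carr I.P_herm] .
  show "mat_rank (P X) \<le> m1" using rank_le_dim[OF I.P_carr] by simp
  show "mat_rank (P X) + mat_rank B4 \<le> mat_rank M1" by (rule I.rank_P_upper)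
  show "mat_rank M1 \<le> i\<^sub>+ (P X) + i\<^sub>- N" by (rule I.rank_M1_le)
  show "i\<^sub>- (P X) + mat_rank B4 \<le> i\<^sub>- N" by (rule I.neg_inertia_P_upper)
  show "i\<^sub>- M2 \<le> i\<^sub>- (P X)" by (rule I.neg_inertia_P_lower[OF psd])
  show "i\<^sub>+ (P X) + mat_rank A4 \<le> i\<^sub>+ M2" by (rule I.pos_inertia_P_upper[OF psd])
qed

lemma S_minimal:
  obtains X where "X \<in> S" "i\<^sub>- (P X) = i\<^sub>- M2" "i\<^sub>+ (P X) + mat_rank A4 = i\<^sub>+ M2"
proof -
  obtain X1 where "solution A1 B1 A4 B4 m1 n m X1" "pos_semidef X1"
    using ne S nonneg_solutions_iff by blast
  then have "pos_semidef (A4 * B4\<^sup>H)" "mat_rank (A4 * B4\<^sup>H) = mat_rank A4"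
    by (rule solution.gram_pos_semidef, rule solution.gram_rank)
  then obtain X Z where X: "X \<in> nonneg_solutions B4 A4" "Z \<in> carrier_mat m n" "X = A4\<^sup>H * Z"
    by (rule minimal_solution_exists)
  interpret I: solution A1 B1 A4 B4 m1 n m X using X nonneg_solutions_iff by blast
  show thesis
    using I.minimal_solution_inertia[OF X(2,3)] S_bounds[of X] X(1) S by (intro that[of X]) auto
qed

text \<open>Only the lower bound on \<open>i\<^sub>- (P X')\<close> is new. With it the chain
  \<open>r(P X') + r(B4) \<le> r(M1) \<le> i\<^sub>+ (P X') + i\<^sub>- N = r(P X') + r(B4)\<close>
  collapses, which gives all three equations.\<close>

lemma S_large:
  obtains X where "X \<in> S" "i\<^sub>- (P X) + mat_rank B4 = i\<^sub>- N" "i\<^sub>+ (P X) + i\<^sub>- N = mat_rank M1"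
    "mat_rank (P X) + mat_rank B4 = mat_rank M1"
proof -
  obtain X where X: "solution A1 B1 A4 B4 m1 n m X" "pos_semidef X"
    using ne S nonneg_solutions_iff by blast
  interpret I: solution A1 B1 A4 B4 m1 n m X by (rule X)
  obtain K where K: "K \<in> carrier_mat n n" "B4 * K = 0\<^sub>m m n"
    "\<And>y. y \<in> carrier_vec n \<Longrightarrow> B4 *\<^sub>v y = 0\<^sub>v m \<Longrightarrow> K *\<^sub>v y = y"
    using kernel_projection by metis
  obtain t where t: "0 < t" "i\<^sub>- N \<le> i\<^sub>- (P (X + complex_of_real t \<cdot>\<^sub>m (K * K\<^sup>H))) + mat_rank B4"
    using I.large_solution_inertia[OF K(1,3,2)] by metis
  define X' where "X' = X + complex_of_real t \<cdot>\<^sub>m (K * K\<^sup>H)"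
  have "X' \<in> S"
    unfolding S nonneg_solutions_iff X'_def using I.solution_add_gram(1,3)[OF K(1,2)] X(2) t(1) by simp
  then show thesis
    using S_bounds[of X'] t(2) by (intro that[of X']) (auto simp: X'_def)
qed

text \<open>Among the solutions with minimal \<open>i\<^sub>-\<close>, one with the least
  \<open>i\<^sub>+\<close> is taken. A descent step would stay in this class, because
  \<open>i\<^sub>- M2\<close> is a lower bound on all of \<open>S\<close>, and so contradict the
  choice.\<close>

lemma S_min_rank:
  obtains X where "X \<in> S" "i\<^sub>- (P X) = i\<^sub>- M2" "i\<^sub>+ (P X) + i\<^sub>- N = mat_rank M1"
proof -
  let ?Q = "\<lambda>X. X \<in> S \<and> i\<^sub>- (P X) = i\<^sub>- M2"
  have "\<exists>X. ?Q X" using S_minimal by metis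
  then obtain X where X: "?Q X" "\<And>X'. ?Q X' \<Longrightarrow> i\<^sub>+ (P X) \<le> i\<^sub>+ (P X')"
    using ex_has_least_nat[of ?Q _ "\<lambda>X. i\<^sub>+ (P X)"] by metis
  have psd: "pos_semidef X" and sol: "solution A1 B1 A4 B4 m1 n m X"
    using X(1) S nonneg_solutions_iff by auto
  interpret I: solution A1 B1 A4 B4 m1 n m X by (rule sol)
  have "i\<^sub>+ (P X) + i\<^sub>- N \<le> mat_rank M1"
  proof (rule ccontr)
    assume "\<not> ?thesis"
    then obtain X' where X': "solution A1 B1 A4 B4 m1 n m X'" "pos_semidef X'"
      "i\<^sub>+ (P X') < i\<^sub>+ (P X)" "i\<^sub>- (P X') \<le> i\<^sub>- (P X)"
      using I.descent[OF psd] by (metis not_le)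
    then have "X' \<in> S" using S nonneg_solutions_iff by blast
    then have "?Q X'" using S_bounds(6)[of X'] X'(4) X(1) by simp
    then show False using X(2) X'(3) by fastforce
  qed
  then show thesis using X(1) S_bounds(4)[of X] by (intro that[of X]) auto
qed

end

end

text \<open>Differences are stated in \<open>int\<close>, as subtraction of naturals truncates. The
  statements over \<open>T\<close> are those decided by solutions with small \<open>P X\<close>,
  namely (f), (g), (j), (k), since every Hermitian solution is dominated as in
  \<open>dominating_solution\<close>. For (e), (h), (i), (l) the range has to be \<open>S\<close>:
  with all sizes 1, \<open>A1 = -1\<close>, \<open>B1 = 1\<close> and \<open>A4 = B4 = 0\<close>,
  the Hermitian solution \<open>X = -2\<close> has \<open>P X = 1\<close>, although
  \<open>M2\<close> is diagonal with entries -1 and 0 and \<open>P X < 0\<close> on all of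
  \<open>S\<close>.\<close>

theorem theorem4p2:
  fixes A1 B1 A4 B4 M1 M2 N :: "complex mat" and m1 n m :: nat
    and S T :: "complex mat set" and P :: "complex mat \<Rightarrow> complex mat"
  assumes A1: "A1 \<in> carrier_mat m1 m1" "hermitian A1"
    and B1: "B1 \<in> carrier_mat m1 n"
    and A4: "A4 \<in> carrier_mat m n"
    and B4: "B4 \<in> carrier_mat m n"
    and S: "S = nonneg_solutions B4 A4"
    and T: "T = hermitian_solutions B4 A4"
    and P: "P = (\<lambda>X. A1 - B1 * X * B1\<^sup>H)"
    and M1: "M1 = four_block_mat A1 B1 (A4 * B1\<^sup>H) B4"
    and M2: "M2 = four_block_mat A1 (B1 * A4\<^sup>H) (A4 * B1\<^sup>H) (A4 * B4\<^sup>H)"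
    and N: "N = block33 A1 B1 (0\<^sub>m m1 m)
                        (B1\<^sup>H) (0\<^sub>m n n) (B4\<^sup>H)
                        (0\<^sub>m m m1) B4 (- (A4 * B4\<^sup>H))"
  shows
    "(S \<noteq> {} \<longleftrightarrow> mat_range A4 \<subseteq> mat_range B4 \<and> pos_semidef (A4 * B4\<^sup>H) \<and>
                 mat_rank (A4 * B4\<^sup>H) = mat_rank A4) \<and>
     (S \<noteq> {} \<longrightarrow>
       int (Max ((\<lambda>X. mat_rank (P X)) ` S)) = int (mat_rank M1) - int (mat_rank B4) \<and>
       int (Min ((\<lambda>X. mat_rank (P X)) ` S)) = int (mat_rank M1) + int (i\<^sub>- M2) - int (i\<^sub>- N) \<and>
       int (Max ((\<lambda>X. i\<^sub>+ (P X)) ` S)) = int (i\<^sub>+ M2) - int (mat_rank A4) \<and>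
       int (Min ((\<lambda>X. i\<^sub>+ (P X)) ` S)) = int (mat_rank M1) - int (i\<^sub>- N) \<and>
       int (Max ((\<lambda>X. i\<^sub>- (P X)) ` S)) = int (i\<^sub>- N) - int (mat_rank B4) \<and>
       Min ((\<lambda>X. i\<^sub>- (P X)) ` S) = i\<^sub>- M2 \<and>
       \<comment> \<open>(a)\<close> ((\<exists>X\<in>S. invertible_mat (P X)) \<longleftrightarrow> mat_rank M1 = mat_rank B4 + m1) \<and>
       \<comment> \<open>(b)\<close> ((\<forall>X\<in>S. invertible_mat (P X)) \<longleftrightarrow> mat_rank M1 + i\<^sub>- M2 = i\<^sub>- N + m1) \<and>
       \<comment> \<open>(c)\<close> ((\<exists>X\<in>S. B1 * X * B1\<^sup>H = A1) \<longleftrightarrow> mat_rank M1 + i\<^sub>- M2 = i\<^sub>- N) \<and>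
       \<comment> \<open>(d)\<close> ((\<forall>X\<in>S. B1 * X * B1\<^sup>H = A1) \<longleftrightarrow> mat_rank M1 = mat_rank B4) \<and>
       \<comment> \<open>(e)\<close> ((\<exists>X\<in>S. pos_def (P X)) \<longleftrightarrow> i\<^sub>+ M2 = mat_rank A4 + m1) \<and>
       \<comment> \<open>(f)\<close> ((\<forall>X\<in>S. pos_def (P X)) \<longleftrightarrow> mat_rank M1 = i\<^sub>- N + m1) \<and>
               ((\<forall>X\<in>T. pos_def (P X)) \<longleftrightarrow> mat_rank M1 = i\<^sub>- N + m1) \<and>
       \<comment> \<open>(g)\<close> ((\<exists>X\<in>S. neg_def (P X)) \<longleftrightarrow> i\<^sub>- N = mat_rank B4 + m1) \<and>
               ((\<exists>X\<in>T. neg_def (P X)) \<longleftrightarrow> i\<^sub>- N = mat_rank B4 + m1) \<and>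
       \<comment> \<open>(h)\<close> ((\<forall>X\<in>S. neg_def (P X)) \<longleftrightarrow> i\<^sub>- M2 = m1) \<and>
       \<comment> \<open>(i)\<close> ((\<exists>X\<in>S. pos_semidef (P X)) \<longleftrightarrow> pos_semidef M2) \<and>
       \<comment> \<open>(j)\<close> ((\<forall>X\<in>S. pos_semidef (P X)) \<longleftrightarrow> i\<^sub>- N = mat_rank B4) \<and>
               ((\<forall>X\<in>T. pos_semidef (P X)) \<longleftrightarrow> i\<^sub>- N = mat_rank B4) \<and>
       \<comment> \<open>(k)\<close> ((\<exists>X\<in>S. neg_semidef (P X)) \<longleftrightarrow> mat_rank M1 = i\<^sub>- N) \<and>
               ((\<exists>X\<in>T. neg_semidef (P X)) \<longleftrightarrow> mat_rank M1 = i\<^sub>- N) \<and>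
       \<comment> \<open>(l)\<close> ((\<forall>X\<in>S. neg_semidef (P X)) \<longleftrightarrow> i\<^sub>+ M2 = mat_rank A4))"
proof (intro conjI impI)
  interpret D: block_data A1 B1 A4 B4 m1 n m
    using A1 B1 A4 B4 by unfold_locales
  show "S \<noteq> {} \<longleftrightarrow> mat_range A4 \<subseteq> mat_range B4 \<and> pos_semidef (A4 * B4\<^sup>H) \<and>
      mat_rank (A4 * B4\<^sup>H) = mat_rank A4"
  proof
    assume "S \<noteq> {}"
    then obtain X where X: "solution A1 B1 A4 B4 m1 n m X" "pos_semidef X"
      using S D.nonneg_solutions_iff by blast
    show "mat_range A4 \<subseteq> mat_range B4 \<and> pos_semidef (A4 * B4\<^sup>H) \<and>
        mat_rank (A4 * B4\<^sup>H) = mat_rank A4"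
      using solution.range_subset[OF X(1)] solution.gram_pos_semidef[OF X] solution.gram_rank[OF X]
      by blast
  next
    assume "mat_range A4 \<subseteq> mat_range B4 \<and> pos_semidef (A4 * B4\<^sup>H) \<and>
        mat_rank (A4 * B4\<^sup>H) = mat_rank A4"
    then show "S \<noteq> {}" using D.minimal_solution_exists S by (metis empty_iff)
  qed
  assume ne: "S \<noteq> {}"
  have defs: "P = D.P" "M1 = D.M1" "M2 = D.M2" "N = D.N"
    by (auto simp: P M1 M2 N D.P_def D.M1_def D.M2_def D.N_def)
  note bounds = D.S_bounds[OF S ne, folded defs]
  obtain X0 where X0: "X0 \<in> S" "i\<^sub>- (P X0) = i\<^sub>- M2" "i\<^sub>+ (P X0) + mat_rank A4 = i\<^sub>+ M2"
    using D.S_minimal[OF S ne] unfolding defs by metis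
  obtain X1 where X1: "X1 \<in> S" "i\<^sub>- (P X1) + mat_rank B4 = i\<^sub>- N" "i\<^sub>+ (P X1) + i\<^sub>- N = mat_rank M1"
    "mat_rank (P X1) + mat_rank B4 = mat_rank M1"
    using D.S_large[OF S ne] unfolding defs by metis
  obtain X2 where X2: "X2 \<in> S" "i\<^sub>- (P X2) = i\<^sub>- M2" "i\<^sub>+ (P X2) + i\<^sub>- N = mat_rank M1"
    using D.S_min_rank[OF S ne] unfolding defs by metis
  have max_rank: "mat_rank (P X) \<le> mat_rank (P X1)" if "X \<in> S" for X
    using bounds(3)[OF that] X1(4) by linarith
  have min_rank: "mat_rank (P X2) \<le> mat_rank (P X)" if "X \<in> S" for X
    using bounds(1,4,6)[OF that] bounds(1)[OF X2(1)] X2(2,3) by linarith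
  have max_pos: "i\<^sub>+ (P X) \<le> i\<^sub>+ (P X0)" if "X \<in> S" for X
    using bounds(7)[OF that] X0(3) by linarith
  have min_pos: "i\<^sub>+ (P X1) \<le> i\<^sub>+ (P X)" if "X \<in> S" for X
    using bounds(4)[OF that] X1(3) by linarith
  have max_neg: "i\<^sub>- (P X) \<le> i\<^sub>- (P X1)" if "X \<in> S" for X
    using bounds(5)[OF that] X1(2) by linarith
  have min_neg: "i\<^sub>- (P X0) \<le> i\<^sub>- (P X)" if "X \<in> S" for X
    using bounds(6)[OF that] X0(2) by linarith
  have dim: "mat_rank (P X) \<le> m1" "i\<^sub>+ (P X) \<le> m1" "i\<^sub>- (P X) \<le> m1" if "X \<in> S" for X
    using bounds(1,2)[OF that] by linarith+
  show "int (Max ((\<lambda>X. mat_rank (P X)) ` S)) = int (mat_rank M1) - int (mat_rank B4)"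
    using Max_image_eq[of X1 S "\<lambda>X. mat_rank (P X)"] max_rank X1 by simp
  show "int (Min ((\<lambda>X. mat_rank (P X)) ` S)) = int (mat_rank M1) + int (i\<^sub>- M2) - int (i\<^sub>- N)"
    using Min_image_eq[of X2 S "\<lambda>X. mat_rank (P X)" m1] min_rank dim X2 bounds(1)[OF X2(1)] by simp
  show "int (Max ((\<lambda>X. i\<^sub>+ (P X)) ` S)) = int (i\<^sub>+ M2) - int (mat_rank A4)"
    using Max_image_eq[of X0 S "\<lambda>X. i\<^sub>+ (P X)"] max_pos X0 by simp
  show "int (Min ((\<lambda>X. i\<^sub>+ (P X)) ` S)) = int (mat_rank M1) - int (i\<^sub>- N)"
    using Min_image_eq[of X1 S "\<lambda>X. i\<^sub>+ (P X)" m1] min_pos dim X1 by simp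
  show "int (Max ((\<lambda>X. i\<^sub>- (P X)) ` S)) = int (i\<^sub>- N) - int (mat_rank B4)"
    using Max_image_eq[of X1 S "\<lambda>X. i\<^sub>- (P X)"] max_neg X1 by simp
  show "Min ((\<lambda>X. i\<^sub>- (P X)) ` S) = i\<^sub>- M2"
    using Min_image_eq[of X0 S "\<lambda>X. i\<^sub>- (P X)" m1] min_neg dim X0 by simp
  have T_sol: "X \<in> T \<longleftrightarrow> solution A1 B1 A4 B4 m1 n m X" for X
    using T D.hermitian_solutions_iff by simp
  have ST: "S \<subseteq> T" using S T_sol D.nonneg_solutions_iff by auto
  have PT: "P X \<in> carrier_mat m1 m1" "hermitian (P X)" if "X \<in> T" for X
    using that unfolding T_sol defs by (auto intro: solution.P_carr solution.P_herm)
  have PS: "P X \<in> carrier_mat m1 m1" "hermitian (P X)" if "X \<in> S" for X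
    using that ST PT by auto
  have inv: "invertible_mat (P X) \<longleftrightarrow> mat_rank (P X) = m1" if "X \<in> S" for X
    using invertible_mat_iff_rank PS that by blast
  have zero: "B1 * X * B1\<^sup>H = A1 \<longleftrightarrow> mat_rank (P X) = 0" if "X \<in> S" for X
  proof -
    have X: "X \<in> carrier_mat n n"
      using that S D.nonneg_solutions_iff solution.X by blast
    have C: "B1 * X * B1\<^sup>H \<in> carrier_mat m1 m1"
      using mult_carrier_mat[OF mult_carrier_mat[OF B1 X] D.adj_carrier(1)] .
    have "P X = 0\<^sub>m m1 m1 \<longleftrightarrow> B1 * X * B1\<^sup>H = A1"
    proof
      assume 0: "P X = 0\<^sub>m m1 m1"
      show "B1 * X * B1\<^sup>H = A1"
      proof (rule eq_matI)
        fix i j assume ij: "i < dim_row A1" "j < dim_col A1"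
        then have "P X $$ (i, j) = A1 $$ (i, j) - (B1 * X * B1\<^sup>H) $$ (i, j)"
          unfolding P using C by (intro index_minus_mat) auto
        then show "(B1 * X * B1\<^sup>H) $$ (i, j) = A1 $$ (i, j)" using 0 ij by simp
      qed (use C in auto)
    next
      assume "B1 * X * B1\<^sup>H = A1"
      then show "P X = 0\<^sub>m m1 m1" using A1 by (simp add: P)
    qed
    then show ?thesis using rank_eq_0_iff[OF PS(1)[OF that]] by simp
  qed
  have pd: "pos_def (P X) \<longleftrightarrow> i\<^sub>+ (P X) = m1" "neg_def (P X) \<longleftrightarrow> i\<^sub>- (P X) = m1"
    "pos_semidef (P X) \<longleftrightarrow> i\<^sub>- (P X) = 0" "neg_semidef (P X) \<longleftrightarrow> i\<^sub>+ (P X) = 0" if "X \<in> S" for X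
    using pos_inertia_eq_dim_iff[OF PS[OF that]] neg_inertia_eq_dim_iff[OF PS[OF that]]
      neg_inertia_eq_0_iff[OF PS[OF that]] pos_inertia_eq_0_iff[OF PS[OF that]] by auto
  \<comment> \<open>From here each quantifier is decided at one extremal solution: the values lie
    between 0 and \<open>m1\<close>, so an end of this interval is reached by some solution, or by
    all, exactly if the appropriate maximizer or minimizer reaches it.\<close>
  show "(\<exists>X\<in>S. invertible_mat (P X)) \<longleftrightarrow> mat_rank M1 = mat_rank B4 + m1"
  proof -
    have "(\<exists>X\<in>S. invertible_mat (P X)) \<longleftrightarrow> mat_rank (P X1) = m1"
      using inv max_rank dim(1) X1(1) by (metis antisym)
    then show ?thesis using X1(4) by linarith
  qed
  show "(\<forall>X\<in>S. invertible_mat (P X)) \<longleftrightarrow> mat_rank M1 + i\<^sub>- M2 = i\<^sub>- N + m1"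
  proof -
    have "(\<forall>X\<in>S. invertible_mat (P X)) \<longleftrightarrow> mat_rank (P X2) = m1"
      using inv min_rank dim(1) X2(1) by (metis antisym)
    then show ?thesis using X2(2,3) bounds(1)[OF X2(1)] by linarith
  qed
  show "(\<exists>X\<in>S. B1 * X * B1\<^sup>H = A1) \<longleftrightarrow> mat_rank M1 + i\<^sub>- M2 = i\<^sub>- N"
  proof -
    have "(\<exists>X\<in>S. B1 * X * B1\<^sup>H = A1) \<longleftrightarrow> mat_rank (P X2) = 0"
      using zero min_rank X2(1) by (metis le_zero_eq)
    then show ?thesis using X2(2,3) bounds(1)[OF X2(1)] by linarith
  qed
  show "(\<forall>X\<in>S. B1 * X * B1\<^sup>H = A1) \<longleftrightarrow> mat_rank M1 = mat_rank B4"
  proof -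
    have "(\<forall>X\<in>S. B1 * X * B1\<^sup>H = A1) \<longleftrightarrow> mat_rank (P X1) = 0"
      using zero max_rank X1(1) by (metis le_zero_eq)
    then show ?thesis using X1(4) by linarith
  qed
  show "(\<exists>X\<in>S. pos_def (P X)) \<longleftrightarrow> i\<^sub>+ M2 = mat_rank A4 + m1"
  proof -
    have "(\<exists>X\<in>S. pos_def (P X)) \<longleftrightarrow> i\<^sub>+ (P X0) = m1"
      using pd(1) max_pos dim(2) X0(1) by (metis antisym)
    then show ?thesis using X0(3) by linarith
  qed
  show f: "(\<forall>X\<in>S. pos_def (P X)) \<longleftrightarrow> mat_rank M1 = i\<^sub>- N + m1"
  proof -
    have "(\<forall>X\<in>S. pos_def (P X)) \<longleftrightarrow> i\<^sub>+ (P X1) = m1"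
      using pd(1) min_pos dim(2) X1(1) by (metis antisym)
    then show ?thesis using X1(3) by linarith
  qed
  show g: "(\<exists>X\<in>S. neg_def (P X)) \<longleftrightarrow> i\<^sub>- N = mat_rank B4 + m1"
  proof -
    have "(\<exists>X\<in>S. neg_def (P X)) \<longleftrightarrow> i\<^sub>- (P X1) = m1"
      using pd(2) max_neg dim(3) X1(1) by (metis antisym)
    then show ?thesis using X1(2) by linarith
  qed
  show "(\<forall>X\<in>S. neg_def (P X)) \<longleftrightarrow> i\<^sub>- M2 = m1"
    using pd(2) min_neg dim(3) X0(1,2) by (metis antisym)
  show "(\<exists>X\<in>S. pos_semidef (P X)) \<longleftrightarrow> pos_semidef M2"
  proof -
    have "solution A1 B1 A4 B4 m1 n m X0" using X0(1) ST T_sol by blast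
    then have "pos_semidef M2 \<longleftrightarrow> i\<^sub>- M2 = 0"
      using neg_inertia_eq_0_iff[OF D.M2_carrier solution.M2_hermitian] by (simp add: defs)
    moreover have "(\<exists>X\<in>S. pos_semidef (P X)) \<longleftrightarrow> i\<^sub>- (P X0) = 0"
      using pd(3) min_neg X0(1) by (metis le_zero_eq)
    ultimately show ?thesis using X0(2) by simp
  qed
  show j: "(\<forall>X\<in>S. pos_semidef (P X)) \<longleftrightarrow> i\<^sub>- N = mat_rank B4"
  proof -
    have "(\<forall>X\<in>S. pos_semidef (P X)) \<longleftrightarrow> i\<^sub>- (P X1) = 0"
      using pd(3) max_neg X1(1) by (metis le_zero_eq)
    then show ?thesis using X1(2) by linarith
  qed
  show k: "(\<exists>X\<in>S. neg_semidef (P X)) \<longleftrightarrow> mat_rank M1 = i\<^sub>- N"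
  proof -
    have "(\<exists>X\<in>S. neg_semidef (P X)) \<longleftrightarrow> i\<^sub>+ (P X1) = 0"
      using pd(4) min_pos X1(1) by (metis le_zero_eq)
    then show ?thesis using X1(3) by linarith
  qed
  show "(\<forall>X\<in>S. neg_semidef (P X)) \<longleftrightarrow> i\<^sub>+ M2 = mat_rank A4"
  proof -
    have "(\<forall>X\<in>S. neg_semidef (P X)) \<longleftrightarrow> i\<^sub>+ (P X0) = 0"
      using pd(4) max_pos X0(1) by (metis le_zero_eq)
    then show ?thesis using X0(3) by linarith
  qed
  \<comment> \<open>\<open>P X'\<close> lies below \<open>P X\<close> as a form, with
    \<open>X'\<close> in \<open>S\<close>: a lower bound valid on \<open>S\<close> passes to all of
    \<open>T\<close>, and an upper bound satisfied somewhere on \<open>T\<close> is satisfied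
    somewhere on \<open>S\<close>.\<close>
  have dominating: "\<exists>X'\<in>S. \<forall>x\<in>carrier_vec m1. quad_form (P X') x \<le> quad_form (P X) x"
    if "X \<in> T" for X
    using solution.dominating_solution[of A1 B1 A4 B4 m1 n m X X0] that X0(1)
    unfolding T_sol S defs by metis
  have dim_P: "dim_row (P X) = m1" if "X \<in> T" for X using PT(1)[OF that] by simp
  have "(\<forall>X\<in>T. pos_def (P X)) \<longleftrightarrow> (\<forall>X\<in>S. pos_def (P X))"
  proof (intro iffI ballI)
    fix X assume all: "\<forall>X\<in>S. pos_def (P X)" and X: "X \<in> T"
    obtain X' where X': "X' \<in> S" "\<forall>x\<in>carrier_vec m1. quad_form (P X') x \<le> quad_form (P X) x"
      using dominating[OF X] by blast
    then have "pos_def (P X')" "dim_row (P X') = m1" using all ST dim_P by auto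
    then show "pos_def (P X)"
      unfolding pos_def_def using PT(2)[OF X] dim_P[OF X] X'(2) by (metis order_less_le_trans)
  qed (use ST in blast)
  with f show "(\<forall>X\<in>T. pos_def (P X)) \<longleftrightarrow> mat_rank M1 = i\<^sub>- N + m1" by simp
  have "(\<forall>X\<in>T. pos_semidef (P X)) \<longleftrightarrow> (\<forall>X\<in>S. pos_semidef (P X))"
  proof (intro iffI ballI)
    fix X assume all: "\<forall>X\<in>S. pos_semidef (P X)" and X: "X \<in> T"
    obtain X' where X': "X' \<in> S" "\<forall>x\<in>carrier_vec m1. quad_form (P X') x \<le> quad_form (P X) x"
      using dominating[OF X] by blast
    then have "pos_semidef (P X')" "dim_row (P X') = m1" using all ST dim_P by auto
    then show "pos_semidef (P X)"
      unfolding pos_semidef_def using PT(2)[OF X] dim_P[OF X] X'(2) by (metis order_trans)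
  qed (use ST in blast)
  with j show "(\<forall>X\<in>T. pos_semidef (P X)) \<longleftrightarrow> i\<^sub>- N = mat_rank B4" by simp
  have "(\<exists>X\<in>T. neg_def (P X)) \<longleftrightarrow> (\<exists>X\<in>S. neg_def (P X))"
  proof
    assume "\<exists>X\<in>T. neg_def (P X)"
    then obtain X where X: "X \<in> T" "neg_def (P X)" by blast
    obtain X' where X': "X' \<in> S" "\<forall>x\<in>carrier_vec m1. quad_form (P X') x \<le> quad_form (P X) x"
      using dominating[OF X(1)] by blast
    have "neg_def (P X')"
      unfolding neg_def_def using PS[OF X'(1)] X'(2) X(2) dim_P[OF X(1)]
      by (metis carrier_matD(1) neg_def_def order_le_less_trans)
    then show "\<exists>X\<in>S. neg_def (P X)" using X'(1) by blast
  qed (use ST in blast)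
  with g show "(\<exists>X\<in>T. neg_def (P X)) \<longleftrightarrow> i\<^sub>- N = mat_rank B4 + m1" by simp
  have "(\<exists>X\<in>T. neg_semidef (P X)) \<longleftrightarrow> (\<exists>X\<in>S. neg_semidef (P X))"
  proof
    assume "\<exists>X\<in>T. neg_semidef (P X)"
    then obtain X where X: "X \<in> T" "neg_semidef (P X)" by blast
    obtain X' where X': "X' \<in> S" "\<forall>x\<in>carrier_vec m1. quad_form (P X') x \<le> quad_form (P X) x"
      using dominating[OF X(1)] by blast
    have "neg_semidef (P X')"
      unfolding neg_semidef_def using PS[OF X'(1)] X'(2) X(2) dim_P[OF X(1)]
      by (metis carrier_matD(1) neg_semidef_def order_trans)
    then show "\<exists>X\<in>S. neg_semidef (P X)" using X'(1) by blast
  qed (use ST in blast)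
  with k show "(\<exists>X\<in>T. neg_semidef (P X)) \<longleftrightarrow> mat_rank M1 = i\<^sub>- N" by simp
qed

end
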